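(* Let $p$ be a prime number, let $\Bbbk$ be an algebraically closed field of characteristic $p$, and let $H$ be a Hopf algebra over $\Bbbk$ with $\dim_\Bbbk H=p$. Then $H$ is isomorphic, as a Hopf algebra, to one of the following: (1) the group algebra $\Bbbk[C_p]$; (2) $\Bbbk[x]/(x^p)$ with comultiplication determined by $\Delta(x)=x\otimes 1+1\otimes x$; (3) $\Bbbk[x]/(x^p-x)$ with comultiplication determined by $\Delta(x)=x\otimes 1+1\otimes x$.
   Context: $C_p$ denotes the cyclic group of order $p$, and $\Bbbk[C_p]$ carries its standard Hopf algebra structure, in which the group elements are group-like. In (2) and (3), $\Bbbk[x]$ is the polynomial algebra in one variable and $\Delta$ is the algebra homomorphism determined by its value on $x$. *)

theory Defs
  imports
    "HOL-Algebra.Algebraic_Closure"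
    "HOL-Algebra.Elementary_Groups"
    "HOL-Algebra.Multiplicative_Group"
    "HOL-Algebra.UnivPoly"
    "HOL-Computational_Algebra.Primes"
    "Jordan_Normal_Form.Missing_VectorSpace"
begin

text \<open>The library's order of an element is $0$ if no positive multiple of it vanishes.\<close>

definition ring_char :: "('k, 'm) ring_scheme \<Rightarrow> nat"
  where "ring_char K = group.ord (add_monoid K) \<one>\<^bsub>K\<^esub>"

text \<open>
  The library locale \<^locale>\<open>algebra\<close> requires a commutative multiplication; here it need not be
  commutative.
\<close>

locale assoc_algebra = module K A + A?: ring A for K and A (structure) +
  assumes smult_mult_left:
      "\<lbrakk>c \<in> carrier K; x \<in> carrier A; y \<in> carrier A\<rbrakk> \<Longrightarrow> (c \<odot> x) \<otimes> y = c \<odot> (x \<otimes> y)"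
    and smult_mult_right:
      "\<lbrakk>c \<in> carrier K; x \<in> carrier A; y \<in> carrier A\<rbrakk> \<Longrightarrow> x \<otimes> (c \<odot> y) = c \<odot> (x \<otimes> y)"

section \<open>Free modules and quotients\<close>

text \<open>
  As in \<^const>\<open>ring.func_space\<close>, the multiplicative fields are dummies: the record type
  \<^typ>\<open>('k, 'b) module\<close> extends that of rings, but only its module part is meant.
\<close>

definition free_module :: "('k, 'm) ring_scheme \<Rightarrow> 'x set \<Rightarrow> ('k, 'x \<Rightarrow> 'k) module"
  where "free_module K V =
    \<lparr>carrier = {u. (\<forall>x. u x \<in> carrier K) \<and> finite {x. u x \<noteq> \<zero>\<^bsub>K\<^esub>} \<and> {x. u x \<noteq> \<zero>\<^bsub>K\<^esub>} \<subseteq> V},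
     monoid.mult = (\<lambda>u v x. \<zero>\<^bsub>K\<^esub>),
     one = (\<lambda>x. \<zero>\<^bsub>K\<^esub>),
     ring.zero = (\<lambda>x. \<zero>\<^bsub>K\<^esub>),
     add = (\<lambda>u v x. u x \<oplus>\<^bsub>K\<^esub> v x),
     smult = (\<lambda>c u x. c \<otimes>\<^bsub>K\<^esub> u x)\<rparr>"

definition free_gen :: "('k, 'm) ring_scheme \<Rightarrow> 'x \<Rightarrow> ('x \<Rightarrow> 'k)"
  where "free_gen K x = (\<lambda>y. if y = x then \<one>\<^bsub>K\<^esub> else \<zero>\<^bsub>K\<^esub>)"

text \<open>The linear map into \<open>M\<close> that sends each generator \<open>x\<close> to \<open>f x\<close>.\<close>

definition lin_ext :: "('k, 'm) ring_scheme \<Rightarrow> ('k, 'b, 'n) module_scheme \<Rightarrow> ('x \<Rightarrow> 'b) \<Rightarrow> ('x \<Rightarrow> 'k) \<Rightarrow> 'b"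
  where "lin_ext K M f u = (\<Oplus>\<^bsub>M\<^esub>x\<in>{x. u x \<noteq> \<zero>\<^bsub>K\<^esub>}. u x \<odot>\<^bsub>M\<^esub> f x)"

text \<open>
  The factor ring \<^term>\<open>A Quot N\<close> with the induced scalar multiplication: an algebra if \<open>N\<close> is an
  ideal of an algebra, and a module (with dummy multiplication) if \<open>N\<close> is a submodule of a module.
\<close>

definition quot_module :: "('k, 'a, 'n) module_scheme \<Rightarrow> 'a set \<Rightarrow> ('k, 'a set) module"
  where "quot_module A N = ring.extend (A Quot N)
    (module.fields (\<lambda>c T. \<Union>t\<in>T. N +>\<^bsub>A\<^esub> (c \<odot>\<^bsub>A\<^esub> t)))"

section \<open>Tensor products\<close>

definition tensor_relations ::
    "('k, 'm) ring_scheme \<Rightarrow> ('k, 'a, 'r) module_scheme \<Rightarrow> ('k, 'b, 's) module_scheme \<Rightarrow> ('a \<times> 'b \<Rightarrow> 'k) set"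
  where "tensor_relations K A B = (let F = free_module K (carrier A \<times> carrier B); g = free_gen K in
      {g (a \<oplus>\<^bsub>A\<^esub> a', b) \<ominus>\<^bsub>F\<^esub> (g (a, b) \<oplus>\<^bsub>F\<^esub> g (a', b)) | a a' b.
          a \<in> carrier A \<and> a' \<in> carrier A \<and> b \<in> carrier B}
    \<union> {g (a, b \<oplus>\<^bsub>B\<^esub> b') \<ominus>\<^bsub>F\<^esub> (g (a, b) \<oplus>\<^bsub>F\<^esub> g (a, b')) | a b b'.
          a \<in> carrier A \<and> b \<in> carrier B \<and> b' \<in> carrier B}
    \<union> {g (c \<odot>\<^bsub>A\<^esub> a, b) \<ominus>\<^bsub>F\<^esub> c \<odot>\<^bsub>F\<^esub> g (a, b) | c a b.
          c \<in> carrier K \<and> a \<in> carrier A \<and> b \<in> carrier B}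
    \<union> {g (a, c \<odot>\<^bsub>B\<^esub> b) \<ominus>\<^bsub>F\<^esub> c \<odot>\<^bsub>F\<^esub> g (a, b) | c a b.
          c \<in> carrier K \<and> a \<in> carrier A \<and> b \<in> carrier B})"

definition tensor_null ::
    "('k, 'm) ring_scheme \<Rightarrow> ('k, 'a, 'r) module_scheme \<Rightarrow> ('k, 'b, 's) module_scheme \<Rightarrow> ('a \<times> 'b \<Rightarrow> 'k) set"
  where "tensor_null K A B =
    module.span K (free_module K (carrier A \<times> carrier B)) (tensor_relations K A B)"

definition tensor_module ::
    "('k, 'm) ring_scheme \<Rightarrow> ('k, 'a, 'r) module_scheme \<Rightarrow> ('k, 'b, 's) module_scheme \<Rightarrow>
      ('k, ('a \<times> 'b \<Rightarrow> 'k) set) module"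
  where "tensor_module K A B =
    quot_module (free_module K (carrier A \<times> carrier B)) (tensor_null K A B)"

text \<open>The element $a \otimes b$.\<close>

definition pure_tensor ::
    "('k, 'm) ring_scheme \<Rightarrow> ('k, 'a, 'r) module_scheme \<Rightarrow> ('k, 'b, 's) module_scheme \<Rightarrow>
      'a \<Rightarrow> 'b \<Rightarrow> ('a \<times> 'b \<Rightarrow> 'k) set"
  where "pure_tensor K A B a b =
    tensor_null K A B +>\<^bsub>free_module K (carrier A \<times> carrier B)\<^esub> free_gen K (a, b)"

text \<open>
  The linear map into \<open>M\<close> induced by a bilinear \<open>f\<close>, that is, $a \otimes b \mapsto f\,a\,b$. For bilinear
  \<open>f\<close> the value does not depend on the chosen representative of the coset.
\<close>

definition tensor_lift ::
    "('k, 'm) ring_scheme \<Rightarrow> ('k, 'c, 'r) module_scheme \<Rightarrow> ('a \<Rightarrow> 'b \<Rightarrow> 'c) \<Rightarrow> ('a \<times> 'b \<Rightarrow> 'k) set \<Rightarrow> 'c"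
  where "tensor_lift K M f T = lin_ext K M (\<lambda>(a, b). f a b) (SOME u. u \<in> T)"

text \<open>The tensor product of two algebras, with $(a \otimes b)(a' \otimes b') = aa' \otimes bb'$.\<close>

definition tensor_algebra ::
    "('k, 'm) ring_scheme \<Rightarrow> ('k, 'a, 'r) module_scheme \<Rightarrow> ('k, 'b, 's) module_scheme \<Rightarrow>
      ('k, ('a \<times> 'b \<Rightarrow> 'k) set) module"
  where "tensor_algebra K A B = (tensor_module K A B)
    \<lparr>monoid.mult := (\<lambda>S T. tensor_lift K (tensor_module K A B)
        (\<lambda>a b. tensor_lift K (tensor_module K A B)
          (\<lambda>a' b'. pure_tensor K A B (a \<otimes>\<^bsub>A\<^esub> a') (b \<otimes>\<^bsub>B\<^esub> b')) T) S),
     one := pure_tensor K A B \<one>\<^bsub>A\<^esub> \<one>\<^bsub>B\<^esub>\<rparr>"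

text \<open>The linear map $f \otimes g$ into the tensor product of \<open>A\<close> and \<open>B\<close>.\<close>

definition tensor_map ::
    "('k, 'm) ring_scheme \<Rightarrow> ('k, 'a, 'r) module_scheme \<Rightarrow> ('k, 'b, 's) module_scheme \<Rightarrow>
      ('c \<Rightarrow> 'a) \<Rightarrow> ('d \<Rightarrow> 'b) \<Rightarrow> ('c \<times> 'd \<Rightarrow> 'k) set \<Rightarrow> ('a \<times> 'b \<Rightarrow> 'k) set"
  where "tensor_map K A B f g =
    tensor_lift K (tensor_module K A B) (\<lambda>c d. pure_tensor K A B (f c) (g d))"

text \<open>The canonical map $(a \otimes b) \otimes c \mapsto a \otimes (b \otimes c)$.\<close>

definition tensor_assoc ::
    "('k, 'm) ring_scheme \<Rightarrow> ('k, 'a, 'r) module_scheme \<Rightarrow> ('k, 'b, 's) module_scheme \<Rightarrow>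
      ('k, 'c, 't) module_scheme \<Rightarrow>
      (('a \<times> 'b \<Rightarrow> 'k) set \<times> 'c \<Rightarrow> 'k) set \<Rightarrow> ('a \<times> ('b \<times> 'c \<Rightarrow> 'k) set \<Rightarrow> 'k) set"
  where "tensor_assoc K A B C =
    (let M = tensor_module K A (tensor_module K B C) in
      tensor_lift K M (\<lambda>t c. tensor_lift K M
        (\<lambda>a b. pure_tensor K A (tensor_module K B C) a (pure_tensor K B C b c)) t))"

section \<open>Hopf algebras\<close>

record ('k, 'a) hopf_algebra = "('k, 'a) module" +
  comult :: "'a \<Rightarrow> ('a \<times> 'a \<Rightarrow> 'k) set"
  counit :: "'a \<Rightarrow> 'k"
  antipode :: "'a \<Rightarrow> 'a"

text \<open>
  The counit axioms identify $K \otimes H$ and $H \otimes K$ with $H$; in Sweedler notation they say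
  $\varepsilon(h_1) h_2 = h = \varepsilon(h_2) h_1$, and the antipode axioms say
  $S(h_1) h_2 = \varepsilon(h) 1 = h_1 S(h_2)$.
\<close>

locale hopf_algebra = vectorspace K H + assoc_algebra K H
  for K :: "('k, 'm) ring_scheme" and H :: "('k, 'h, 'n) hopf_algebra_scheme" (structure) +
  assumes comult_linear: "comult H \<in> module_hom K H (tensor_algebra K H H)"
    and comult_ring_hom: "comult H \<in> ring_hom H (tensor_algebra K H H)"
    and counit_linear:
      "\<lbrakk>c \<in> carrier K; h \<in> carrier H\<rbrakk> \<Longrightarrow> counit H (c \<odot> h) = c \<otimes>\<^bsub>K\<^esub> counit H h"
    and counit_ring_hom: "counit H \<in> ring_hom H K"
    and coassoc: "h \<in> carrier H \<Longrightarrow>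
      tensor_assoc K H H H (tensor_map K (tensor_module K H H) H (comult H) (\<lambda>x. x) (comult H h))
        = tensor_map K H (tensor_module K H H) (\<lambda>x. x) (comult H) (comult H h)"
    and counit_left: "h \<in> carrier H \<Longrightarrow>
      tensor_lift K H (\<lambda>a b. counit H a \<odot> b) (comult H h) = h"
    and counit_right: "h \<in> carrier H \<Longrightarrow>
      tensor_lift K H (\<lambda>a b. counit H b \<odot> a) (comult H h) = h"
    and antipode_linear: "antipode H \<in> module_hom K H H"
    and antipode_left: "h \<in> carrier H \<Longrightarrow>
      tensor_lift K H (\<lambda>a b. antipode H a \<otimes> b) (comult H h) = counit H h \<odot> \<one>"
    and antipode_right: "h \<in> carrier H \<Longrightarrow>
      tensor_lift K H (\<lambda>a b. a \<otimes> antipode H b) (comult H h) = counit H h \<odot> \<one>"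

definition hopf_iso ::
    "('k, 'm) ring_scheme \<Rightarrow> ('k, 'a, 'r) hopf_algebra_scheme \<Rightarrow> ('k, 'b, 's) hopf_algebra_scheme \<Rightarrow>
      ('a \<Rightarrow> 'b) set"
  where "hopf_iso K H L =
    {\<phi>. \<phi> \<in> ring_iso H L \<and> \<phi> \<in> module_hom K H L \<and>
        (\<forall>h\<in>carrier H.
            comult L (\<phi> h) = tensor_map K L L \<phi> \<phi> (comult H h) \<and>
            counit L (\<phi> h) = counit H h \<and>
            antipode L (\<phi> h) = \<phi> (antipode H h))}"

definition is_hopf_iso ::
    "('k, 'm) ring_scheme \<Rightarrow> ('k, 'a, 'r) hopf_algebra_scheme \<Rightarrow> ('k, 'b, 's) hopf_algebra_scheme \<Rightarrow> bool"
  where "is_hopf_iso K H L \<longleftrightarrow> hopf_iso K H L \<noteq> {}"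

section \<open>Group algebras\<close>

definition group_algebra :: "('k, 'm) ring_scheme \<Rightarrow> ('g, 'n) monoid_scheme \<Rightarrow> ('k, 'g \<Rightarrow> 'k) module"
  where "group_algebra K G = (let F = free_module K (carrier G) in
    F\<lparr>monoid.mult := (\<lambda>u v. lin_ext K F (\<lambda>x. lin_ext K F (\<lambda>y. free_gen K (x \<otimes>\<^bsub>G\<^esub> y)) v) u),
      one := free_gen K \<one>\<^bsub>G\<^esub>\<rparr>)"

text \<open>Group elements are group-like: $\Delta(g) = g \otimes g$, $\varepsilon(g) = 1$, $S(g) = g^{-1}$.\<close>

definition group_hopf_algebra ::
    "('k, 'm) ring_scheme \<Rightarrow> ('g, 'n) monoid_scheme \<Rightarrow> ('k, 'g \<Rightarrow> 'k) hopf_algebra"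
  where "group_hopf_algebra K G = (let A = group_algebra K G in
    module.extend A (hopf_algebra.fields
      (lin_ext K (tensor_module K A A) (\<lambda>g. pure_tensor K A A (free_gen K g) (free_gen K g)))
      (\<lambda>u. \<Oplus>\<^bsub>K\<^esub>g\<in>{g. u g \<noteq> \<zero>\<^bsub>K\<^esub>}. u g)
      (lin_ext K A (\<lambda>g. free_gen K (inv\<^bsub>G\<^esub> g)))))"

section \<open>Quotients of the polynomial algebra in one variable\<close>

definition poly_var :: "('k, 'm) ring_scheme \<Rightarrow> (nat \<Rightarrow> 'k)"
  where "poly_var K = monom (UP K) \<one>\<^bsub>K\<^esub> 1"

definition poly_quot :: "('k, 'm) ring_scheme \<Rightarrow> (nat \<Rightarrow> 'k) \<Rightarrow> ('k, (nat \<Rightarrow> 'k) set) module"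
  where "poly_quot K f = quot_module (UP K) (PIdl\<^bsub>UP K\<^esub> f)"

definition poly_quot_var :: "('k, 'm) ring_scheme \<Rightarrow> (nat \<Rightarrow> 'k) \<Rightarrow> (nat \<Rightarrow> 'k) set"
  where "poly_quot_var K f = PIdl\<^bsub>UP K\<^esub> f +>\<^bsub>UP K\<^esub> poly_var K"

text \<open>
  The algebra homomorphism from $K[x]/(f)$ to \<open>B\<close> sending $x$ to \<open>s\<close>. If \<open>s\<close> is a root of \<open>f\<close>, the
  value does not depend on the chosen representative of the coset.
\<close>

definition poly_quot_eval ::
    "('k, 'm) ring_scheme \<Rightarrow> ('k, 'b, 'n) module_scheme \<Rightarrow> 'b \<Rightarrow> (nat \<Rightarrow> 'k) set \<Rightarrow> 'b"
  where "poly_quot_eval K B s T = eval K B (\<lambda>c. c \<odot>\<^bsub>B\<^esub> \<one>\<^bsub>B\<^esub>) s (SOME q. q \<in> T)"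

text \<open>
  $K[x]/(f)$ with $x$ primitive: $\Delta(x) = x \otimes 1 + 1 \otimes x$, $\varepsilon(x) = 0$,
  $S(x) = -x$, extended to algebra homomorphisms. This is a Hopf algebra only for suitable \<open>f\<close>, such
  as $x^p$ and $x^p - x$ in characteristic $p$.
\<close>

definition primitive_hopf_algebra ::
    "('k, 'm) ring_scheme \<Rightarrow> (nat \<Rightarrow> 'k) \<Rightarrow> ('k, (nat \<Rightarrow> 'k) set) hopf_algebra"
  where "primitive_hopf_algebra K f = (let A = poly_quot K f; x = poly_quot_var K f; T = tensor_algebra K A A in
    module.extend A (hopf_algebra.fields
      (poly_quot_eval K T (pure_tensor K A A x \<one>\<^bsub>A\<^esub> \<oplus>\<^bsub>T\<^esub> pure_tensor K A A \<one>\<^bsub>A\<^esub> x))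
      (\<lambda>S. eval K K (\<lambda>c. c) \<zero>\<^bsub>K\<^esub> (SOME q. q \<in> S))
      (poly_quot_eval K A (\<ominus>\<^bsub>A\<^esub> x))))"

end

theory Submission
  imports Defs "HOL-Analysis.Determinants"
begin

text \<open>
  Everything takes place in coordinates, with $H$ and $H^*$ on the same footing. A non-trivial
  group-like element of $H$ has $p$ linearly independent powers, and so has a non-zero primitive
  element; hence either of them generates $H$, and in the primitive case a rescaling (a root of
  degree $p-1$) gives $x^p \in \{0, x\}$. A non-trivial group-like element $\alpha$ of $H^*$ gives the
  primitive element $\alpha^i \mapsto i$ of $H$, and a non-zero primitive element of $H^*$ gives a
  primitive or a group-like element of $H$ in the same way. It remains to find a non-trivial
  group-like or a non-zero primitive element in $H$ or $H^*$.

  If there is no non-trivial group-like element, then both $H$ and $H^*$ are unimodular, and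
  $S^4 = 1$ by Radford's argument. For integrals $l \in H^*$ and $L \in H$, the trace of
  $x \mapsto a S^2(x)$ is $\varepsilon(L)\, l(S(a))$ up to a non-zero factor. Since $p = 0$ in the
  field, the regular character of $H^*$ is a square-zero element of $H$; with it as $a$, the formula
  yields $\varepsilon(L)\, l(1) = 0$ (Larson and Radford). So $S^2$ has trace zero. An idempotent
  endomorphism of a $p$-dimensional space with trace zero is $0$ or $1$, which applied to
  $(1 + S^2)/2$ gives $S^2 = 1$.

  Say $\varepsilon(L) = 0$. Then the regular character of $H$ vanishes, so $H$ has no idempotents
  except $0$ and $1$. If the augmentation ideal $I$ were equal to $I^2$, a minimal left ideal
  $J \subseteq I$ with $I J \neq 0$ would contain an idempotent; so $I^2 \neq I$, and a non-zero
  functional on $I/I^2$ is a primitive element of $H^*$.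
\<close>

section \<open>Sweedler calculus in coordinates\<close>

text \<open>Two facts tie dim H = p to p = 0 in the field. The rank of an endomorphism lies between
  0 and p, so it vanishes in the field only at the two ends; and the regular character
  \<open>reg\<close> satisfies reg \<star> reg = p reg = 0. Together they stand in for freeness over
  Hopf subalgebras: a group-like element of order n with 1 < n < p would give an idempotent average
  of its powers on which \<open>reg\<close> vanishes, hence 0 or 1, and it can be neither. They also
  explain why S^4 = 1 has to be sharpened: the trace formula concerns x -> a S^2(x), and only S^2 =
  1 turns its trace into the regular character of H. For p = 2 the map (1 + S^2)/2 does not exist,
  and S^2 - 1 is treated as a nilpotent map instead. Sweedler identities are sums over structure
  constants tested against functionals: coassociativity is then an exchange of nested sums, and
  duality a permutation of indices. Abstract tensor products enter only to extract the constants and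
  to transport the generator back.\<close>

definition pr :: "'a::field^'n::finite \<Rightarrow> 'a^'n \<Rightarrow> 'a"
  where "pr f a = (\<Sum>i\<in>UNIV. f$i * a$i)"

definition mulv :: "('n::finite \<Rightarrow> 'n \<Rightarrow> 'n \<Rightarrow> 'a::field) \<Rightarrow> 'a^'n \<Rightarrow> 'a^'n \<Rightarrow> 'a^'n"
  where "mulv m a b = (\<chi> k. \<Sum>i\<in>UNIV. \<Sum>j\<in>UNIV. a$i * b$j * m i j k)"

definition applyv :: "('n::finite \<Rightarrow> 'n \<Rightarrow> 'a::field) \<Rightarrow> 'a^'n \<Rightarrow> 'a^'n"
  where "applyv s a = (\<chi> j. \<Sum>i\<in>UNIV. a$i * s i j)"

text \<open>The Sweedler sum $\sum F(a_{(1)}, a_{(2)})$; only its values at basis vectors enter.\<close>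

definition sw :: "('n::finite \<Rightarrow> 'n \<Rightarrow> 'n \<Rightarrow> 'a::field) \<Rightarrow> 'a^'n \<Rightarrow> ('a^'n \<Rightarrow> 'a^'n \<Rightarrow> 'a) \<Rightarrow> 'a"
  where "sw d a F = (\<Sum>i\<in>UNIV. \<Sum>j\<in>UNIV. (\<Sum>k\<in>UNIV. a$k * d k i j) * F (axis i 1) (axis j 1))"

text \<open>Integrands of \<open>sw\<close> are scalars while operators are vector-valued; two
  predicates let the rules \<open>lin\<close> compose a functional with an operator.\<close>

definition slin :: "('a::field^'n::finite \<Rightarrow> 'a) \<Rightarrow> bool"
  where "slin F \<longleftrightarrow> (\<forall>x y. F (x + y) = F x + F y) \<and> (\<forall>c x. F (c *s x) = c * F x)"

definition vlin :: "('a::field^'n::finite \<Rightarrow> 'a^'m::finite) \<Rightarrow> bool"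
  where "vlin G \<longleftrightarrow> (\<forall>x y. G (x + y) = G x + G y) \<and> (\<forall>c x. G (c *s x) = c *s G x)"

lemma slinI: "(\<And>x y. F (x + y) = F x + F y) \<Longrightarrow> (\<And>c x. F (c *s x) = c * F x) \<Longrightarrow> slin F"
  by (simp add: slin_def)

lemma slin_add: "slin F \<Longrightarrow> F (x + y) = F x + F y"
  and slin_scale: "slin F \<Longrightarrow> F (c *s x) = c * F x"
  by (simp_all add: slin_def)

lemma vlinI: "(\<And>x y. G (x + y) = G x + G y) \<Longrightarrow> (\<And>c x. G (c *s x) = c *s G x) \<Longrightarrow> vlin G"
  by (simp add: vlin_def)

lemma vlin_add: "vlin G \<Longrightarrow> G (x + y) = G x + G y"
  and vlin_scale: "vlin G \<Longrightarrow> G (c *s x) = c *s G x"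
  by (simp_all add: vlin_def)

lemma slin_zero: "slin F \<Longrightarrow> F 0 = 0"
  using slin_scale[of F 0 0] by simp

lemma vlin_zero: "vlin F \<Longrightarrow> F 0 = 0"
  using vlin_scale[of F 0 0] by simp

lemma slin_sum_arg: "slin F \<Longrightarrow> F (\<Sum>i\<in>A. g i) = (\<Sum>i\<in>A. F (g i))"
  by (induction A rule: infinite_finite_induct) (simp_all add: slin_zero slin_add)

lemma vlin_sum_arg: "vlin F \<Longrightarrow> F (\<Sum>i\<in>A. g i) = (\<Sum>i\<in>A. F (g i))"
  by (induction A rule: infinite_finite_induct) (simp_all add: vlin_zero vlin_add)

lemma vlin_linear: "vlin G \<longleftrightarrow> Vector_Spaces.linear (*s) (*s) G"
  unfolding vlin_def Vector_Spaces.linear_iff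
  by (simp add: vec.vector_space_axioms)

lemma slin_expand: "slin F \<Longrightarrow> F a = (\<Sum>i\<in>UNIV. a$i * F (axis i 1))"
  by (subst basis_expansion[symmetric], subst slin_sum_arg) (simp_all add: slin_scale)

lemma vlin_expand: "vlin F \<Longrightarrow> F a = (\<Sum>i\<in>UNIV. a$i *s F (axis i 1))"
  by (subst basis_expansion[symmetric], subst vlin_sum_arg) (simp_all add: vlin_scale)

lemma slin_eqI: "slin F \<Longrightarrow> slin G \<Longrightarrow> (\<And>i. F (axis i 1) = G (axis i 1)) \<Longrightarrow> F a = G a"
  using slin_expand[of F a] slin_expand[of G a] by simp

lemma vlin_eqI: "vlin F \<Longrightarrow> vlin G \<Longrightarrow> (\<And>i. F (axis i 1) = G (axis i 1)) \<Longrightarrow> F a = G a"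
  using vlin_expand[of F a] vlin_expand[of G a] by simp

lemma slin_comp: "slin F \<Longrightarrow> vlin G \<Longrightarrow> slin (\<lambda>x. F (G x))"
  by (rule slinI) (simp_all add: vlin_add vlin_scale slin_add slin_scale)

text \<open>The Sweedler rules ask for linearity in one slot of an integrand;
  \<open>intro lin\<close> settles this by the shape of the term.\<close>

named_theorems lin

lemma pr_commute: "pr f a = pr a f"
  by (simp add: pr_def mult.commute)

lemma pr_add_l: "pr (f + g) a = pr f a + pr g a" and pr_add_r: "pr f (a + b) = pr f a + pr f b"
  and pr_scale_l: "pr (c *s f) a = c * pr f a" and pr_scale_r: "pr f (c *s a) = c * pr f a"
  and pr_diff_l: "pr (f - g) a = pr f a - pr g a" and pr_diff_r: "pr f (a - b) = pr f a - pr f b"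
  and pr_zero_l [simp]: "pr 0 a = 0" and pr_zero_r [simp]: "pr f 0 = 0"
  by (simp_all add: pr_def algebra_simps sum.distrib sum_distrib_left sum_subtractf)

lemma pr_sum_r: "pr f (\<Sum>i\<in>A. g i) = (\<Sum>i\<in>A. pr f (g i))"
  by (induction A rule: infinite_finite_induct) (simp_all add: pr_add_r)

lemma pr_sum_l: "pr (\<Sum>i\<in>A. g i) f = (\<Sum>i\<in>A. pr (g i) f)"
  by (induction A rule: infinite_finite_induct) (simp_all add: pr_add_l)

lemma pr_axis_l [simp]: "pr (axis i 1) a = a$i"
  by (simp add: pr_def axis_def if_distrib[of "\<lambda>x. x * _"] cong: if_cong)

lemma pr_axis_r [simp]: "pr f (axis i 1) = f$i"
  by (subst pr_commute) simp

lemma pr_eqI: "(\<And>f. pr f a = pr f b) \<Longrightarrow> a = b"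
  by (metis pr_axis_l vec_eq_iff)

lemma pr_eqI2: "(\<And>a. pr f a = pr g a) \<Longrightarrow> f = g"
  by (metis pr_axis_r vec_eq_iff)

text \<open>The transposed matrix is the adjoint for \<open>pr\<close>; hence the antipode of the
  dual is the transpose of \<open>s\<close>.\<close>

lemma applyv_adjoint: "pr (applyv (\<lambda>i j. s j i) f) a = pr f (applyv s a)"
  unfolding pr_def applyv_def
  by (simp add: sum_distrib_left sum_distrib_right) (subst sum.swap, simp add: ac_simps)

lemma vlin_id [lin]: "vlin (\<lambda>x. x)"
  by (rule vlinI) simp_all

lemma vlin_mulv_r [lin]: "vlin G \<Longrightarrow> vlin (\<lambda>x. mulv m a (G x))"
  by (rule vlinI) (simp_all add: vlin_add vlin_scale mulv_def vec_eq_iff algebra_simps sum.distrib sum_distrib_left)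

lemma vlin_mulv_l [lin]: "vlin G \<Longrightarrow> vlin (\<lambda>x. mulv m (G x) b)"
  by (rule vlinI) (simp_all add: vlin_add vlin_scale mulv_def vec_eq_iff algebra_simps sum.distrib sum_distrib_left)

lemma vlin_applyv [lin]: "vlin G \<Longrightarrow> vlin (\<lambda>x. applyv s (G x))"
  by (rule vlinI) (simp_all add: vlin_add vlin_scale applyv_def vec_eq_iff algebra_simps sum.distrib sum_distrib_left)

lemma vlin_plus [lin]: "vlin F \<Longrightarrow> vlin G \<Longrightarrow> vlin (\<lambda>x. F x + G x)"
  by (rule vlinI) (simp_all add: vlin_add vlin_scale algebra_simps vec.scale_right_distrib)

lemma vlin_minus [lin]: "vlin F \<Longrightarrow> vlin G \<Longrightarrow> vlin (\<lambda>x. F x - G x)"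
  by (rule vlinI) (simp_all add: vlin_add vlin_scale algebra_simps vec.scale_right_diff_distrib)

lemma vlin_scaled [lin]: "vlin F \<Longrightarrow> vlin (\<lambda>x. c *s F x)"
  by (rule vlinI) (simp_all add: vlin_add vlin_scale algebra_simps vec.scale_right_distrib)

lemma slin_pr_r [lin]: "vlin G \<Longrightarrow> slin (\<lambda>x. pr f (G x))"
  by (rule slinI) (simp_all add: vlin_add vlin_scale pr_add_r pr_scale_r)

lemma slin_pr_l [lin]: "vlin G \<Longrightarrow> slin (\<lambda>x. pr (G x) a)"
  by (rule slinI) (simp_all add: vlin_add vlin_scale pr_add_l pr_scale_l)

lemma slin_mult_l [lin]: "slin F \<Longrightarrow> slin (\<lambda>x. F x * c)"
  by (rule slinI) (simp_all add: slin_add slin_scale algebra_simps)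

lemma slin_mult_r [lin]: "slin F \<Longrightarrow> slin (\<lambda>x. c * F x)"
  by (rule slinI) (simp_all add: slin_add slin_scale algebra_simps)

lemma slin_sum [lin]: "(\<And>i. slin (F i)) \<Longrightarrow> slin (\<lambda>x. \<Sum>i\<in>A. F i x)"
  by (rule slinI) (simp_all add: slin_add slin_scale sum.distrib sum_distrib_left)

lemma slin_nth [lin]: "vlin G \<Longrightarrow> slin (\<lambda>x. G x $ i)"
  by (rule slinI) (simp_all add: vlin_add vlin_scale)

lemma slin_sw [lin]: "(\<And>p q. slin (\<lambda>x. F x p q)) \<Longrightarrow> slin (\<lambda>x. sw d a (F x))"
  unfolding sw_def by (intro lin)

lemma slin_sw_arg [lin]: "vlin G \<Longrightarrow> slin (\<lambda>x. sw d (G x) F)"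
  unfolding sw_def
  by (intro slin_sum slin_mult_l, rule slinI)
     (simp_all add: vlin_add vlin_scale algebra_simps sum.distrib sum_distrib_left)

lemma sw_cong: "(\<And>x y. F x y = G x y) \<Longrightarrow> sw d a F = sw d a G"
  by (simp add: sw_def)

lemma sw_cmult: "sw d a (\<lambda>x y. c * F x y) = c * sw d a F"
  and sw_cmult_r: "sw d a (\<lambda>x y. F x y * c) = sw d a F * c"
  by (simp_all add: sw_def sum_distrib_left sum_distrib_right ac_simps)

lemma sw_sum: "sw d a (\<lambda>x y. \<Sum>i\<in>A. F i x y) = (\<Sum>i\<in>A. sw d a (F i))"
  by (induction A rule: infinite_finite_induct) (simp_all add: sw_def distrib_left sum.distrib)

lemma sw_swap: "sw d a (\<lambda>x y. sw d' b (F x y)) = sw d' b (\<lambda>p q. sw d a (\<lambda>x y. F x y p q))"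
  unfolding sw_def[of d' b] by (simp add: sw_sum sw_cmult)

lemma sw_axis: "sw d (axis k 1) F = (\<Sum>i\<in>UNIV. \<Sum>j\<in>UNIV. d k i j * F (axis i 1) (axis j 1))"
  by (simp add: sw_def axis_def if_distrib[of "\<lambda>x. x * _"] cong: if_cong)

lemma mulv_axis: "mulv m (axis i 1) (axis j 1) = (\<chi> k. m i j k)"
  by (simp add: mulv_def vec_eq_iff axis_def if_distrib[of "\<lambda>x. x * _"] if_distrib[of "\<lambda>x. _ * x"] cong: if_cong)

text \<open>The coefficient of b_i \<otimes> b_j in \<Delta>(a) is the value at a of a product of
  two dual basis vectors. Facts about the multiplication of the dual thus become facts about
  Sweedler sums.\<close>

lemma sw_alt: "sw d a F
   = (\<Sum>i\<in>UNIV. \<Sum>j\<in>UNIV. pr (mulv (\<lambda>i j k. d k i j) (axis i 1) (axis j 1)) a * F (axis i 1) (axis j 1))"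
  by (simp add: sw_def mulv_axis pr_def mult.commute)

lemma bilin_expand:
  assumes "\<And>y. slin (\<lambda>x. F x y)" "\<And>x. slin (F x)"
  shows "F x y = (\<Sum>i\<in>UNIV. \<Sum>j\<in>UNIV. x$i * y$j * F (axis i 1) (axis j 1))"
  by (subst slin_expand[OF assms(1)], subst slin_expand[OF assms(2)])
     (simp add: sum_distrib_left mult.assoc)

lemma pr_conv: "pr (mulv (\<lambda>i j k. d k i j) f g) a = sw d a (\<lambda>x y. pr f x * pr g y)"
proof (rule slin_eqI[where a = a])
  show "slin (pr (mulv (\<lambda>i j k. d k i j) f g))" by (intro lin)
  show "slin (\<lambda>a. sw d a (\<lambda>x y. pr f x * pr g y))" by (intro lin)
qed (simp add: sw_axis mulv_def algebra_simps)

lemma sum_move2: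
  "(\<Sum>a\<in>A. \<Sum>b\<in>B. \<Sum>t\<in>T. f a b t) = (\<Sum>t\<in>T. \<Sum>a\<in>A. \<Sum>b\<in>B. (f a b t :: 'c::comm_monoid_add))"
proof -
  have "(\<Sum>a\<in>A. \<Sum>b\<in>B. \<Sum>t\<in>T. f a b t) = (\<Sum>a\<in>A. \<Sum>t\<in>T. \<Sum>b\<in>B. f a b t)"
    by (rule sum.cong[OF refl], rule sum.swap)
  then show ?thesis by (simp only: sum.swap[of _ T A])
qed

text \<open>
  Structure constants with respect to a basis $b_i$: $b_i b_j = \sum_k m_{ijk} b_k$,
  $\Delta(b_k) = \sum_{i,j} d_{kij}\, b_i \otimes b_j$, $S(b_i) = \sum_j s_{ij} b_j$. Functionals
  are coordinate vectors as well, \<open>pr\<close> is the evaluation pairing, and exchanging \<open>m\<close> with \<open>d\<close> and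
  \<open>u\<close> with \<open>e\<close> passes to the dual Hopf algebra.
\<close>

locale hopf_constants =
  fixes m d :: "'n::finite \<Rightarrow> 'n \<Rightarrow> 'n \<Rightarrow> 'a::field" and u e :: "'a^'n" and s :: "'n \<Rightarrow> 'n \<Rightarrow> 'a"
  assumes assoc0: "\<And>i j k l. (\<Sum>x\<in>UNIV. m i j x * m x k l) = (\<Sum>x\<in>UNIV. m j k x * m i x l)"
    and unit_l0: "\<And>i j. (\<Sum>x\<in>UNIV. u$x * m x i j) = (if i = j then 1 else 0)"
    and unit_r0: "\<And>i j. (\<Sum>x\<in>UNIV. u$x * m i x j) = (if i = j then 1 else 0)"
    and coassoc0: "\<And>k a b c. (\<Sum>x\<in>UNIV. d k x c * d x a b) = (\<Sum>x\<in>UNIV. d k a x * d x b c)"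
    and counit_l0: "\<And>k j. (\<Sum>x\<in>UNIV. e$x * d k x j) = (if k = j then 1 else 0)"
    and counit_r0: "\<And>k j. (\<Sum>x\<in>UNIV. e$x * d k j x) = (if k = j then 1 else 0)"
    and bialg0: "\<And>i j a b. (\<Sum>k\<in>UNIV. m i j k * d k a b) =
      (\<Sum>i1\<in>UNIV. \<Sum>i2\<in>UNIV. \<Sum>j1\<in>UNIV. \<Sum>j2\<in>UNIV. d i i1 i2 * d j j1 j2 * m i1 j1 a * m i2 j2 b)"
    and unit_d0: "\<And>a b. (\<Sum>k\<in>UNIV. u$k * d k a b) = u$a * u$b"
    and counit_m0: "\<And>i j. (\<Sum>k\<in>UNIV. e$k * m i j k) = e$i * e$j"
    and counit_unit0: "(\<Sum>k\<in>UNIV. e$k * u$k) = 1"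
    and anti_l0: "\<And>k l. (\<Sum>a\<in>UNIV. \<Sum>b\<in>UNIV. \<Sum>c\<in>UNIV. d k a b * s a c * m c b l) = e$k * u$l"
    and anti_r0: "\<And>k l. (\<Sum>a\<in>UNIV. \<Sum>b\<in>UNIV. \<Sum>c\<in>UNIV. d k a b * s b c * m a c l) = e$k * u$l"
begin

text \<open>Transposition permutes the axioms: associativity and coassociativity change places, as
  do unit and counit laws, while the bialgebra and antipode axioms return to themselves up to the
  order of summation.\<close>

lemma dual: "hopf_constants (\<lambda>i j k. d k i j) (\<lambda>k i j. m i j k) e u (\<lambda>i j. s j i)"
proof (unfold_locales, goal_cases)
  case (1 i j k l) then show ?case using coassoc0[of l k i j] by (simp add: mult.commute)
next
  case (4 k a b c) then show ?case using assoc0[of a b c k] by (simp add: mult.commute)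
next
  case (7 i j a b)
  have "(\<Sum>k\<in>UNIV. d k i j * m a b k) =
     (\<Sum>a1\<in>UNIV. \<Sum>a2\<in>UNIV. \<Sum>b1\<in>UNIV. \<Sum>b2\<in>UNIV. d a a1 a2 * d b b1 b2 * m a1 b1 i * m a2 b2 j)"
    using bialg0[of a b i j] by (simp add: mult.commute)
  also have "\<dots> = (\<Sum>a1\<in>UNIV. \<Sum>b1\<in>UNIV. \<Sum>a2\<in>UNIV. \<Sum>b2\<in>UNIV. d a a1 a2 * d b b1 b2 * m a1 b1 i * m a2 b2 j)"
    by (rule sum.cong[OF refl], rule sum.swap)
  finally show ?case by (simp add: ac_simps)
next
  case (11 k l)
  have "(\<Sum>c\<in>UNIV. \<Sum>b\<in>UNIV. \<Sum>a\<in>UNIV. d l a b * s a c * m c b k) = e$l * u$k"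
    unfolding anti_l0[symmetric]
    by (subst sum_move2, rule sum.cong[OF refl], rule sum.swap)
  then show ?case by (simp add: ac_simps)
next
  case (12 k l)
  have "(\<Sum>a\<in>UNIV. \<Sum>c\<in>UNIV. \<Sum>b\<in>UNIV. d l a b * s b c * m a c k) = e$l * u$k"
    unfolding anti_r0[symmetric]
    by (rule sum.cong[OF refl], rule sum.swap)
  then show ?case by (simp add: ac_simps)
qed (simp_all add: unit_l0 unit_r0 counit_l0 counit_r0 unit_d0 counit_m0 counit_unit0 mult.commute
     counit_unit0)

abbreviation M (infixl "\<cdot>" 70) where "a \<cdot> b \<equiv> mulv m a b"
abbreviation C (infixl "\<star>" 70) where "f \<star> g \<equiv> mulv (\<lambda>i j k. d k i j) f g"
abbreviation "S \<equiv> applyv s"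
abbreviation "S' \<equiv> applyv (\<lambda>i j. s j i)"

lemma mul_assoc: "(a \<cdot> b) \<cdot> c = a \<cdot> (b \<cdot> c)"
proof (rule vlin_eqI[where a = a])
  fix i show "(axis i 1 \<cdot> b) \<cdot> c = axis i 1 \<cdot> (b \<cdot> c)"
  proof (rule vlin_eqI[where a = b])
    fix j show "(axis i 1 \<cdot> axis j 1) \<cdot> c = axis i 1 \<cdot> (axis j 1 \<cdot> c)"
    proof (rule vlin_eqI[where a = c])
      fix k
      have "(axis i 1 \<cdot> axis j 1) \<cdot> axis k 1 = (\<Sum>x\<in>UNIV. m i j x *s (axis x 1 \<cdot> axis k 1))"
        by (subst vlin_expand[where F = "\<lambda>v. v \<cdot> axis k 1"], intro lin) (simp add: mulv_axis)
      moreover have "axis i 1 \<cdot> (axis j 1 \<cdot> axis k 1) = (\<Sum>x\<in>UNIV. m j k x *s (axis i 1 \<cdot> axis x 1))"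
        by (subst vlin_expand[where F = "\<lambda>v. axis i 1 \<cdot> v"], intro lin) (simp add: mulv_axis)
      ultimately show "(axis i 1 \<cdot> axis j 1) \<cdot> axis k 1 = axis i 1 \<cdot> (axis j 1 \<cdot> axis k 1)"
        by (simp add: mulv_axis vec_eq_iff assoc0)
    qed (intro lin)+
  qed (intro lin)+
qed (intro lin)+

lemma unit_l [simp]: "u \<cdot> a = a"
proof (rule vlin_eqI[where a = a])
  fix i show "u \<cdot> axis i 1 = axis i 1"
    by (subst vlin_expand[where F = "\<lambda>v. v \<cdot> axis i 1"], intro lin)
       (simp add: mulv_axis vec_eq_iff unit_l0, simp add: axis_def)
qed (intro lin)+

lemma unit_r [simp]: "a \<cdot> u = a"
proof (rule vlin_eqI[where a = a])
  fix i show "axis i 1 \<cdot> u = axis i 1"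
    by (subst vlin_expand[where F = "\<lambda>v. axis i 1 \<cdot> v"], intro lin)
       (simp add: mulv_axis vec_eq_iff unit_r0, simp add: axis_def)
qed (intro lin)+

lemma eps_mul: "pr e (a \<cdot> b) = pr e a * pr e b"
proof (rule slin_eqI[where a = a])
  fix i show "pr e (axis i 1 \<cdot> b) = pr e (axis i 1) * pr e b"
    by (rule slin_eqI[where a = b], (intro lin)+)
       (simp add: mulv_axis, simp add: pr_def counit_m0)
qed (intro lin)+

lemma eps_unit [simp]: "pr e u = 1"
  by (simp add: pr_def counit_unit0)

text \<open>No linearity of F is assumed, because \<open>sw\<close> evaluates it at basis vectors
  only, on both sides.\<close>

lemma coassoc: "sw d a (\<lambda>x y. sw d x (\<lambda>p q. F p q y)) = sw d a (\<lambda>x y. sw d y (\<lambda>p q. F x p q))"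
proof -
  have "(\<Sum>i\<in>UNIV. \<Sum>c\<in>UNIV. d k i c * (\<Sum>p\<in>UNIV. \<Sum>q\<in>UNIV. d i p q * F (axis p 1) (axis q 1) (axis c 1)))
      = (\<Sum>p\<in>UNIV. \<Sum>i\<in>UNIV. d k p i * (\<Sum>q\<in>UNIV. \<Sum>c\<in>UNIV. d i q c * F (axis p 1) (axis q 1) (axis c 1)))"
    (is "?L = ?R") for k
  proof -
    have "?L = (\<Sum>i\<in>UNIV. \<Sum>c\<in>UNIV. \<Sum>p\<in>UNIV. \<Sum>q\<in>UNIV. d k i c * d i p q * F (axis p 1) (axis q 1) (axis c 1))"
      by (simp add: sum_distrib_left mult.assoc)
    also have "\<dots> = (\<Sum>p\<in>UNIV. \<Sum>q\<in>UNIV. \<Sum>c\<in>UNIV. \<Sum>i\<in>UNIV. d k i c * d i p q * F (axis p 1) (axis q 1) (axis c 1))"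
      by (subst sum_move2, rule sum.cong[OF refl], subst sum_move2, rule sum.cong[OF refl], rule sum.swap)
    also have "\<dots> = (\<Sum>p\<in>UNIV. \<Sum>q\<in>UNIV. \<Sum>c\<in>UNIV. \<Sum>i\<in>UNIV. d k p i * d i q c * F (axis p 1) (axis q 1) (axis c 1))"
      by (simp add: sum_distrib_right[symmetric] coassoc0)
    also have "\<dots> = ?R"
      by (rule sum.cong[OF refl], subst sum_move2) (simp add: sum_distrib_left mult.assoc)
    finally show ?thesis .
  qed
  then have 1: "sw d (axis k 1) (\<lambda>x y. sw d x (\<lambda>p q. F p q y)) = sw d (axis k 1) (\<lambda>x y. sw d y (\<lambda>p q. F x p q))" for k
    by (simp only: sw_axis)
  show ?thesis by (rule slin_eqI[where a = a], (intro lin)+, rule 1)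
qed

lemma counit_l: assumes "slin F" shows "sw d a (\<lambda>x y. pr e x * F y) = F a"
proof (rule slin_eqI[where a = a])
  fix k
  have "sw d (axis k 1) (\<lambda>x y. pr e x * F y) = (\<Sum>j\<in>UNIV. (\<Sum>i\<in>UNIV. e$i * d k i j) * F (axis j 1))"
    by (simp add: sw_axis sum_distrib_right, subst sum.swap) (simp add: ac_simps)
  then show "sw d (axis k 1) (\<lambda>x y. pr e x * F y) = F (axis k 1)"
    by (simp add: counit_l0 if_distrib[of "\<lambda>x. x * _"] cong: if_cong)
qed (intro lin assms)+

lemma counit_r: assumes "slin F" shows "sw d a (\<lambda>x y. pr e y * F x) = F a"
proof (rule slin_eqI[where a = a])
  fix k
  have "sw d (axis k 1) (\<lambda>x y. pr e y * F x) = (\<Sum>j\<in>UNIV. (\<Sum>i\<in>UNIV. e$i * d k j i) * F (axis j 1))"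
    by (simp add: sw_axis sum_distrib_right) (simp add: ac_simps)
  then show "sw d (axis k 1) (\<lambda>x y. pr e y * F x) = F (axis k 1)"
    by (simp add: counit_r0 if_distrib[of "\<lambda>x. x * _"] cong: if_cong)
qed (intro lin assms)+

lemma applyv_axis: "applyv s (axis i 1) = (\<chi> j. s i j)"
  by (simp add: applyv_def vec_eq_iff axis_def if_distrib[of "\<lambda>x. x * _"] cong: if_cong)

lemma anti_l: assumes F: "slin F" shows "sw d a (\<lambda>x y. F (S x \<cdot> y)) = pr e a * F u"
proof (rule slin_eqI[where a = a])
  fix k
  have 1: "F (S (axis i 1) \<cdot> axis j 1) = (\<Sum>c\<in>UNIV. \<Sum>l\<in>UNIV. s i c * m c j l * F (axis l 1))" for i j
    by (subst slin_expand[OF slin_comp[OF F], where a = "S (axis i 1)"], intro lin,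
        subst slin_expand[OF F, where a = "axis _ 1 \<cdot> axis j 1"])
       (simp add: applyv_axis mulv_axis sum_distrib_left mult.assoc)
  have "sw d (axis k 1) (\<lambda>x y. F (S x \<cdot> y))
      = (\<Sum>a\<in>UNIV. \<Sum>b\<in>UNIV. \<Sum>c\<in>UNIV. \<Sum>l\<in>UNIV. d k a b * s a c * m c b l * F (axis l 1))"
    by (simp add: sw_axis 1 sum_distrib_left mult.assoc)
  also have "\<dots> = (\<Sum>a\<in>UNIV. \<Sum>l\<in>UNIV. \<Sum>b\<in>UNIV. \<Sum>c\<in>UNIV. d k a b * s a c * m c b l * F (axis l 1))"
    by (rule sum.cong[OF refl], rule sum_move2)
  also have "\<dots> = (\<Sum>l\<in>UNIV. \<Sum>a\<in>UNIV. \<Sum>b\<in>UNIV. \<Sum>c\<in>UNIV. d k a b * s a c * m c b l * F (axis l 1))"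
    by (rule sum.swap)
  also have "\<dots> = (\<Sum>l\<in>UNIV. e$k * u$l * F (axis l 1))"
    by (simp add: sum_distrib_right[symmetric] anti_l0)
  also have "\<dots> = pr e (axis k 1) * F u"
    by (subst (2) slin_expand[OF F]) (simp add: sum_distrib_left mult.assoc)
  finally show "sw d (axis k 1) (\<lambda>x y. F (S x \<cdot> y)) = pr e (axis k 1) * F u" .
qed (intro lin)+

lemma anti_r: assumes F: "slin F" shows "sw d a (\<lambda>x y. F (x \<cdot> S y)) = pr e a * F u"
proof (rule slin_eqI[where a = a])
  fix k
  have 1: "F (axis i 1 \<cdot> S (axis j 1)) = (\<Sum>c\<in>UNIV. \<Sum>l\<in>UNIV. s j c * m i c l * F (axis l 1))" for i j
    by (subst slin_expand[OF slin_comp[OF F], where a = "S (axis j 1)"], intro lin,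
        subst slin_expand[OF F, where a = "axis i 1 \<cdot> axis _ 1"])
       (simp add: applyv_axis mulv_axis sum_distrib_left mult.assoc)
  have "sw d (axis k 1) (\<lambda>x y. F (x \<cdot> S y))
      = (\<Sum>a\<in>UNIV. \<Sum>b\<in>UNIV. \<Sum>c\<in>UNIV. \<Sum>l\<in>UNIV. d k a b * s b c * m a c l * F (axis l 1))"
    by (simp add: sw_axis 1 sum_distrib_left mult.assoc)
  also have "\<dots> = (\<Sum>a\<in>UNIV. \<Sum>l\<in>UNIV. \<Sum>b\<in>UNIV. \<Sum>c\<in>UNIV. d k a b * s b c * m a c l * F (axis l 1))"
    by (rule sum.cong[OF refl], rule sum_move2)
  also have "\<dots> = (\<Sum>l\<in>UNIV. \<Sum>a\<in>UNIV. \<Sum>b\<in>UNIV. \<Sum>c\<in>UNIV. d k a b * s b c * m a c l * F (axis l 1))"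
    by (rule sum.swap)
  also have "\<dots> = (\<Sum>l\<in>UNIV. e$k * u$l * F (axis l 1))"
    by (simp add: sum_distrib_right[symmetric] anti_r0)
  also have "\<dots> = pr e (axis k 1) * F u"
    by (subst (2) slin_expand[OF F]) (simp add: sum_distrib_left mult.assoc)
  finally show "sw d (axis k 1) (\<lambda>x y. F (x \<cdot> S y)) = pr e (axis k 1) * F u" .
qed (intro lin)+

lemma sw_unit:
  assumes "\<And>y. slin (\<lambda>x. F x y)" "\<And>x. slin (F x)"
  shows "sw d u F = F u u"
  by (subst bilin_expand[of F, OF assms]) (simp add: sw_def unit_d0)

text \<open>Here bilinearity matters: the products inside F are no longer basis vectors and must be
  expanded before the bialgebra axiom applies.\<close>

lemma sw_mul:
  assumes F: "\<And>y. slin (\<lambda>x. F x y)" "\<And>x. slin (F x)"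
  shows "sw d (a \<cdot> b) F = sw d a (\<lambda>x y. sw d b (\<lambda>p q. F (x \<cdot> p) (y \<cdot> q)))"
proof (rule slin_eqI[where a = a])
  fix i show "sw d (axis i 1 \<cdot> b) F = sw d (axis i 1) (\<lambda>x y. sw d b (\<lambda>p q. F (x \<cdot> p) (y \<cdot> q)))"
  proof (rule slin_eqI[where a = b])
    fix j
    have "sw d (axis i 1) (\<lambda>x y. sw d (axis j 1) (\<lambda>p q. F (x \<cdot> p) (y \<cdot> q)))
      = (\<Sum>i1\<in>UNIV. \<Sum>i2\<in>UNIV. \<Sum>j1\<in>UNIV. \<Sum>j2\<in>UNIV. \<Sum>a\<in>UNIV. \<Sum>b\<in>UNIV.
          d i i1 i2 * d j j1 j2 * m i1 j1 a * m i2 j2 b * F (axis a 1) (axis b 1))"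
      by (subst bilin_expand[of F, OF F]) (simp add: sw_axis mulv_axis sum_distrib_left mult.assoc)
    also have "\<dots> = (\<Sum>a\<in>UNIV. \<Sum>b\<in>UNIV. \<Sum>i1\<in>UNIV. \<Sum>i2\<in>UNIV. \<Sum>j1\<in>UNIV. \<Sum>j2\<in>UNIV.
          d i i1 i2 * d j j1 j2 * m i1 j1 a * m i2 j2 b * F (axis a 1) (axis b 1))"
      by (rule sym, (rule trans[OF sum_move2], rule sum.cong[OF refl])+) simp
    also have "\<dots> = (\<Sum>a\<in>UNIV. \<Sum>b\<in>UNIV. (\<Sum>k\<in>UNIV. m i j k * d k a b) * F (axis a 1) (axis b 1))"
      by (simp add: sum_distrib_right bialg0)
    also have "\<dots> = sw d (axis i 1 \<cdot> axis j 1) F"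
      by (simp add: sw_def mulv_axis)
    finally show "sw d (axis i 1 \<cdot> axis j 1) F
      = sw d (axis i 1) (\<lambda>x y. sw d (axis j 1) (\<lambda>p q. F (x \<cdot> p) (y \<cdot> q)))" ..
  qed (intro lin)+
qed (intro lin)+

lemma antipode_unit [simp]: "S u = u"
proof (rule pr_eqI)
  fix f
  have "sw d u (\<lambda>x y. pr f (S x \<cdot> y)) = pr f (S u \<cdot> u)"
    by (rule sw_unit) (intro lin)+
  moreover have "sw d u (\<lambda>x y. pr f (S x \<cdot> y)) = pr e u * pr f u"
    by (rule anti_l[where F = "pr f"]) (intro lin)
  ultimately show "pr f (S u) = pr f u" by simp
qed

text \<open>Both sides are convolution inverses of the multiplication map. The sum S(a1 b1) a2 b2
  S(b3) S(a3) collapses from the right to S(ab), and from the left, by \<open>sw_mul\<close>, to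
  S(b) S(a).\<close>

lemma antipode_mul: "S (a \<cdot> b) = S b \<cdot> S a"
proof (rule pr_eqI)
  fix f
  let ?G = "\<lambda>a1 a2 a3 b1 b2 b3. pr f (S (a1 \<cdot> b1) \<cdot> ((a2 \<cdot> b2) \<cdot> (S b3 \<cdot> S a3)))"
  let ?X = "sw d a (\<lambda>a1 a'. sw d a' (\<lambda>a2 a3. sw d b (\<lambda>b1 b'. sw d b' (\<lambda>b2 b3. ?G a1 a2 a3 b1 b2 b3))))"
  have 1: "sw d b' (\<lambda>b2 b3. ?G a1 a2 a3 b1 b2 b3) = pr e b' * pr f (S (a1 \<cdot> b1) \<cdot> (a2 \<cdot> S a3))"
    for a1 a2 a3 b1 b'
    using anti_r[of "\<lambda>z. pr f (S (a1 \<cdot> b1) \<cdot> (a2 \<cdot> (z \<cdot> S a3)))" b', OF slin_pr_r]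
    by (simp add: mul_assoc lin)
  have 2: "sw d b (\<lambda>b1 b'. pr e b' * pr f (S (a1 \<cdot> b1) \<cdot> (a2 \<cdot> S a3))) = pr f (S (a1 \<cdot> b) \<cdot> (a2 \<cdot> S a3))"
    for a1 a2 a3 by (rule counit_r) (intro lin)
  have 3: "sw d a' (\<lambda>a2 a3. pr f (S (a1 \<cdot> b) \<cdot> (a2 \<cdot> S a3))) = pr e a' * pr f (S (a1 \<cdot> b))" for a1 a'
    using anti_r[of "\<lambda>z. pr f (S (a1 \<cdot> b) \<cdot> z)" a', OF slin_pr_r] by (simp add: lin)
  have 4: "sw d a (\<lambda>a1 a'. pr e a' * pr f (S (a1 \<cdot> b))) = pr f (S (a \<cdot> b))"
    by (rule counit_r) (intro lin)
  have L: "?X = pr f (S (a \<cdot> b))" by (simp only: 1 2 3 4)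
  have 5: "sw d b (\<lambda>b1 b'. sw d b' (\<lambda>b2 b3. ?G a1 a2 a3 b1 b2 b3))
     = sw d b (\<lambda>y b3. sw d y (\<lambda>b1 b2. ?G a1 a2 a3 b1 b2 b3))" for a1 a2 a3
    by (rule coassoc[symmetric])
  have "?X = sw d a (\<lambda>x a3. sw d x (\<lambda>a1 a2. sw d b (\<lambda>y b3. sw d y (\<lambda>b1 b2. ?G a1 a2 a3 b1 b2 b3))))"
    by (simp only: 5, rule coassoc[symmetric])
  also have "\<dots> = sw d a (\<lambda>x a3. sw d b (\<lambda>y b3. sw d x (\<lambda>a1 a2. sw d y (\<lambda>b1 b2. ?G a1 a2 a3 b1 b2 b3))))"
    by (rule sw_cong, rule sw_swap)
  also have "\<dots> = sw d a (\<lambda>x a3. sw d b (\<lambda>y b3. pr e y * (pr e x * pr f (S b3 \<cdot> S a3))))"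
  proof -
    have "sw d x (\<lambda>a1 a2. sw d y (\<lambda>b1 b2. ?G a1 a2 a3 b1 b2 b3)) = pr e (x \<cdot> y) * pr f (S b3 \<cdot> S a3)"
      for x y a3 b3
    proof -
      have "sw d x (\<lambda>a1 a2. sw d y (\<lambda>b1 b2. ?G a1 a2 a3 b1 b2 b3))
          = sw d (x \<cdot> y) (\<lambda>p q. pr f (S p \<cdot> (q \<cdot> (S b3 \<cdot> S a3))))"
        by (rule sw_mul[symmetric]) (intro lin)+
      also have "\<dots> = pr e (x \<cdot> y) * pr f (S b3 \<cdot> S a3)"
        using anti_l[of "\<lambda>z. pr f (z \<cdot> (S b3 \<cdot> S a3))" "x \<cdot> y", OF slin_pr_r]
        by (simp add: mul_assoc lin)
      finally show ?thesis .
    qed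
    then show ?thesis by (simp only: eps_mul mult.assoc mult.left_commute[of "pr e _" "pr e _"])
  qed
  also have "\<dots> = sw d a (\<lambda>x a3. pr e x * pr f (S b \<cdot> S a3))"
    by (rule sw_cong, rule counit_l) (intro lin)
  also have "\<dots> = pr f (S b \<cdot> S a)" by (rule counit_l) (intro lin)
  finally show "pr f (S (a \<cdot> b)) = pr f (S b \<cdot> S a)" using L by simp
qed

end

context hopf_constants begin

interpretation D: hopf_constants "\<lambda>i j k. d k i j" "\<lambda>k i j. m i j k" e u "\<lambda>i j. s j i"
  by (rule dual)

lemmas conv_assoc = D.mul_assoc
  and conv_unit_l [simp] = D.unit_l
  and conv_unit_r [simp] = D.unit_r
  and conv_at_unit = D.eps_mul
  and antipode'_unit [simp] = D.antipode_unit
  and antipode'_mul = D.antipode_mul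

lemma pr_antipode': "pr (S' f) a = pr f (S a)"
  by (rule applyv_adjoint)

lemma eps_antipode [simp]: "pr e (S a) = pr e a"
  by (subst pr_antipode'[symmetric]) simp

text \<open>Dual form of \<open>antipode_mul\<close>: the coefficients of \<Delta>(S a) are products
  in the dual evaluated at S a, and S' reverses such products.\<close>

lemma sw_antipode:
  assumes F: "\<And>y. slin (\<lambda>x. F x y)" "\<And>x. slin (F x)"
  shows "sw d (S a) F = sw d a (\<lambda>x y. F (S y) (S x))"
proof -
  have "sw d (S a) F = (\<Sum>i\<in>UNIV. \<Sum>j\<in>UNIV. sw d a (\<lambda>x y. S y $ i * S x $ j * F (axis i 1) (axis j 1)))"
    by (simp add: sw_alt[of d "S a"] pr_antipode'[symmetric] antipode'_mul pr_conv sw_cmult_r)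
       (simp add: pr_antipode' mult.commute)
  also have "\<dots> = sw d a (\<lambda>x y. F (S y) (S x))"
    by (subst bilin_expand[of F, OF F]) (simp add: sw_sum)
  finally show ?thesis .
qed

end

text \<open>Represents a functional by a vector; operators with values in the dual are defined by
  such vectors and used only through \<open>pr\<close>.\<close>

lemma pr_chi: "slin F \<Longrightarrow> pr (\<chi> i. F (axis i 1)) a = F a"
  by (subst slin_expand[of F a]) (simp_all add: pr_def mult.commute)

lemma vlin_diff: "vlin F \<Longrightarrow> F (x - y) = F x - F y"
  using vlin_add[of F "x - y" y] by (simp add: algebra_simps)

lemma vlin_inj_surj:
  fixes G :: "'a::field^'n::finite \<Rightarrow> 'a^'n"
  assumes "vlin G" "\<And>x. G x = 0 \<Longrightarrow> x = 0" shows "\<exists>x. y = G x"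
proof -
  have "Vector_Spaces.linear (*s) (*s) G" using assms(1) by (simp add: vlin_linear)
  moreover have "inj G"
  proof (rule injI)
    fix x y assume "G x = G y"
    then have "G (x - y) = 0"
      using vlin_add[OF assms(1), of "x - y" y] by simp
    then show "x = y" using assms(2)[of "x - y"] by simp
  qed
  ultimately have "surj G" by (rule vec.linear_injective_imp_surjective) simp
  then show ?thesis by (metis surjD)
qed

section \<open>Integrals\<close>

context hopf_constants begin

text \<open>\<open>ract\<close> is a right action of H on its dual, the antipode reversing the order
  of the natural left action \<open>rtrans\<close>. \<open>hit\<close> is the left action of the
  dual on H, h -> h1 g(h2).\<close>

definition ract where "ract f h = (\<chi> i. pr f (axis i 1 \<cdot> S h))"
definition rtrans where "rtrans g h = (\<chi> i. pr g (axis i 1 \<cdot> h))"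
definition hit where "hit g h = (\<chi> i. pr (axis i 1 \<star> g) h)"

lemma pr_ract: "pr (ract f h) a = pr f (a \<cdot> S h)"
  unfolding ract_def by (rule pr_chi) (intro lin)

lemma pr_rtrans: "pr (rtrans g h) a = pr g (a \<cdot> h)"
  unfolding rtrans_def by (rule pr_chi) (intro lin)

lemma pr_hit: "pr f (hit g h) = pr (f \<star> g) h"
  unfolding hit_def by (subst pr_commute, rule pr_chi) (intro lin)

lemma slin_hit: assumes "slin F" shows "F (hit g h) = sw d h (\<lambda>x y. F x * pr g y)"
proof -
  have "F (hit g h) = pr (\<chi> i. F (axis i 1)) (hit g h)" by (simp add: pr_chi assms)
  then show ?thesis by (simp add: pr_hit pr_conv pr_chi assms)
qed

lemma vlin_ract_l [lin]: "vlin G \<Longrightarrow> vlin (\<lambda>x. ract (G x) h)"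
  by (rule vlinI; rule pr_eqI2) (simp_all add: pr_ract vlin_add vlin_scale pr_add_l pr_scale_l)

lemma vlin_ract_r [lin]: assumes "vlin G" shows "vlin (\<lambda>x. ract f (G x))"
proof -
  have 1: "vlin (\<lambda>x. y \<cdot> S (G x))" for y by (intro lin assms)
  show ?thesis
    by (intro vlinI; intro pr_eqI2)
       (simp_all only: pr_ract pr_add_l pr_scale_l pr_add_r pr_scale_r vlin_add[OF 1] vlin_scale[OF 1])
qed

lemma vlin_rtrans_r [lin]: assumes "vlin G" shows "vlin (\<lambda>x. rtrans f (G x))"
proof -
  have 1: "vlin (\<lambda>x. y \<cdot> G x)" for y by (intro lin assms)
  show ?thesis
    by (intro vlinI; intro pr_eqI2)
       (simp_all only: pr_rtrans pr_add_l pr_scale_l pr_add_r pr_scale_r vlin_add[OF 1] vlin_scale[OF 1])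
qed

lemma ract_unit [simp]: "ract f u = f"
  by (rule pr_eqI2) (simp add: pr_ract)

lemma ract_ract: "ract (ract f h) k = ract f (h \<cdot> k)"
  by (rule pr_eqI2) (simp add: pr_ract antipode_mul mul_assoc)

text \<open>The dual space with the action \<^const>\<open>ract\<close> and the coaction dual to left convolution is a
  Hopf module; this is its compatibility condition.\<close>

lemma conv_ract:
  "pr (g \<star> ract f h) a = sw d h (\<lambda>h1 h2. pr (ract (rtrans g h2 \<star> f) h1) a)"
proof -
  have 1: "sw d (a \<cdot> S h1) (\<lambda>x y. pr g (x \<cdot> h2) * pr f y)
    = sw d a (\<lambda>a1 a2. sw d h1 (\<lambda>p q. pr g (a1 \<cdot> (S q \<cdot> h2)) * pr f (a2 \<cdot> S p)))" for h1 h2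
  proof -
    have "sw d (a \<cdot> S h1) (\<lambda>x y. pr g (x \<cdot> h2) * pr f y)
      = sw d a (\<lambda>a1 a2. sw d (S h1) (\<lambda>p q. pr g ((a1 \<cdot> p) \<cdot> h2) * pr f (a2 \<cdot> q)))"
      by (rule sw_mul) (intro lin)+
    also have "\<dots> = sw d a (\<lambda>a1 a2. sw d h1 (\<lambda>p q. pr g ((a1 \<cdot> S q) \<cdot> h2) * pr f (a2 \<cdot> S p)))"
      by (rule sw_cong, rule sw_antipode) (intro lin)+
    finally show ?thesis by (simp only: mul_assoc)
  qed
  have 2: "sw d h' (\<lambda>q h2. pr g (a1 \<cdot> (S q \<cdot> h2)) * pr f (a2 \<cdot> S p)) = pr e h' * (pr g a1 * pr f (a2 \<cdot> S p))"
    for h' a1 a2 p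
    using anti_l[of "\<lambda>z. pr g (a1 \<cdot> z) * pr f (a2 \<cdot> S p)" h'] by (simp add: lin)
  have 3: "sw d h (\<lambda>p h'. pr e h' * (pr g a1 * pr f (a2 \<cdot> S p))) = pr g a1 * pr f (a2 \<cdot> S h)" for a1 a2
    by (rule counit_r) (intro lin)
  have "sw d h (\<lambda>h1 h2. pr (ract (rtrans g h2 \<star> f) h1) a)
     = sw d h (\<lambda>h1 h2. sw d a (\<lambda>a1 a2. sw d h1 (\<lambda>p q. pr g (a1 \<cdot> (S q \<cdot> h2)) * pr f (a2 \<cdot> S p))))"
    by (simp only: pr_ract pr_conv pr_rtrans 1)
  also have "\<dots> = sw d a (\<lambda>a1 a2. sw d h (\<lambda>h1 h2. sw d h1 (\<lambda>p q. pr g (a1 \<cdot> (S q \<cdot> h2)) * pr f (a2 \<cdot> S p))))"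
    by (rule sw_swap)
  also have "\<dots> = sw d a (\<lambda>a1 a2. sw d h (\<lambda>p h'. sw d h' (\<lambda>q h2. pr g (a1 \<cdot> (S q \<cdot> h2)) * pr f (a2 \<cdot> S p))))"
    by (rule sw_cong, rule coassoc)
  also have "\<dots> = pr (g \<star> ract f h) a"
    by (simp only: 2 3 pr_conv pr_ract)
  finally show ?thesis ..
qed

text \<open>For the canonical element, the sum of b_k \<otimes> b^k over dual bases, comultiplying
  the first leg amounts to multiplying two copies of the second: both operations have the constants
  \<open>d\<close>.\<close>

lemma sum_basis_comult:
  assumes "\<And>x y. slin (F x y)"
  shows "(\<Sum>k\<in>UNIV. sw d (axis k 1) (\<lambda>x y. F x y (axis k 1)))
    = (\<Sum>i\<in>UNIV. \<Sum>j\<in>UNIV. F (axis i 1) (axis j 1) (axis i 1 \<star> axis j 1))"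
proof -
  have 1: "F x y (axis i 1 \<star> axis j 1) = (\<Sum>k\<in>UNIV. d k i j * F x y (axis k 1))" for x y i j
    by (subst slin_expand[OF assms]) (simp add: mulv_axis)
  show ?thesis unfolding 1 sw_axis by (rule sum_move2[symmetric])
qed

text \<open>The projection $f \mapsto f_{(0)} S(f_{(1)})$ of this Hopf module onto its coinvariants, which
  are the left integrals.\<close>

definition integral_proj where
  "integral_proj f = (\<Sum>k\<in>UNIV. ract (axis k 1 \<star> f) (S (axis k 1)))"

text \<open>By \<open>conv_ract\<close> the factor g meets one leg of \<Delta>(S b_k). The canonical
  element then isolates the sum of rtrans g (S b_i) \<star> b^i, which the antipode axiom evaluates
  to g(1) \<epsilon>.\<close>

lemma integral_proj_left: "g \<star> integral_proj f = pr g u *s integral_proj f"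
proof (rule pr_eqI2)
  fix a
  have 1: "(\<Sum>i\<in>UNIV. rtrans g (S (axis i 1)) \<star> axis i 1) = pr g u *s e"
  proof (rule pr_eqI2)
    fix x
    have "pr (\<Sum>i\<in>UNIV. rtrans g (S (axis i 1)) \<star> axis i 1) x
      = sw d x (\<lambda>x1 x2. \<Sum>i\<in>UNIV. x2 $ i * pr g (x1 \<cdot> S (axis i 1)))"
      by (simp add: pr_sum_l pr_conv pr_rtrans sw_sum mult.commute)
    also have "\<dots> = sw d x (\<lambda>x1 x2. pr g (x1 \<cdot> S x2))"
      by (rule sw_cong, rule slin_expand[symmetric]) (intro lin)
    also have "\<dots> = pr e x * pr g u"
      by (rule anti_r) (intro lin)
    finally show "pr (\<Sum>i\<in>UNIV. rtrans g (S (axis i 1)) \<star> axis i 1) x = pr (pr g u *s e) x"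
      by (simp add: pr_scale_l)
  qed
  have "pr (g \<star> integral_proj f) a = (\<Sum>k\<in>UNIV. pr (g \<star> ract (axis k 1 \<star> f) (S (axis k 1))) a)"
    unfolding integral_proj_def
    by (subst vlin_sum_arg[of "\<lambda>x. g \<star> x"]) (intro lin, simp add: pr_sum_l)
  also have "\<dots> = (\<Sum>k\<in>UNIV. sw d (axis k 1) (\<lambda>x y. pr (ract (rtrans g (S x) \<star> (axis k 1 \<star> f)) (S y)) a))"
    by (rule sum.cong[OF refl], subst conv_ract, rule sw_antipode) (intro lin)+
  also have "\<dots> = (\<Sum>i\<in>UNIV. \<Sum>j\<in>UNIV.
      pr (ract (rtrans g (S (axis i 1)) \<star> ((axis i 1 \<star> axis j 1) \<star> f)) (S (axis j 1))) a)"
    by (rule sum_basis_comult) (intro lin)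
  also have "\<dots> = (\<Sum>j\<in>UNIV. \<Sum>i\<in>UNIV.
      pr (ract ((rtrans g (S (axis i 1)) \<star> axis i 1) \<star> (axis j 1 \<star> f)) (S (axis j 1))) a)"
    by (subst sum.swap) (simp add: conv_assoc)
  also have "\<dots> = (\<Sum>j\<in>UNIV. pr (ract ((\<Sum>i\<in>UNIV. rtrans g (S (axis i 1)) \<star> axis i 1) \<star> (axis j 1 \<star> f)) (S (axis j 1))) a)"
    by (rule sum.cong[OF refl],
        rule slin_sum_arg[where F = "\<lambda>z. pr (ract (z \<star> (axis _ 1 \<star> f)) (S (axis _ 1))) a", symmetric]) (intro lin)
  also have "\<dots> = (\<Sum>j\<in>UNIV. pr g u * pr (ract (axis j 1 \<star> f) (S (axis j 1))) a)"
    unfolding 1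
    by (rule sum.cong[OF refl], subst slin_scale[where F = "\<lambda>z. pr (ract (z \<star> (axis _ 1 \<star> f)) (S (axis _ 1))) a"])
       (intro lin, simp)
  also have "\<dots> = pr (pr g u *s integral_proj f) a"
    unfolding integral_proj_def by (simp add: pr_scale_l pr_sum_l sum_distrib_left)
  finally show "pr (g \<star> integral_proj f) a = pr (pr g u *s integral_proj f) a" .
qed

text \<open>The two actions combine to S(S(b_k) b_i); the canonical element makes the pair a
  comultiplication, and the antipode axiom contracts it. This is the generation part of the
  fundamental theorem of Hopf modules: the coinvariants generate the dual under
  \<open>ract\<close>.\<close>

lemma integral_proj_decomp: "f = (\<Sum>i\<in>UNIV. ract (integral_proj (axis i 1 \<star> f)) (axis i 1))"
proof (rule pr_eqI2)
  fix a
  have "pr (\<Sum>i\<in>UNIV. ract (integral_proj (axis i 1 \<star> f)) (axis i 1)) a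
    = (\<Sum>k\<in>UNIV. \<Sum>i\<in>UNIV. pr ((axis k 1 \<star> axis i 1) \<star> f) (a \<cdot> S (S (axis k 1) \<cdot> axis i 1)))"
    by (subst sum.swap)
       (simp add: pr_sum_l pr_ract integral_proj_def conv_assoc antipode_mul mul_assoc)
  also have "\<dots> = (\<Sum>k\<in>UNIV. sw d (axis k 1) (\<lambda>x y. pr (axis k 1 \<star> f) (a \<cdot> S (S x \<cdot> y))))"
    by (rule sum_basis_comult[symmetric]) (intro lin)
  also have "\<dots> = (\<Sum>k\<in>UNIV. pr e (axis k 1) * pr (axis k 1 \<star> f) (a \<cdot> S u))"
    by (rule sum.cong[OF refl], rule anti_l[where F = "\<lambda>z. pr (axis _ 1 \<star> f) (a \<cdot> S z)"]) (intro lin)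
  also have "\<dots> = pr (e \<star> f) a"
    by (subst slin_expand[where F = "\<lambda>x. pr (x \<star> f) a"], intro lin) simp
  finally show "pr f a = pr (\<Sum>i\<in>UNIV. ract (integral_proj (axis i 1 \<star> f)) (axis i 1)) a"
    by simp
qed

text \<open>If every projection vanished, the decomposition would make every functional zero, but
  \<epsilon>(1) = 1.\<close>

lemma left_integral_exists: "\<exists>l. l \<noteq> 0 \<and> (\<forall>g. g \<star> l = pr g u *s l)"
proof (rule ccontr)
  assume "\<not> ?thesis"
  then have "integral_proj f = 0" for f using integral_proj_left by blast
  then have "f = (\<Sum>i\<in>UNIV. ract 0 (axis i 1))" for f using integral_proj_decomp[of f] by simp
  moreover have "ract 0 h = 0" for h by (rule pr_eqI2) (simp add: pr_ract)
  ultimately have "e = 0" by (metis (no_types, lifting) sum.neutral)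
  then show False using eps_unit by simp
qed

context
  fixes l assumes l_nz: "l \<noteq> 0" and l_left: "\<And>g. g \<star> l = pr g u *s l"
begin

lemma conv_integral_ract: "g \<star> ract l h = ract l (hit g h)"
proof (rule pr_eqI2)
  fix a
  have "pr (g \<star> ract l h) a = sw d h (\<lambda>h1 h2. pr (ract l h1) a * pr g h2)"
    unfolding conv_ract l_left pr_rtrans by (simp add: pr_ract pr_scale_l mult.commute)
  also have "\<dots> = pr (ract l (hit g h)) a"
    by (rule slin_hit[symmetric]) (intro lin)
  finally show "pr (g \<star> ract l h) a = pr (ract l (hit g h)) a" .
qed

text \<open>The element \<epsilon>(h) 1 = h1 S(h2) is the sum of hit(b^i, h) S(b_i). Applied to l,
  each term becomes b^i \<star> (l.h) acted on by S(b_i), which vanishes together with l.h.\<close>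

lemma ract_kernel_eps: assumes "ract l h = 0" shows "pr e h = 0"
proof -
  have z: "ract 0 k = 0" for k by (rule pr_eqI2) (simp add: pr_ract)
  have "pr e h *s u = (\<Sum>i\<in>UNIV. hit (axis i 1) h \<cdot> S (axis i 1))"
  proof (rule pr_eqI)
    fix f
    have "pr f (\<Sum>i\<in>UNIV. hit (axis i 1) h \<cdot> S (axis i 1))
      = (\<Sum>i\<in>UNIV. sw d h (\<lambda>x y. pr f (x \<cdot> S (axis i 1)) * pr (axis i 1) y))"
      unfolding pr_sum_r by (rule sum.cong[OF refl], rule slin_hit) (intro lin)
    also have "\<dots> = sw d h (\<lambda>x y. \<Sum>i\<in>UNIV. y $ i * pr f (x \<cdot> S (axis i 1)))"
      by (simp add: sw_sum mult.commute)
    also have "\<dots> = sw d h (\<lambda>x y. pr f (x \<cdot> S y))"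
      by (rule sw_cong, rule slin_expand[symmetric]) (intro lin)
    also have "\<dots> = pr e h * pr f u" by (rule anti_r) (intro lin)
    finally show "pr f (pr e h *s u) = pr f (\<Sum>i\<in>UNIV. hit (axis i 1) h \<cdot> S (axis i 1))"
      by (simp add: pr_scale_r)
  qed
  then have "ract l (pr e h *s u) = (\<Sum>i\<in>UNIV. ract l (hit (axis i 1) h \<cdot> S (axis i 1)))"
    by (simp add: vlin_sum_arg[of "ract l"] lin)
  also have "\<dots> = (\<Sum>i\<in>UNIV. ract (axis i 1 \<star> ract l h) (S (axis i 1)))"
    by (simp add: ract_ract[symmetric] conv_integral_ract)
  also have "\<dots> = 0" unfolding assms by (simp add: vlin_zero[of "\<lambda>x. _ \<star> x"] lin z)
  finally have "pr e h *s l = 0" by (simp add: vlin_scale[of "ract l"] lin)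
  then show ?thesis using l_nz by (simp add: vec_eq_iff) blast
qed

text \<open>The kernel of \<open>ract l\<close> is stable under \<open>hit\<close>, and
  \<epsilon>(hit g h) = g(h); so the vanishing of \<epsilon> on the kernel already gives
  injectivity.\<close>

lemma ract_inj0: assumes "ract l h = 0" shows "h = 0"
proof (rule pr_eqI)
  fix g
  have "ract l (hit g h) = 0"
    unfolding conv_integral_ract[symmetric] assms by (rule vlin_zero) (intro lin)
  then have "pr e (hit g h) = 0" by (rule ract_kernel_eps)
  then show "pr g h = pr g 0" by (simp add: pr_hit)
qed

text \<open>H and its dual have equal dimension. The dual is thus generated by l, which makes l a
  Frobenius form on H.\<close>

lemma ract_surj: "\<exists>h. f = ract l h"
  by (rule vlin_inj_surj[where G = "ract l"]) (intro lin, erule ract_inj0)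

text \<open>\<open>ract l\<close> depends on h only through S h, so its injectivity passes to
  S.\<close>

lemma antipode_inj0': assumes "S h = 0" shows "h = 0"
proof (rule ract_inj0)
  have "a \<cdot> 0 = 0" for a by (rule vlin_zero) (intro lin)
  then show "ract l h = 0" by (intro pr_eqI2) (simp add: pr_ract assms)
qed

text \<open>Writing l' = l.h, left invariance pulls back along the injective \<open>ract l\<close>
  to hit g h = g(1) h; applying \<epsilon> gives g(h) = g(1) \<epsilon>(h) for all g, so h is a
  multiple of 1.\<close>

lemma left_integral_unique: assumes "\<And>g. g \<star> l' = pr g u *s l'" shows "\<exists>c. l' = c *s l"
proof -
  obtain h where h: "l' = ract l h" using ract_surj by blast
  have "hit g h = pr g u *s h" for g
  proof -
    have "ract l (hit g h) = ract l (pr g u *s h)"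
      using assms[of g] unfolding h conv_integral_ract by (simp add: vlin_scale[of "ract l"] lin)
    then have "ract l (hit g h - pr g u *s h) = 0"
      by (metis (no_types) vlin_add[of "ract l", OF vlin_ract_r[OF vlin_id]] add_diff_cancel_right' diff_add_cancel diff_self)
    then show ?thesis using ract_inj0 by fastforce
  qed
  then have eps: "pr e (hit g h) = pr e (pr g u *s h)" for g by (rule arg_cong)
  have "pr g h = pr g (pr e h *s u)" for g
    by (rule trans[OF _ trans[OF eps[of g]]]) (simp_all add: pr_hit pr_scale_r)
  then have "h = pr e h *s u" by (rule pr_eqI)
  then have "l' = pr e h *s l" unfolding h
    by (metis vlin_scale[of "ract l", OF vlin_ract_r[OF vlin_id]] ract_unit)
  then show ?thesis ..
qed

text \<open>Right convolution multiplies a left integral by the distinguished group-like element.\<close>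

lemma distinguished_grouplike:
  "\<exists>g. (\<forall>f f'. pr (f \<star> f') g = pr f g * pr f' g) \<and> pr e g = 1 \<and> (\<forall>f. l \<star> f = pr f g *s l)"
proof -
  have "\<exists>c. l \<star> f = c *s l" for f
    by (rule left_integral_unique)
       (simp add: conv_assoc[symmetric] l_left vlin_scale[of "\<lambda>x. x \<star> f"] lin)
  then obtain \<gamma> where \<gamma>: "\<And>f. l \<star> f = \<gamma> f *s l" by metis
  obtain i where i: "l $ i \<noteq> 0" using l_nz by (auto simp: vec_eq_iff)
  \<comment> \<open>Reading the factor off a non-zero coordinate of l makes its linearity
    evident.\<close>
  have \<gamma>': "\<gamma> f = (l \<star> f) $ i * (1 / l $ i)" for f using i by (simp add: \<gamma>)
  have "slin \<gamma>" unfolding \<gamma>' by (intro lin)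
  define g where "g = (\<chi> j. \<gamma> (axis j 1))"
  have g: "pr f g = \<gamma> f" for f unfolding g_def using \<open>slin \<gamma>\<close> by (subst pr_commute) (rule pr_chi)
  have canc: "c *s l = c' *s l \<Longrightarrow> c = c'" for c c' using i by (auto simp: vec_eq_iff)
  have "\<gamma> (f \<star> f') *s l = (\<gamma> f * \<gamma> f') *s l" for f f'
    by (simp add: \<gamma>[symmetric] conv_assoc[symmetric] vlin_scale[of "\<lambda>x. x \<star> f'"] lin)
       (simp add: \<gamma> vlin_scale[of "\<lambda>x. x \<star> f'"] lin)
  moreover have "\<gamma> e *s l = 1 *s l" by (simp add: \<gamma>[symmetric])
  ultimately have "\<gamma> (f \<star> f') = \<gamma> f * \<gamma> f'" "\<gamma> e = 1" for f f'
    using canc by blast+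
  then show ?thesis by (intro exI[of _ g] conjI allI) (simp_all only: g \<gamma>)
qed

end

lemma antipode_inj0: "S h = 0 \<Longrightarrow> h = 0"
  using left_integral_exists antipode_inj0' by blast

lemma antipode_surj: "\<exists>h. a = S h"
  by (rule vlin_inj_surj) (intro lin, erule antipode_inj0)

lemma antipode'_surj: "\<exists>h. a = S' h"
proof -
  interpret D: hopf_constants "\<lambda>i j k. d k i j" "\<lambda>k i j. m i j k" e u "\<lambda>i j. s j i" by (rule dual)
  show ?thesis by (rule D.antipode_surj)
qed

end

section \<open>Two-sided integrals: Frobenius form, Nakayama automorphism, S^4 = 1\<close>

locale unimodular_hopf = hopf_constants m d u e s
  for m d :: "'n::finite \<Rightarrow> 'n \<Rightarrow> 'n \<Rightarrow> 'a::field" and u e :: "'a^'n" and s :: "'n \<Rightarrow> 'n \<Rightarrow> 'a" +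
  fixes l L :: "'a^'n"
  assumes l_nz: "l \<noteq> 0" and l_left: "\<And>g. g \<star> l = pr g u *s l" and l_right: "\<And>g. l \<star> g = pr g u *s l"
    and L_nz: "L \<noteq> 0" and L_left: "\<And>a. a \<cdot> L = pr a e *s L" and L_right: "\<And>a. L \<cdot> a = pr a e *s L"
begin

lemma unimodular_dual: "unimodular_hopf (\<lambda>i j k. d k i j) (\<lambda>k i j. m i j k) e u (\<lambda>i j. s j i) L l"
  by (intro unimodular_hopf.intro dual unimodular_hopf_axioms.intro)
     (simp_all add: l_nz L_nz l_left l_right L_left L_right)

lemmas ract_surj' = ract_surj[OF l_nz l_left] and ract_inj' = ract_inj0[OF l_nz l_left]

text \<open>Every functional has the form l(- S(h)), and L absorbs S(h) into a scalar; l(L) = 0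
  would therefore make all functionals vanish at L.\<close>

lemma pairing_nz: "pr l L \<noteq> 0"
proof
  assume 0: "pr l L = 0"
  have "pr f L = 0" for f
  proof -
    obtain h where "f = ract l h" using ract_surj' by blast
    then show ?thesis by (simp add: pr_ract L_right pr_scale_r 0)
  qed
  then show False using L_nz pr_eqI[of L 0] by simp
qed

text \<open>In S(h1) h2 L1 \<otimes> h3 L2 one can cancel S(h1) h2, or use h L = \<epsilon>(h) L on
  the pair (h2, h3); the two evaluations are the two sides.\<close>

lemma integral_shift_left:
  assumes F: "\<And>y. slin (\<lambda>x. F x y)" "\<And>x. slin (F x)"
  shows "sw d L (\<lambda>x y. F x (h \<cdot> y)) = sw d L (\<lambda>x y. F (S h \<cdot> x) y)"
proof -
  note F' [lin] = slin_comp[OF F(1)] slin_comp[OF F(2)]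
  let ?X = "sw d h (\<lambda>h1 h'. sw d h' (\<lambda>h2 h3. sw d L (\<lambda>x y. F (S h1 \<cdot> (h2 \<cdot> x)) (h3 \<cdot> y))))"
  have 1: "sw d h' (\<lambda>h2 h3. sw d L (\<lambda>x y. F (S h1 \<cdot> (h2 \<cdot> x)) (h3 \<cdot> y)))
      = pr e h' * sw d L (\<lambda>p q. F (S h1 \<cdot> p) q)" for h1 h'
  proof -
    have "sw d h' (\<lambda>h2 h3. sw d L (\<lambda>x y. F (S h1 \<cdot> (h2 \<cdot> x)) (h3 \<cdot> y))) = sw d (h' \<cdot> L) (\<lambda>p q. F (S h1 \<cdot> p) q)"
      by (rule sw_mul[symmetric]) (intro lin)+
    also have "\<dots> = pr h' e * sw d L (\<lambda>p q. F (S h1 \<cdot> p) q)"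
      unfolding L_left by (rule slin_scale) (intro lin)
    finally show ?thesis by (simp only: pr_commute)
  qed
  have X1: "?X = sw d L (\<lambda>x y. F (S h \<cdot> x) y)"
    unfolding 1 by (rule counit_r) (intro lin)
  have 2: "sw d k (\<lambda>h1 h2. sw d L (\<lambda>x y. F (S h1 \<cdot> (h2 \<cdot> x)) (h3 \<cdot> y))) = pr e k * sw d L (\<lambda>x y. F x (h3 \<cdot> y))"
    for k h3
    using anti_l[of "\<lambda>z. sw d L (\<lambda>x y. F (z \<cdot> x) (h3 \<cdot> y))" k] by (simp add: lin mul_assoc)
  have "?X = sw d h (\<lambda>k h3. sw d k (\<lambda>h1 h2. sw d L (\<lambda>x y. F (S h1 \<cdot> (h2 \<cdot> x)) (h3 \<cdot> y))))"
    by (rule coassoc[symmetric])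
  also have "\<dots> = sw d L (\<lambda>x y. F x (h \<cdot> y))"
    unfolding 2 by (rule counit_l) (intro lin)
  finally show ?thesis using X1 by simp
qed

text \<open>Mirror image of the previous argument, with L1 h1 \<otimes> L2 h2 S(h3).\<close>

lemma integral_shift_right:
  assumes F: "\<And>y. slin (\<lambda>x. F x y)" "\<And>x. slin (F x)"
  shows "sw d L (\<lambda>x y. F (x \<cdot> h) y) = sw d L (\<lambda>x y. F x (y \<cdot> S h))"
proof -
  note F' [lin] = slin_comp[OF F(1)] slin_comp[OF F(2)]
  let ?X = "sw d h (\<lambda>h1 h'. sw d h' (\<lambda>h2 h3. sw d L (\<lambda>x y. F (x \<cdot> h1) (y \<cdot> (h2 \<cdot> S h3)))))"
  have 1: "sw d k (\<lambda>h1 h2. sw d L (\<lambda>x y. F (x \<cdot> h1) (y \<cdot> (h2 \<cdot> S h3))))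
      = pr e k * sw d L (\<lambda>p q. F p (q \<cdot> S h3))" for k h3
  proof -
    have "sw d k (\<lambda>h1 h2. sw d L (\<lambda>x y. F (x \<cdot> h1) (y \<cdot> (h2 \<cdot> S h3))))
       = sw d L (\<lambda>x y. sw d k (\<lambda>h1 h2. F (x \<cdot> h1) ((y \<cdot> h2) \<cdot> S h3)))"
      by (simp only: mul_assoc, rule sw_swap)
    also have "\<dots> = sw d (L \<cdot> k) (\<lambda>p q. F p (q \<cdot> S h3))"
      by (rule sw_mul[symmetric]) (intro lin F)+
    also have "\<dots> = pr k e * sw d L (\<lambda>p q. F p (q \<cdot> S h3))"
      unfolding L_right by (rule slin_scale) (intro lin)
    finally show ?thesis by (simp only: pr_commute)
  qed
  have "?X = sw d h (\<lambda>k h3. sw d k (\<lambda>h1 h2. sw d L (\<lambda>x y. F (x \<cdot> h1) (y \<cdot> (h2 \<cdot> S h3)))))"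
    by (rule coassoc[symmetric])
  also have "\<dots> = sw d L (\<lambda>x y. F x (y \<cdot> S h))"
    unfolding 1 by (rule counit_l) (intro lin)
  finally have X1: "?X = sw d L (\<lambda>x y. F x (y \<cdot> S h))" .
  have 2: "sw d h' (\<lambda>h2 h3. sw d L (\<lambda>x y. F (x \<cdot> h1) (y \<cdot> (h2 \<cdot> S h3)))) = pr e h' * sw d L (\<lambda>x y. F (x \<cdot> h1) y)"
    for h1 h'
    using anti_r[of "\<lambda>z. sw d L (\<lambda>x y. F (x \<cdot> h1) (y \<cdot> z))" h'] by (simp add: lin)
  have "?X = sw d L (\<lambda>x y. F (x \<cdot> h) y)"
    unfolding 2 by (rule counit_r) (intro lin F)
  then show ?thesis using X1 by simp
qed

text \<open>Shifting h to the first leg leaves l alone on the second, where its invariance removes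
  the leg. Up to the factor l(L), the two legs of \<Delta>(L) are dual bases for the form l, here
  twisted by S.\<close>

lemma integral_dual_basis_left: "sw d L (\<lambda>x y. pr f x * pr l (h \<cdot> y)) = pr f (S h) * pr l L"
proof -
  define f' where "f' = (\<chi> i. pr f (S h \<cdot> axis i 1))"
  have f': "pr f' a = pr f (S h \<cdot> a)" for a unfolding f'_def by (rule pr_chi) (intro lin)
  have "sw d L (\<lambda>x y. pr f x * pr l (h \<cdot> y)) = sw d L (\<lambda>x y. pr f (S h \<cdot> x) * pr l y)"
    by (rule integral_shift_left) (intro lin)+
  also have "\<dots> = pr (f' \<star> l) L" by (simp add: pr_conv f')
  finally show ?thesis by (simp add: l_left pr_scale_l f')
qed

lemma integral_dual_basis_right: "sw d L (\<lambda>x y. pr f x * pr l (y \<cdot> S h)) = pr f h * pr l L"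
proof -
  have "sw d L (\<lambda>x y. pr f x * pr l (y \<cdot> S h)) = sw d L (\<lambda>x y. pr f (x \<cdot> h) * pr l y)"
    by (rule integral_shift_right[symmetric]) (intro lin)+
  also have "\<dots> = pr (rtrans f h \<star> l) L" by (simp add: pr_conv pr_rtrans)
  finally show ?thesis by (simp add: l_left pr_scale_l pr_rtrans)
qed

text \<open>The square of the antipode is the Nakayama automorphism of the Frobenius form \<open>l\<close>.\<close>

lemma nakayama: "pr l (x \<cdot> S (S k)) = pr l (k \<cdot> x)"
proof -
  define G where "G = (\<chi> i. pr l (axis i 1 \<cdot> S (S k)) - pr l (k \<cdot> axis i 1))"
  have sl: "slin (\<lambda>x. pr l (x \<cdot> S (S k)) - pr l (k \<cdot> x))"
    unfolding pr_diff_r[symmetric] by (intro lin)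
  have G: "pr G a = pr l (a \<cdot> S (S k)) - pr l (k \<cdot> a)" for a
    unfolding G_def by (rule pr_chi[OF sl])
  \<comment> \<open>The dual basis formula recovers h from G, up to l(L). Both terms of G contribute
    S(k), so that h = 0.\<close>
  obtain h where h: "G = ract l h" using ract_surj' by blast
  have "pr f h = 0" for f
  proof -
    have "pr f h * pr l L = sw d L (\<lambda>x y. pr f x * pr G y)"
      by (simp add: h pr_ract integral_dual_basis_right)
    also have "\<dots> = sw d L (\<lambda>x y. pr f x * pr l (y \<cdot> S (S k))) - sw d L (\<lambda>x y. pr f x * pr l (k \<cdot> y))"
      by (simp add: G sw_def sum_subtractf algebra_simps)
    also have "\<dots> = 0" by (simp add: integral_dual_basis_left integral_dual_basis_right)
    finally show ?thesis using pairing_nz by simp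
  qed
  then have "h = 0" using pr_eqI[of h 0] by simp
  then have "G = 0" unfolding h by (simp add: vlin_zero[of "ract l"] lin)
  then show ?thesis using G[of x] by simp
qed

text \<open>S' reverses convolution products, so it turns the right invariance of l into left
  invariance, and uniqueness yields the factor. It is non-zero because L lies in the image of S and
  l(L) is non-zero.\<close>

lemma integral_antipode: "\<exists>c. c \<noteq> 0 \<and> (\<forall>a. pr l (S a) = c * pr l a)"
proof -
  have "\<exists>c. S' l = c *s l"
  proof (rule left_integral_unique[OF l_nz l_left])
    fix g
    obtain g' where g: "g = S' g'" using antipode'_surj by blast
    have "S' (l \<star> g') = pr g' u *s S' l"
      unfolding l_right by (rule vlin_scale) (intro lin)
    then show "g \<star> S' l = pr g u *s S' l"
      by (simp add: g antipode'_mul pr_antipode')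
  qed
  then obtain c where c: "S' l = c *s l" by blast
  then have c': "pr l (S a) = c * pr l a" for a by (simp add: pr_antipode'[symmetric] pr_scale_l)
  moreover have "c \<noteq> 0"
  proof
    assume "c = 0"
    obtain h where "L = S h" using antipode_surj by blast
    then show False using c'[of h] pairing_nz \<open>c = 0\<close> by simp
  qed
  ultimately show ?thesis by blast
qed

text \<open>Moving factors past l by S^2, once after applying l(S(-)) = c l and once more after
  undoing it, gives l(k x) = l(k S^4(x)); l is nondegenerate.\<close>

lemma antipode_four: "S (S (S (S x))) = x"
proof -
  obtain c where c: "c \<noteq> 0" "\<And>a. pr l (S a) = c * pr l a" using integral_antipode by blast
  have "pr l (k \<cdot> x) = pr l (k \<cdot> S (S (S (S x))))" for k
  proof -
    have "c * pr l (k \<cdot> x) = pr l (S k \<cdot> S (S (S x)))"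
      by (simp add: c(2)[symmetric] antipode_mul nakayama)
    also have "\<dots> = c * pr l (S (S x) \<cdot> k)" by (simp add: c(2)[symmetric] antipode_mul)
    also have "\<dots> = c * pr l (k \<cdot> S (S (S (S x))))" by (simp add: nakayama)
    finally show ?thesis using c(1) by simp
  qed
  then have 1: "pr l (k \<cdot> (x - S (S (S (S x))))) = 0" for k
    by (simp add: vlin_diff[of "\<lambda>z. k \<cdot> z"] pr_diff_r lin)
  obtain z where z: "x - S (S (S (S x))) = S z" using antipode_surj by blast
  have "ract l z = 0" using 1 by (intro pr_eqI2) (simp add: pr_ract z)
  then have "z = 0" by (rule ract_inj')
  moreover have "S 0 = 0" by (rule vlin_zero) (intro lin)
  ultimately show ?thesis using z by simp
qed

end

section \<open>Traces\<close>

definition tr :: "('a::field^'n::finite \<Rightarrow> 'a^'n) \<Rightarrow> 'a"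
  where "tr F = (\<Sum>i\<in>UNIV. F (axis i 1) $ i)"

lemma tr_commute:
  assumes "vlin F" "vlin G" shows "tr (\<lambda>x. F (G x)) = tr (\<lambda>x. G (F x))"
  unfolding tr_def
  by (subst vlin_expand[OF assms(1), of "G _"], subst vlin_expand[OF assms(2), of "F _"],
      simp, subst sum.swap) (simp add: mult.commute)

context unimodular_hopf begin

text \<open>The trace is the sum of i-th coordinates of F(b_i); each coordinate functional is
  replaced by its expression through the dual bases L1, L2.\<close>

lemma trace_formula:
  assumes [lin]: "vlin F"
  shows "pr l L * tr F = sw d L (\<lambda>x y. pr l (y \<cdot> S (F x)))"
proof -
  have "pr l L * tr F = (\<Sum>i\<in>UNIV. sw d L (\<lambda>x y. pr (axis i 1) x * pr l (y \<cdot> S (F (axis i 1)))))"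
    by (simp only: integral_dual_basis_right) (simp add: tr_def sum_distrib_left mult.commute)
  also have "\<dots> = sw d L (\<lambda>x y. \<Sum>i\<in>UNIV. x $ i * pr l (y \<cdot> S (F (axis i 1))))"
    by (simp add: sw_sum)
  also have "\<dots> = sw d L (\<lambda>x y. pr l (y \<cdot> S (F x)))"
    by (rule sw_cong, rule slin_expand[symmetric]) (intro lin)
  finally show ?thesis .
qed

text \<open>S^4 = 1 allows L2 S(a S^2(L1)) to be rewritten as S^3(L1 S(L2)) S(a), in which the
  antipode axiom for L applies.\<close>

lemma trace_antipode_squared: "pr l L * tr (\<lambda>x. a \<cdot> S (S x)) = pr e L * pr l (S a)"
proof -
  have "y \<cdot> S (a \<cdot> S (S x)) = S (S (S (x \<cdot> S y))) \<cdot> S a" for x y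
    by (simp add: antipode_mul antipode_four mul_assoc)
  then have "pr l L * tr (\<lambda>x. a \<cdot> S (S x)) = sw d L (\<lambda>x y. pr l (S (S (S (x \<cdot> S y))) \<cdot> S a))"
    by (subst trace_formula) (intro lin, simp)
  also have "\<dots> = pr e L * pr l (S (S (S u)) \<cdot> S a)"
    by (rule anti_r[where F = "\<lambda>z. pr l (S (S (S z)) \<cdot> S a)"]) (intro lin)
  finally show ?thesis by simp
qed

end

lemma of_nat_eq_0_prime:
  assumes "Factorial_Ring.prime p" "of_nat p = (0::'a::field)" "of_nat k = (0::'a)"
  shows "p dvd k"
proof (rule ccontr)
  assume "\<not> p dvd k"
  then have "coprime (int k) (int p)"
    using assms(1) prime_imp_coprime[of p k] by (simp add: ac_simps)
  then obtain x y where "x * int k + y * int p = 1"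
    using bezout_int[of "int k" "int p"] by (auto simp: coprime_iff_gcd_eq_1)
  then have "of_int x * of_nat k + of_int y * of_nat p = (1::'a)"
    by (metis of_int_add of_int_mult of_int_of_nat_eq of_int_1)
  then show False using assms by simp
qed

text \<open>N acts as the scalar c on its image. In a basis extending one of the image, the vectors
  outside it contribute nothing, since N sends them into the image. The case c = 1 serves
  idempotents, c = 0 maps of square zero.\<close>

lemma tr_range:
  fixes N :: "'a::field^'n::finite \<Rightarrow> 'a^'n"
  assumes N: "vlin N" and NN: "\<And>x. N (N x) = c *s N x"
  shows "tr N = of_nat (vec.dim (range N)) * c"
proof -
  have lin: "Vector_Spaces.linear (*s) (*s) N" using N by (simp add: vlin_linear)
  have sub: "vec.subspace (range N)"
    using vec.linear_subspace_image[OF lin vec.subspace_UNIV] .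
  obtain B where B: "B \<subseteq> range N" "vec.independent B" "range N \<subseteq> vec.span B" "card B = vec.dim (range N)"
    using vec.basis_exists[of "range N"] by blast
  define B' where "B' = vec.extend_basis B"
  have B': "vec.independent B'" "vec.span B' = UNIV" "B \<subseteq> B'"
    unfolding B'_def using B(2)
    by (simp_all add: vec.independent_extend_basis vec.span_extend_basis vec.extend_basis_superset)
  have fin: "finite B'" by (rule vec.finiteI_independent[OF B'(1)])
  let ?r = "\<lambda>v b. vec.representation B' v b"
  have add: "?r (x + y) b = ?r x b + ?r y b" for x y b
    by (simp add: vec.representation_add[OF B'(1)] B'(2))
  have scale: "?r (k *s x) b = k * ?r x b" for k x b
    by (simp add: vec.representation_scale[OF B'(1)] B'(2))
  have "slin (\<lambda>v. ?r v b)" for b by (rule slinI) (simp_all add: add scale)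
  then have sl: "slin (\<lambda>v. ?r (N v) b)" for b using slin_comp[OF _ N] by blast
  have rep: "v = (\<Sum>b\<in>B'. ?r v b *s b)" for v
    by (rule vec.sum_representation_eq[symmetric]) (simp_all add: B' fin)
  have "tr N = (\<Sum>i\<in>UNIV. \<Sum>b\<in>B'. ?r (N (axis i 1)) b * b $ i)"
    unfolding tr_def by (subst rep) simp
  also have "\<dots> = (\<Sum>b\<in>B'. \<Sum>i\<in>UNIV. b $ i * ?r (N (axis i 1)) b)"
    by (subst sum.swap) (simp add: mult.commute)
  also have "\<dots> = (\<Sum>b\<in>B'. ?r (N b) b)"
    by (simp add: slin_expand[OF sl, symmetric])
  also have "\<dots> = (\<Sum>b\<in>B'. if b \<in> B then c else 0)"
  proof (rule sum.cong[OF refl])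
    fix b assume b: "b \<in> B'"
    show "?r (N b) b = (if b \<in> B then c else 0)"
    proof (cases "b \<in> B")
      case True
      then obtain x where "b = N x" using B(1) by blast
      then have "N b = c *s b" using NN by simp
      then show ?thesis using True b by (simp add: scale vec.representation_basis[OF B'(1)])
    next
      case False
      have "?r (N b) = vec.representation B (N b)"
        by (rule vec.representation_extend[OF B'(1) _ B'(3)]) (use B(3) in blast)
      then show ?thesis using False vec.representation_ne_zero[of B "N b" b] by auto
    qed
  qed
  also have "\<dots> = of_nat (card B) * c"
    using fin B'(3) by (simp add: sum.If_cases Int_absorb1)
  finally show ?thesis by (simp add: B(4))
qed

lemma idempotent_trace_0:
  fixes N :: "'a::field^'n::finite \<Rightarrow> 'a^'n"
  assumes p: "Factorial_Ring.prime CARD('n)" "of_nat CARD('n) = (0::'a)"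
    and N: "vlin N" "\<And>x. N (N x) = N x" and tr: "tr N = 0"
  shows "(\<forall>x. N x = 0) \<or> (\<forall>x. N x = x)"
proof -
  have sub: "vec.subspace (range N)"
    using vec.linear_subspace_image[OF N(1)[unfolded vlin_linear] vec.subspace_UNIV] .
  have "of_nat (vec.dim (range N)) = (0::'a)"
    using tr_range[OF N(1), of 1] N(2) tr by simp
  then have "CARD('n) dvd vec.dim (range N)" by (rule of_nat_eq_0_prime[OF p])
  moreover have "vec.dim (range N) \<le> CARD('n)"
    using vec.dim_subset[of "range N" UNIV] vec_dim_card[where 'a='a and 'n='n] by simp
  ultimately consider "vec.dim (range N) = 0" | "vec.dim (range N) = CARD('n)"
    using dvd_imp_le by fastforce
  then show ?thesis
  proof cases
    case 1
    then have "range N \<subseteq> {0}" by (simp add: vec.dim_eq_0)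
    then show ?thesis by blast
  next
    case 2
    then have "range N = UNIV"
      using vec.subspace_dim_equal[OF sub vec.subspace_UNIV] vec_dim_card[where 'a='a and 'n='n] by simp
    then show ?thesis using N(2) by (metis rangeE rangeI surjD)
  qed
qed

section \<open>Independent families\<close>

text \<open>Families are indexed by numbers because they will be powers of one element; a repeated
  member counts as a dependence.\<close>

definition fam_indep :: "(nat \<Rightarrow> 'a::field^'n::finite) \<Rightarrow> nat \<Rightarrow> bool"
  where "fam_indep b n \<longleftrightarrow> (\<forall>c. (\<Sum>i<n. c i *s b i) = 0 \<longrightarrow> (\<forall>i<n. c i = 0))"

lemma fam_indepD: "fam_indep b n \<Longrightarrow> (\<Sum>i<n. c i *s b i) = 0 \<Longrightarrow> i < n \<Longrightarrow> c i = 0"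
  unfolding fam_indep_def by blast

lemma fam_indep_inj: assumes "fam_indep b n" shows "inj_on b {..<n}"
proof (rule inj_onI, rule ccontr)
  fix i j assume ij: "i \<in> {..<n}" "j \<in> {..<n}" "b i = b j" "i \<noteq> j"
  let ?c = "\<lambda>k. (if k = i then 1 else 0) - (if k = j then 1 else 0) :: 'a"
  have "(\<Sum>k<n. ?c k *s b k) = (\<Sum>k<n. (if k = i then b k else 0) - (if k = j then b k else 0))"
    by (rule sum.cong) (auto simp: vec_eq_iff)
  also have "\<dots> = 0" using ij by (simp add: sum_subtractf)
  finally have "?c i = 0" by (rule fam_indepD[OF assms]) (use ij in simp)
  then show False using ij by simp
qed

lemma fam_functional:
  fixes b :: "nat \<Rightarrow> 'a::field^'n::finite"
  assumes "fam_indep b n"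
  shows "\<exists>f. \<forall>i<n. pr f (b i) = v i"
proof -
  have inj: "inj_on b {..<n}" by (rule fam_indep_inj[OF assms])
  have ind: "vec.independent (b ` {..<n})"
  proof (rule vec.independent_if_scalars_zero)
    fix f x assume s: "(\<Sum>x\<in>b ` {..<n}. f x *s x) = 0" and "x \<in> b ` {..<n}"
    then obtain i where "i < n" "x = b i" by auto
    moreover have "(\<Sum>i<n. f (b i) *s b i) = 0" using s by (simp add: sum.reindex[OF inj])
    ultimately show "f x = 0" using fam_indepD[OF assms, of "\<lambda>i. f (b i)"] by simp
  qed simp
  \<comment> \<open>The extension theorem is used with vector values: the prescribed scalars are put
    on one arbitrary coordinate and read off again there.\<close>
  obtain g where g: "Vector_Spaces.linear (*s) (*s) g"
      "\<forall>x\<in>b ` {..<n}. g x = v (the_inv_into {..<n} b x) *s (axis undefined 1 :: 'a^'n)"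
    using vec.linear_independent_extend[OF ind, of "\<lambda>x. v (the_inv_into {..<n} b x) *s axis undefined 1"] by blast
  have "slin (\<lambda>x. g x $ undefined)"
    using g(1) by (intro slin_nth) (simp add: vlin_linear)
  then have "pr (\<chi> i. g (axis i 1) $ undefined) x = g x $ undefined" for x by (rule pr_chi)
  then show ?thesis
    by (intro exI[of _ "\<chi> i. g (axis i 1) $ undefined"]) (simp add: g(2) the_inv_into_f_f[OF inj])
qed

lemma fam_span:
  fixes b :: "nat \<Rightarrow> 'a::field^'n::finite"
  assumes "fam_indep b CARD('n)"
  shows "\<exists>c. a = (\<Sum>i<CARD('n). c i *s b i)"
proof -
  obtain h where h: "bij_betw h (UNIV::'n set) {..<CARD('n)}"
    using ex_bij_betw_finite_nat[of "UNIV::'n set"] by (auto simp: atLeast0LessThan)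
  let ?G = "\<lambda>c::'a^'n. \<Sum>j\<in>UNIV. c $ j *s b (h j)"
  let ?g = "the_inv_into UNIV h"
  have hg: "h (?g i) = i" if "i < CARD('n)" for i
    using that f_the_inv_into_f_bij_betw[OF h] by auto
  have G: "?G c = (\<Sum>i<CARD('n). c $ ?g i *s b i)" for c
    by (subst sum.reindex_bij_betw[OF h, symmetric])
       (simp add: the_inv_into_f_f[OF bij_betw_imp_inj_on[OF h]])
  have G1: "vlin ?G"
    by (rule vlinI) (simp_all add: vec.scale_left_distrib sum.distrib vec.scale_sum_right)
  have G2: "c = 0" if "?G c = 0" for c
  proof -
    have "c $ j = 0" for j
    proof -
      have "h j < CARD('n)" using bij_betwE[OF h] by blast
      then show ?thesis
        using fam_indepD[OF assms, of "\<lambda>i. c $ ?g i" "h j"] that unfolding G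
        by (simp add: the_inv_into_f_f[OF bij_betw_imp_inj_on[OF h]])
    qed
    then show ?thesis by (simp add: vec_eq_iff)
  qed
  obtain c where "a = ?G c" using vlin_inj_surj[of ?G a, OF G1 G2] by blast
  then show ?thesis unfolding G by (intro exI)
qed

lemma fam_indep_mono: assumes "fam_indep b n" "k \<le> n" shows "fam_indep b k"
  unfolding fam_indep_def
proof (intro allI impI)
  fix c i assume c: "(\<Sum>i<k. c i *s b i) = 0" and i: "i < k"
  have "(\<Sum>i<n. (if i < k then c i else 0) *s b i) = (\<Sum>i<k. c i *s b i)"
    using assms(2) by (intro sum.mono_neutral_cong_right) auto
  then show "c i = 0" using fam_indepD[OF assms(1), of "\<lambda>i. if i < k then c i else 0" i] c i assms(2) by simp
qed

lemma fam_not_indep: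
  fixes b :: "nat \<Rightarrow> 'a::field^'n::finite"
  shows "\<not> fam_indep b (Suc CARD('n))"
proof
  assume *: "fam_indep b (Suc CARD('n))"
  then obtain c where c: "b CARD('n) = (\<Sum>i<CARD('n). c i *s b i)"
    using fam_span[OF fam_indep_mono[OF *]] by fastforce
  let ?c = "\<lambda>i. if i < CARD('n) then c i else -1"
  have "(\<Sum>i<Suc CARD('n). ?c i *s b i) = 0" by (simp add: c)
  then have "?c CARD('n) = 0" by (rule fam_indepD[OF *]) simp
  then show False by simp
qed

lemma fam_slin_eqI:
  fixes b :: "nat \<Rightarrow> 'a::field^'n::finite"
  assumes "fam_indep b CARD('n)" "slin F" "slin G" "\<And>i. i < CARD('n) \<Longrightarrow> F (b i) = G (b i)"
  shows "F a = G a"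
proof -
  obtain c where "a = (\<Sum>i<CARD('n). c i *s b i)" using fam_span[OF assms(1)] by blast
  then show ?thesis by (simp add: slin_sum_arg assms slin_scale)
qed

section \<open>Group-like and primitive elements\<close>

context hopf_constants begin

definition pw where "pw x i = ((\<lambda>y. y \<cdot> x) ^^ i) u"

lemma pw_0 [simp]: "pw x 0 = u" and pw_Suc: "pw x (Suc i) = pw x i \<cdot> x"
  by (simp_all add: pw_def)

lemma pw_1 [simp]: "pw x (Suc 0) = x" by (simp add: pw_Suc)

lemma pw_add: "pw x (i + j) = pw x i \<cdot> pw x j"
  by (induction j) (simp_all add: pw_Suc mul_assoc)

lemma pw_Suc': "pw x (Suc i) = x \<cdot> pw x i"
  using pw_add[of x 1 i] by simp

lemma pw_scale: "pw (c *s x) i = (c ^ i) *s pw x i"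
  by (induction i)
     (simp_all add: pw_Suc vlin_scale[of "\<lambda>z. z \<cdot> x"] vlin_scale[of "\<lambda>z. y \<cdot> z" for y] lin mult.commute)

text \<open>\<Delta>(g) = g \<otimes> g says that evaluation at g is multiplicative on the dual;
  \<epsilon>(g) = 1 excludes zero. Likewise, an element is primitive if evaluation at it is a
  derivation along evaluation at 1.\<close>

definition glike where "glike g \<longleftrightarrow> (\<forall>f h. pr (f \<star> h) g = pr f g * pr h g) \<and> pr e g = 1"
definition primitive where "primitive x \<longleftrightarrow> (\<forall>f h. pr (f \<star> h) x = pr f x * pr h u + pr f u * pr h x)"

lemma glike_sw:
  assumes "glike g" and F: "\<And>y. slin (\<lambda>x. F x y)" "\<And>x. slin (F x)"
  shows "sw d g F = F g g"
  using assms(1) by (subst bilin_expand[of F, OF F]) (simp add: sw_alt glike_def)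

lemma primitive_sw:
  assumes "primitive g" and F: "\<And>y. slin (\<lambda>x. F x y)" "\<And>x. slin (F x)"
  shows "sw d g F = F g u + F u g"
  using assms(1)
  by (subst bilin_expand[of F g, OF F], subst bilin_expand[of F u, OF F])
     (simp add: sw_alt primitive_def distrib_right sum.distrib)

lemma primitive_eps: assumes "primitive x" shows "pr e x = 0"
proof -
  have "pr (e \<star> e) x = pr e x * pr e u + pr e u * pr e x" using assms unfolding primitive_def by blast
  then show ?thesis by (simp only: conv_unit_l eps_unit mult_1_left mult_1_right add_cancel_right_right)
qed

lemma glike_mul: assumes "glike g" "glike h" shows "glike (g \<cdot> h)"
proof -
  have "pr (f \<star> f') (g \<cdot> h) = pr f (g \<cdot> h) * pr f' (g \<cdot> h)" for f f'
  proof -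
    have "pr (f \<star> f') (g \<cdot> h) = sw d g (\<lambda>x y. sw d h (\<lambda>p q. pr f (x \<cdot> p) * pr f' (y \<cdot> q)))"
      unfolding pr_conv by (rule sw_mul) (intro lin)+
    also have "\<dots> = sw d h (\<lambda>p q. pr f (g \<cdot> p) * pr f' (g \<cdot> q))"
      by (rule glike_sw[OF assms(1)]) (intro lin)+
    also have "\<dots> = pr f (g \<cdot> h) * pr f' (g \<cdot> h)"
      by (rule glike_sw[OF assms(2)]) (intro lin)+
    finally show ?thesis .
  qed
  then show ?thesis using assms by (simp add: glike_def eps_mul)
qed

lemma glike_unit: "glike u" by (simp add: glike_def conv_at_unit[unfolded pr_commute[of u]])

lemma glike_pw: "glike g \<Longrightarrow> glike (pw g i)"
  by (induction i) (simp_all add: pw_Suc glike_unit glike_mul)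

lemma glike_antipode: assumes "glike g" shows "S g \<cdot> g = u"
proof (rule pr_eqI)
  fix f
  have "sw d g (\<lambda>x y. pr f (S x \<cdot> y)) = pr f (S g \<cdot> g)" by (rule glike_sw[OF assms]) (intro lin)+
  moreover have "sw d g (\<lambda>x y. pr f (S x \<cdot> y)) = pr e g * pr f u" by (rule anti_l) (intro lin)
  ultimately show "pr f (S g \<cdot> g) = pr f u" using assms by (simp add: glike_def)
qed

lemma primitive_antipode: assumes "primitive x" shows "S x = - x"
proof (rule pr_eqI)
  fix f
  have "sw d x (\<lambda>x y. pr f (S x \<cdot> y)) = pr f (S x \<cdot> u) + pr f (S u \<cdot> x)"
    by (rule primitive_sw[OF assms]) (intro lin)+
  moreover have "sw d x (\<lambda>x y. pr f (S x \<cdot> y)) = pr e x * pr f u" by (rule anti_l) (intro lin)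
  ultimately have "pr f (S x) + pr f x = 0" using primitive_eps[OF assms] by simp
  moreover have "pr f (- x) + pr f x = 0" by (simp add: pr_add_r[symmetric])
  ultimately show "pr f (S x) = pr f (- x)" by (metis add_right_cancel)
qed

lemma antipode_pw: "S (pw x i) = pw (S x) i"
  by (induction i) (simp_all add: pw_Suc antipode_mul pw_Suc'[symmetric])

definition reg where "reg = (\<chi> i. tr (\<lambda>x. axis i 1 \<cdot> x))"

lemma pr_reg: "pr reg a = tr (\<lambda>x. a \<cdot> x)"
  unfolding reg_def by (rule pr_chi) (unfold tr_def, intro lin)

lemma reg_unit: "pr reg u = of_nat CARD('n)"
  by (simp add: pr_reg tr_def axis_def)

lemma reg_commute: "pr reg (a \<cdot> b) = pr reg (b \<cdot> a)"
  unfolding pr_reg mul_assoc by (rule tr_commute) (intro lin)+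

text \<open>The regular character is multiplied by a character of dimension $n$ to its $n$-fold: here
  $H \otimes H \cong H \otimes H_{\mathrm{triv}}$ via $h \otimes k \mapsto h_{(1)} \otimes h_{(2)} k$.\<close>

lemma reg_conv_reg: "pr (reg \<star> reg) a = of_nat CARD('n) * pr reg a"
proof -
  \<comment> \<open>b2 S(b3) is inserted under \<open>reg\<close>, and cyclicity of the trace brings
    S(b3) to the front.\<close>
  have 1: "sw d a (\<lambda>x y. (x \<cdot> b) $ i * pr reg y)
    = sw d b (\<lambda>b1 b2. sw d (a \<cdot> b1) (\<lambda>p q. p $ i * pr reg (S b2 \<cdot> q)))" for b i
  proof -
    have "sw d b (\<lambda>b1 b2. sw d (a \<cdot> b1) (\<lambda>p q. p $ i * pr reg (S b2 \<cdot> q)))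
      = sw d b (\<lambda>b1 b2. sw d a (\<lambda>x y. sw d b1 (\<lambda>p q. (x \<cdot> p) $ i * pr reg (S b2 \<cdot> (y \<cdot> q)))))"
      by (rule sw_cong, rule sw_mul) (intro lin)+
    also have "\<dots> = sw d a (\<lambda>x y. sw d b (\<lambda>b1 b2. sw d b1 (\<lambda>p q. (x \<cdot> p) $ i * pr reg (y \<cdot> (q \<cdot> S b2)))))"
      by (simp only: reg_commute[of "S _"] mul_assoc, rule sw_swap)
    also have "\<dots> = sw d a (\<lambda>x y. sw d b (\<lambda>p w. sw d w (\<lambda>q b2. (x \<cdot> p) $ i * pr reg (y \<cdot> (q \<cdot> S b2)))))"
      by (rule sw_cong, rule coassoc)
    also have "\<dots> = sw d a (\<lambda>x y. sw d b (\<lambda>p w. pr e w * ((x \<cdot> p) $ i * pr reg (y \<cdot> u))))"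
      by (rule sw_cong, rule sw_cong, rule anti_r[where F = "\<lambda>z. (_ \<cdot> _) $ i * pr reg (_ \<cdot> z)"]) (intro lin)
    also have "\<dots> = sw d a (\<lambda>x y. (x \<cdot> b) $ i * pr reg (y \<cdot> u))"
      by (rule sw_cong, rule counit_r) (intro lin)
    finally show ?thesis by simp
  qed
  have "pr (reg \<star> reg) a = (\<Sum>i\<in>UNIV. sw d a (\<lambda>x y. (x \<cdot> axis i 1) $ i * pr reg y))"
    unfolding pr_conv by (subst (1) pr_reg) (simp add: tr_def sum_distrib_right sw_sum)
  also have "\<dots> = (\<Sum>k\<in>UNIV. sw d (axis k 1) (\<lambda>b1 b2. sw d (a \<cdot> b1) (\<lambda>p q. pr (axis k 1) p * pr reg (S b2 \<cdot> q))))"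
    by (simp add: 1)
  also have "\<dots> = (\<Sum>i\<in>UNIV. \<Sum>j\<in>UNIV. sw d (a \<cdot> axis i 1) (\<lambda>p q. pr (axis i 1 \<star> axis j 1) p * pr reg (S (axis j 1) \<cdot> q)))"
    by (rule sum_basis_comult) (intro lin)
  also have "\<dots> = (\<Sum>i\<in>UNIV. \<Sum>j\<in>UNIV. sw d (a \<cdot> axis i 1) (\<lambda>p q. sw d p (\<lambda>r v. r $ i * (v $ j * pr reg (S (axis j 1) \<cdot> q)))))"
    by (simp add: pr_conv sw_cmult_r[symmetric] mult.assoc)
  also have "\<dots> = (\<Sum>i\<in>UNIV. sw d (a \<cdot> axis i 1) (\<lambda>p q. sw d p (\<lambda>r v. r $ i * (\<Sum>j\<in>UNIV. v $ j * pr reg (S (axis j 1) \<cdot> q)))))"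
    by (simp add: sum_distrib_left sw_sum)
  also have "\<dots> = (\<Sum>i\<in>UNIV. sw d (a \<cdot> axis i 1) (\<lambda>p q. sw d p (\<lambda>r v. r $ i * pr reg (S v \<cdot> q))))"
    by (rule sum.cong[OF refl], rule sw_cong, rule sw_cong, rule arg_cong[where f = "\<lambda>z. _ * z"],
        rule slin_expand[symmetric]) (intro lin)
  \<comment> \<open>Coassociativity brings S(v) and q together; they cancel and leave reg(1), which
    is the dimension.\<close>
  also have "\<dots> = (\<Sum>i\<in>UNIV. sw d (a \<cdot> axis i 1) (\<lambda>r w. sw d w (\<lambda>v q. r $ i * pr reg (S v \<cdot> q))))"
    by (rule sum.cong[OF refl], rule coassoc)
  also have "\<dots> = (\<Sum>i\<in>UNIV. sw d (a \<cdot> axis i 1) (\<lambda>r w. pr e w * (r $ i * pr reg u)))"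
    by (rule sum.cong[OF refl], rule sw_cong, rule anti_l[where F = "\<lambda>z. _ $ _ * pr reg z"]) (intro lin)
  also have "\<dots> = (\<Sum>i\<in>UNIV. (a \<cdot> axis i 1) $ i * pr reg u)"
    by (rule sum.cong[OF refl], rule counit_r) (intro lin)
  finally show ?thesis by (simp add: pr_reg[of a] tr_def sum_distrib_right[symmetric] reg_unit)
qed

text \<open>S^2 is an algebra automorphism, so left multiplication by S^2(a) is conjugate to that by
  a; S^4 = 1 provides the inverse.\<close>

lemma reg_antipode_squared:
  assumes "\<And>x. S (S (S (S x))) = x" shows "pr reg (S (S a)) = pr reg a"
proof -
  have "pr reg (S (S a)) = tr (\<lambda>x. S (S (a \<cdot> S (S x))))"
    by (simp add: pr_reg antipode_mul assms)
  also have "\<dots> = tr (\<lambda>x. a \<cdot> S (S (S (S x))))"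
    by (rule tr_commute[where F = "\<lambda>x. S (S x)"]) (intro lin)+
  finally show ?thesis by (simp add: assms pr_reg)
qed

end

section \<open>Powers of group-like and of primitive elements\<close>

lemma sum_pascal:
  "(\<Sum>k\<le>n. of_nat (n choose k) * A (Suc k) (n - k)) + (\<Sum>k\<le>n. of_nat (n choose k) * A k (Suc n - k))
    = (\<Sum>k\<le>Suc n. of_nat (Suc n choose k) * (A k (Suc n - k) :: 'a::comm_semiring_1))"
proof -
  have "(\<Sum>k\<le>n. of_nat (n choose k) * A k (Suc n - k)) = (\<Sum>k\<le>Suc n. of_nat (n choose k) * A k (Suc n - k))"
    by (simp add: binomial_eq_0)
  also have "\<dots> = A 0 (Suc n) + (\<Sum>k\<le>n. of_nat (n choose Suc k) * A (Suc k) (n - k))"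
    by (subst sum.atMost_Suc_shift) simp
  finally show ?thesis
    by (subst sum.atMost_Suc_shift) (simp add: sum.distrib distrib_right add.assoc add.left_commute)
qed

context hopf_constants begin

text \<open>The first dependence among the powers makes g^n an earlier power, hence g^n = 1 by
  cancellation. If n < p, then n is invertible and the average z of the powers is an idempotent with
  reg(z) = 0, because reg(g^i)^2 = p reg(g^i). Then z = 0 contradicts \<epsilon>(z) = 1, and z = 1
  contradicts g z = z.\<close>

lemma glike_order:
  assumes p: "Factorial_Ring.prime CARD('n)" "of_nat CARD('n) = (0::'a)" and g: "glike g" "g \<noteq> u"
  shows "fam_indep (pw g) CARD('n) \<and> pw g CARD('n) = u"
proof -
  \<comment> \<open>The powers 0, ..., n-1 are independent, and n is maximal with this
    property.\<close>
  define n where "n = (LEAST n. \<not> fam_indep (pw g) (Suc n))"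
  have n: "\<not> fam_indep (pw g) (Suc n)" unfolding n_def by (rule LeastI[of _ "CARD('n)"]) (rule fam_not_indep)
  have n_le: "n \<le> CARD('n)" unfolding n_def by (rule Least_le) (rule fam_not_indep)
  have u_nz: "u \<noteq> 0" using eps_unit by force
  have "fam_indep (pw g) (Suc 0)"
    unfolding fam_indep_def using u_nz by (auto simp: vec_eq_iff)
  then have n_pos: "n > 0" using n by (cases n) auto
  then have ind: "fam_indep (pw g) n"
    using not_less_Least[of "n - 1" "\<lambda>n. \<not> fam_indep (pw g) (Suc n)"] by (simp add: n_def[symmetric])
  have gl: "glike (pw g i)" for i by (rule glike_pw[OF g(1)])
  obtain c where c: "(\<Sum>i<Suc n. c i *s pw g i) = 0" "\<exists>i<Suc n. c i \<noteq> 0"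
    using n unfolding fam_indep_def by blast
  have "c n \<noteq> 0"
  proof
    assume "c n = 0"
    then have "(\<Sum>i<n. c i *s pw g i) = 0" using c(1) by simp
    then have "\<forall>i<n. c i = 0" using ind fam_indepD by blast
    then show False using c(2) \<open>c n = 0\<close> less_Suc_eq by auto
  qed
  define a where "a i = - c i / c n" for i
  have "(\<Sum>i<n. a i *s pw g i) = (- 1 / c n) *s (\<Sum>i<n. c i *s pw g i)"
    by (simp add: a_def vec.scale_sum_right)
  also have "(\<Sum>i<n. c i *s pw g i) = - (c n *s pw g n)" using c(1) by (simp add: eq_neg_iff_add_eq_0)
  finally have gn: "pw g n = (\<Sum>i<n. a i *s pw g i)" using \<open>c n \<noteq> 0\<close> by (simp add: vec_eq_iff)
  have "\<exists>f. \<forall>i<n. pr f (pw g i) = (if i = j then 1 else 0)" for j by (rule fam_functional[OF ind])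
  then obtain f where f: "\<And>i j. i < n \<Longrightarrow> pr (f j) (pw g i) = (if i = j then 1 else 0)" by metis
  have fn: "pr (f j) (pw g n) = a j" if "j < n" for j
    using that by (simp add: gn pr_sum_r pr_scale_r f if_distrib[of "\<lambda>z. _ * z"] cong: if_cong)
  \<comment> \<open>Since g^n and the earlier powers are group-like, the coefficients of g^n are
    orthogonal idempotents of the field; \<epsilon> makes their sum 1, so exactly one of them is 1
    and the others vanish.\<close>
  have aa: "a j * a k = (if j = k then a j else 0)" if "j < n" "k < n" for j k
  proof -
    have "a j * a k = pr (f j \<star> f k) (pw g n)" using gl[of n] that by (simp add: glike_def fn)
    also have "\<dots> = (\<Sum>i<n. a i * (pr (f j) (pw g i) * pr (f k) (pw g i)))"
      unfolding gn pr_sum_r pr_scale_r using gl by (simp add: glike_def)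
    also have "\<dots> = (\<Sum>i<n. if i = j then if j = k then a j else 0 else 0)"
      by (rule sum.cong) (auto simp: f)
    finally show ?thesis using that by simp
  qed
  have "pr e (pw g n) = (\<Sum>i<n. a i * pr e (pw g i))" by (simp add: gn pr_sum_r pr_scale_r)
  then have "(\<Sum>i<n. a i) = 1" using gl by (simp add: glike_def)
  then obtain i where i: "i < n" "a i \<noteq> 0" by (metis lessThan_iff sum.neutral zero_neq_one)
  have "a i = 1" using aa[OF i(1) i(1)] i(2) by simp
  moreover have "a k = 0" if "k < n" "k \<noteq> i" for k using aa[OF i(1) that(1)] i(2) that(2) by auto
  ultimately have "pw g n = (\<Sum>k<n. if k = i then pw g i else 0)"
    unfolding gn by (intro sum.cong) auto
  then have gni: "pw g n = pw g i" using i by simp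
  have gninv: "S (pw g i) \<cdot> (pw g i \<cdot> z) = z" for z
    by (simp add: mul_assoc[symmetric] glike_antipode[OF gl])
  have "pw g i \<cdot> pw g (n - i) = pw g i \<cdot> u"
    using gni i by (simp add: pw_add[symmetric])
  then have gm: "pw g (n - i) = u" by (metis gninv)
  have "i = 0"
  proof (rule ccontr)
    assume "i \<noteq> 0"
    then have "n - i = 0" using fam_indep_inj[OF ind] gm i by (auto dest!: inj_onD[where x = "n - i" and y = 0])
    then show False using i by simp
  qed
  then have gn1: "pw g n = u" using gm by simp
  have "n = CARD('n)"
  proof (rule ccontr)
    assume "n \<noteq> CARD('n)"
    then have "n < CARD('n)" using n_le by simp
    then have nn: "of_nat n \<noteq> (0::'a)" using of_nat_eq_0_prime[OF p, of n] n_pos by (metis dvd_imp_le not_less)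
    define z where "z = (1 / of_nat n) *s (\<Sum>i<n. pw g i)"
    have "g \<cdot> (\<Sum>i<n. pw g i) = (\<Sum>i<n. pw g (Suc i))"
      by (simp add: vlin_sum_arg[of "\<lambda>z. g \<cdot> z"] lin pw_Suc')
    also have "\<dots> = (\<Sum>i<n. pw g i)"
      using sum.lessThan_Suc_shift[of "pw g" n] by (simp add: gn1)
    finally have gz: "g \<cdot> z = z" by (simp add: z_def vlin_scale[of "\<lambda>z. g \<cdot> z"] lin)
    have giz: "pw g i \<cdot> z = z" for i by (induction i) (simp_all add: pw_Suc mul_assoc gz)
    have "z \<cdot> z = (1 / of_nat n) *s (\<Sum>i<n. pw g i \<cdot> z)"
      by (subst (1) z_def) (simp add: vlin_scale[of "\<lambda>y. y \<cdot> z"] vlin_sum_arg[of "\<lambda>y. y \<cdot> z"] lin)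
    then have zz: "z \<cdot> z = z" using nn by (simp add: giz vec_eq_iff of_nat_index)
    have "pr reg (pw g i) * pr reg (pw g i) = 0" for i
      using reg_conv_reg[of "pw g i"] gl[of i] p(2) by (simp add: glike_def)
    then have "pr reg z = 0" by (simp add: z_def pr_scale_r pr_sum_r)
    then have "(\<forall>x. z \<cdot> x = 0) \<or> (\<forall>x. z \<cdot> x = x)"
      by (intro idempotent_trace_0[OF p]) (intro lin, simp_all add: mul_assoc[symmetric] zz pr_reg)
    moreover have "pr e z = 1" using gl nn by (simp add: z_def pr_scale_r pr_sum_r glike_def)
    moreover have "z \<cdot> u \<noteq> 0" using \<open>pr e z = 1\<close> by auto
    ultimately have "z = u" by (metis unit_r)
    then show False using gz g(2) by simp
  qed
  then show ?thesis using ind gn1 by simp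
qed

text \<open>The binomial theorem for the commuting elements x \<otimes> 1 and 1 \<otimes> x. The
  induction is over all f and h at once, since a further factor x is moved into them by
  \<open>rtrans\<close>.\<close>

lemma primitive_pw:
  assumes "primitive x"
  shows "pr (f \<star> h) (pw x n) = (\<Sum>k\<le>n. of_nat (n choose k) * (pr f (pw x k) * pr h (pw x (n - k))))"
proof (induction n arbitrary: f h)
  case 0 show ?case by (simp add: conv_at_unit[unfolded pr_commute[of u]])
next
  case (Suc n)
  have "pr (f \<star> h) (pw x (Suc n)) = sw d (pw x n) (\<lambda>a b. sw d x (\<lambda>p q. pr f (a \<cdot> p) * pr h (b \<cdot> q)))"
    unfolding pw_Suc pr_conv by (rule sw_mul) (intro lin)+
  also have "\<dots> = sw d (pw x n) (\<lambda>a b. pr f (a \<cdot> x) * pr h (b \<cdot> u) + pr f (a \<cdot> u) * pr h (b \<cdot> x))"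
    by (rule sw_cong, rule primitive_sw[OF assms]) (intro lin)+
  also have "\<dots> = pr (rtrans f x \<star> h) (pw x n) + pr (f \<star> rtrans h x) (pw x n)"
    unfolding pr_conv pr_rtrans by (simp add: sw_def sum.distrib distrib_left)
  also have "\<dots> = (\<Sum>k\<le>Suc n. of_nat (Suc n choose k) * (pr f (pw x k) * pr h (pw x (Suc n - k))))"
    unfolding Suc.IH pr_rtrans pw_Suc[symmetric]
    by (subst sum_pascal[symmetric]) (simp add: Suc_diff_le)
  finally show ?case .
qed

text \<open>Applying f \<otimes> id to \<Delta>, where f(1) = 0 and f(x) is non-zero, acts on
  polynomials in x like a derivative: the degree drops by one and the leading coefficient is
  multiplied by n f(x), which is non-zero for 0 < n < p.\<close>

lemma primitive_indep:
  assumes p: "Factorial_Ring.prime CARD('n)" "of_nat CARD('n) = (0::'a)" and x: "primitive x" "x \<noteq> 0"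
  shows "fam_indep (pw x) CARD('n)"
proof -
  obtain f0 where f0: "pr f0 x \<noteq> 0" using x(2) pr_eqI[of x 0] by auto
  \<comment> \<open>\<epsilon>(x) = 0, so subtracting a multiple of \<epsilon> corrects the value at
    1 and keeps the one at x.\<close>
  define f where "f = f0 - pr f0 u *s e"
  have f: "pr f u = 0" "pr f x \<noteq> 0"
    using f0 primitive_eps[OF x(1)] by (simp_all add: f_def pr_diff_l pr_scale_l)
  have u_nz: "u \<noteq> 0" using eps_unit by force
  have lead: "c n = 0" if "n < CARD('n)" "(\<Sum>i\<le>n. c i *s pw x i) = 0" for n c
    using that
  proof (induction n arbitrary: c)
    case 0 then show ?case using u_nz by (auto simp: vec_eq_iff)
  next
    case (Suc n)
    \<comment> \<open>c' j is the coefficient of x^j after applying f \<otimes> id. The one at Suc n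
      vanishes because f(1) = 0; the one at n involves only c (Suc n).\<close>
    define c' where "c' j = (\<Sum>i\<le>Suc n. if j \<le> i then c i * (of_nat (i choose (i - j)) * pr f (pw x (i - j))) else 0)" for j
    have "(\<Sum>j\<le>n. c' j *s pw x j) = 0"
    proof (rule pr_eqI)
      fix h
      have "0 = pr (f \<star> h) (\<Sum>i\<le>Suc n. c i *s pw x i)" using Suc.prems by simp
      also have "\<dots> = (\<Sum>i\<le>Suc n. c i * (\<Sum>k\<le>i. of_nat (i choose k) * (pr f (pw x k) * pr h (pw x (i - k)))))"
        by (simp only: pr_sum_r pr_scale_r primitive_pw[OF x(1)])
      also have "\<dots> = (\<Sum>i\<le>Suc n. \<Sum>j\<le>i. c i * (of_nat (i choose (i - j)) * pr f (pw x (i - j))) * pr h (pw x j))"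
      proof (rule sum.cong[OF refl])
        fix i
        have "(\<Sum>k\<le>i. of_nat (i choose k) * (pr f (pw x k) * pr h (pw x (i - k))))
           = (\<Sum>j\<le>i. of_nat (i choose (i - j)) * (pr f (pw x (i - j)) * pr h (pw x j)))"
          by (rule sum.reindex_bij_witness[of _ "\<lambda>j. i - j" "\<lambda>j. i - j"]) auto
        then show "c i * (\<Sum>k\<le>i. of_nat (i choose k) * (pr f (pw x k) * pr h (pw x (i - k))))
          = (\<Sum>j\<le>i. c i * (of_nat (i choose (i - j)) * pr f (pw x (i - j))) * pr h (pw x j))"
          by (simp only: sum_distrib_left mult.assoc)
      qed
      also have "\<dots> = (\<Sum>i\<le>Suc n. \<Sum>j\<le>Suc n. if j \<le> i then c i * (of_nat (i choose (i - j)) * pr f (pw x (i - j))) * pr h (pw x j) else 0)"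
        by (rule sum.cong[OF refl], rule sum.mono_neutral_cong_left) auto
      also have "\<dots> = (\<Sum>j\<le>Suc n. \<Sum>i\<le>Suc n. if j \<le> i then c i * (of_nat (i choose (i - j)) * pr f (pw x (i - j))) * pr h (pw x j) else 0)"
        by (rule sum.swap)
      also have "\<dots> = (\<Sum>j\<le>Suc n. c' j * pr h (pw x j))"
        unfolding c'_def sum_distrib_right by (intro sum.cong) auto
      also have "\<dots> = (\<Sum>j\<le>n. c' j * pr h (pw x j))"
      proof -
        have "c' (Suc n) = (\<Sum>i\<le>Suc n. if i = Suc n then c i * pr f u else 0)"
          unfolding c'_def by (intro sum.cong) auto
        then show ?thesis by (simp add: f)
      qed
      finally show "pr h (\<Sum>j\<le>n. c' j *s pw x j) = pr h 0" by (simp add: pr_sum_r pr_scale_r)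
    qed
    then have "c' n = 0" using Suc.IH Suc.prems by simp
    moreover have "c' n = (\<Sum>i\<le>Suc n. if i = Suc n then c i * (of_nat (Suc n) * pr f x) else 0)"
      unfolding c'_def using f(1) by (intro sum.cong) (auto simp: le_Suc_eq)
    ultimately have "c (Suc n) * (of_nat (Suc n) * pr f x) = 0" by simp
    moreover have "of_nat (Suc n) \<noteq> (0::'a)"
      using of_nat_eq_0_prime[OF p, of "Suc n"] Suc.prems(1) by (metis dvd_imp_le not_less zero_less_Suc)
    ultimately show ?case using f(2) by simp
  qed
  have "fam_indep (pw x) n" if "n \<le> CARD('n)" for n using that
  proof (induction n)
    case 0 show ?case by (simp add: fam_indep_def)
  next
    case (Suc n)
    show ?case unfolding fam_indep_def
    proof (intro allI impI)
      fix c i assume c: "(\<Sum>i<Suc n. c i *s pw x i) = 0" and i: "i < Suc n"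
      have "c n = 0" using lead[of n c] c Suc.prems by (simp add: lessThan_Suc_atMost)
      then have "(\<Sum>i<n. c i *s pw x i) = 0" using c by simp
      then show "c i = 0" using fam_indepD[OF Suc.IH, of c i] \<open>c n = 0\<close> Suc.prems i less_Suc_eq by auto
    qed
  qed
  then show ?thesis by simp
qed

text \<open>The middle binomial coefficients vanish, so x^p behaves like a primitive element: its
  pairing with f_1 \<star> f_(j-1) is zero for 1 < j < p, while the expansion in powers gives j a_j.
  The constant term is removed by \<epsilon>.\<close>

lemma primitive_frobenius:
  assumes p: "Factorial_Ring.prime CARD('n)" "of_nat CARD('n) = (0::'a)" and x: "primitive x" "x \<noteq> 0"
  shows "\<exists>c. pw x CARD('n) = c *s x"
proof -
  let ?p = "CARD('n)"
  have ind: "fam_indep (pw x) ?p" by (rule primitive_indep[OF assms])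
  obtain a where a: "pw x ?p = (\<Sum>i<?p. a i *s pw x i)" using fam_span[OF ind] by blast
  have "\<exists>f. \<forall>i<?p. pr f (pw x i) = (if i = j then 1 else 0)" for j by (rule fam_functional[OF ind])
  then obtain f where f: "\<And>i j. i < ?p \<Longrightarrow> pr (f j) (pw x i) = (if i = j then 1 else 0)" by metis
  have p2: "?p \<ge> 2" using p(1) by (simp add: prime_ge_2_nat)
  have fp: "pr (f j) (pw x ?p) = a j" if "j < ?p" for j
    using that by (simp add: a pr_sum_r pr_scale_r f if_distrib[of "\<lambda>z. _ * z"] cong: if_cong)
  have "a j = 0" if j: "1 < j" "j < ?p" for j
  proof -
    let ?g = "f (j - 1)"
    have g1: "pr ?g u = 0" using f[of 0 "j - 1"] j by simp
    have f1: "pr (f 1) u = 0" using f[of 0 1] p2 by simp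
    have "pr (f 1 \<star> ?g) (pw x ?p) = (\<Sum>k\<le>?p. of_nat (?p choose k) * (pr (f 1) (pw x k) * pr ?g (pw x (?p - k))))"
      by (rule primitive_pw[OF x(1)])
    also have "\<dots> = (\<Sum>k\<le>?p. 0)"
    proof (rule sum.cong[OF refl])
      fix k assume "k \<in> {..?p}"
      then consider "k = 0" | "k = ?p" | "0 < k" "k < ?p" by fastforce
      then show "of_nat (?p choose k) * (pr (f 1) (pw x k) * pr ?g (pw x (?p - k))) = 0"
      proof cases
        case 3
        then have "?p dvd (?p choose k)" using p(1) by (intro dvd_choose_prime) auto
        then have "of_nat (?p choose k) = (0::'a)" using p(2) by (auto elim!: dvdE)
        then show ?thesis by simp
      qed (use f1 g1 in simp_all)
    qed
    finally have 0: "pr (f 1 \<star> ?g) (pw x ?p) = 0" by simp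
    have fg: "pr (f 1 \<star> ?g) (pw x i) = (if i = j then of_nat j else 0)" if i: "i < ?p" for i
    proof -
      have "pr (f 1 \<star> ?g) (pw x i) = (\<Sum>k\<le>i. of_nat (i choose k) * (pr (f 1) (pw x k) * pr ?g (pw x (i - k))))"
        by (rule primitive_pw[OF x(1)])
      also have "\<dots> = (\<Sum>k\<le>i. if k = 1 then (if i = j then of_nat j else 0) else 0)"
        using i j by (intro sum.cong) (auto simp: f)
      finally show ?thesis using j by auto
    qed
    have "pr (f 1 \<star> ?g) (pw x ?p) = (\<Sum>i<?p. a i * (if i = j then of_nat j else 0))"
      unfolding a pr_sum_r pr_scale_r
      by (rule sum.cong[OF refl], rule arg_cong[where f = "\<lambda>z. _ * z"], rule fg) simp
    also have "\<dots> = a j * of_nat j" using j(2) by (simp add: if_distrib[of "\<lambda>z. _ * z"] cong: if_cong)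
    finally have "a j * of_nat j = 0" using 0 by simp
    moreover have "of_nat j \<noteq> (0::'a)" using of_nat_eq_0_prime[OF p, of j] nat_dvd_not_less[of j ?p] j by auto
    ultimately show ?thesis by simp
  qed
  moreover have "a 0 = 0"
  proof -
    have ei: "pr e (pw x i) = (if i = 0 then 1 else 0)" for i
      by (cases i) (simp_all add: pw_Suc eps_mul primitive_eps[OF x(1)])
    have "pr e (pw x ?p) = (\<Sum>i<?p. a i * (if i = 0 then 1 else 0))"
      unfolding a pr_sum_r pr_scale_r ei ..
    then show ?thesis by (simp add: ei if_distrib[of "\<lambda>z. _ * z"] cong: if_cong)
  qed
  ultimately have "a i = 0" if "i < ?p" "i \<noteq> 1" for i
    using that by (cases "i = 0") auto
  then have "pw x ?p = (\<Sum>i<?p. if i = 1 then a 1 *s x else 0)"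
    unfolding a by (intro sum.cong) auto
  then show ?thesis using p2 by auto
qed

end

section \<open>Existence of a generator\<close>

lemma vlin_subspace_kernel: "vlin G \<Longrightarrow> vec.subspace {x. G x = 0}"
  by (rule vec.subspaceI) (simp_all add: vlin_zero vlin_add vlin_scale)

context hopf_constants begin

definition group_gen where
  "group_gen g \<longleftrightarrow> glike g \<and> fam_indep (pw g) CARD('n) \<and> pw g CARD('n) = u"
definition prim_gen where
  "prim_gen x \<longleftrightarrow> primitive x \<and> fam_indep (pw x) CARD('n) \<and> (pw x CARD('n) = 0 \<or> pw x CARD('n) = x)"

lemma primitive_scale: "primitive x \<Longrightarrow> primitive (c *s x)"
  by (simp add: primitive_def pr_scale_r algebra_simps)

lemma primitive_gen:
  assumes p: "Factorial_Ring.prime CARD('n)" "of_nat CARD('n) = (0::'a)"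
    and root: "\<And>a::'a. \<exists>c. c ^ (CARD('n) - 1) = a" and x: "primitive x" "x \<noteq> 0"
  shows "\<exists>y. prim_gen y"
proof -
  obtain c where c: "pw x CARD('n) = c *s x" using primitive_frobenius[OF p x] by blast
  show ?thesis
  proof (cases "c = 0")
    case True
    then show ?thesis using c x primitive_indep[OF p x] by (intro exI[of _ x]) (simp add: prim_gen_def)
  next
    case False
    \<comment> \<open>With this choice b^p c = b, so the p-th power of b x is b x itself.\<close>
    obtain b where b: "b ^ (CARD('n) - 1) = inverse c" using root by blast
    have p2: "CARD('n) \<ge> 2" using p(1) by (simp add: prime_ge_2_nat)
    have "b \<noteq> 0"
    proof
      assume "b = 0"
      then have "inverse c = 0" using b p2 by (simp add: power_0_left split: if_splits)
      then show False using False by simp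
    qed
    have "b ^ CARD('n) = b ^ (CARD('n) - 1) * b" using p2 by (metis Suc_diff_1 power_Suc2 zero_less_card_finite)
    then have "b ^ CARD('n) * c = b" using b False by simp
    then have "pw (b *s x) CARD('n) = b *s x" by (simp add: pw_scale c)
    moreover have "b *s x \<noteq> 0" using \<open>b \<noteq> 0\<close> x(2) by simp
    ultimately show ?thesis
      using primitive_indep[OF p primitive_scale[OF x(1)]] primitive_scale[OF x(1)]
      unfolding prim_gen_def by blast
  qed
qed

lemma glike_eps: "glike g \<Longrightarrow> pr e g = 1"
  by (simp add: glike_def)

text \<open>The discrete logarithm: exponents add under multiplication and all powers of g have
  counit 1. It extends to every exponent because g^p = 1 and p = 0 in the field.\<close>

lemma group_gen_derivation:
  assumes p: "Factorial_Ring.prime CARD('n)" "of_nat CARD('n) = (0::'a)" and g: "group_gen g"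
  shows "\<exists>\<alpha>. \<alpha> \<noteq> 0 \<and> (\<forall>a b. pr \<alpha> (a \<cdot> b) = pr \<alpha> a * pr e b + pr e a * pr \<alpha> b)"
proof -
  have ind: "fam_indep (pw g) CARD('n)" using g by (simp add: group_gen_def)
  obtain \<alpha> where \<alpha>: "\<And>i. i < CARD('n) \<Longrightarrow> pr \<alpha> (pw g i) = of_nat i"
    using fam_functional[OF ind, of of_nat] by blast
  have p2: "CARD('n) \<ge> 2" using p(1) by (simp add: prime_ge_2_nat)
  have \<alpha>': "pr \<alpha> (pw g n) = of_nat n" for n
  proof (induction n rule: less_induct)
    case (less n)
    show ?case
    proof (cases "n < CARD('n)")
      case False
      then have n: "n = CARD('n) + (n - CARD('n))" by simp
      have "pw g n = pw g (n - CARD('n))"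
        by (subst n, subst pw_add) (use g in \<open>simp add: group_gen_def\<close>)
      moreover have "of_nat n = (of_nat (n - CARD('n)) :: 'a)"
        by (subst n, subst of_nat_add) (simp add: p(2))
      ultimately show ?thesis using less[of "n - CARD('n)"] p2 False by simp
    qed (rule \<alpha>)
  qed
  have e1: "pr e (pw g i) = 1" for i using g by (simp add: group_gen_def glike_eps glike_pw)
  have "pr \<alpha> (a \<cdot> b) = pr \<alpha> a * pr e b + pr e a * pr \<alpha> b" for a b
  proof -
    have sl: "slin (\<lambda>a. pr \<alpha> a * pr e b + pr e a * pr \<alpha> b)" "slin (\<lambda>b. pr \<alpha> a * pr e b + pr e a * pr \<alpha> b)" for a b
      by (rule slinI; simp add: pr_add_r pr_scale_r algebra_simps)+
    show ?thesis
    proof (rule fam_slin_eqI[OF ind _ sl(1)])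
      fix i
      show "pr \<alpha> (pw g i \<cdot> b) = pr \<alpha> (pw g i) * pr e b + pr e (pw g i) * pr \<alpha> b"
        by (rule fam_slin_eqI[OF ind _ sl(2)]) (intro lin, simp add: pw_add[symmetric] \<alpha>' e1)
    qed (intro lin)
  qed
  moreover have "\<alpha> \<noteq> 0" using \<alpha>'[of 1] by auto
  ultimately show ?thesis by blast
qed

text \<open>If x^p = 0, the coefficient of x is a derivation along \<epsilon>. If x^p = x, then 1 is
  a root of t^p - t, so x -> 1 defines a character, different from \<epsilon> since \<epsilon>(x) =
  0.\<close>

lemma prim_gen_dual:
  assumes p: "Factorial_Ring.prime CARD('n)" "of_nat CARD('n) = (0::'a)" and x: "prim_gen x"
  shows "(\<exists>\<alpha>. \<alpha> \<noteq> 0 \<and> (\<forall>a b. pr \<alpha> (a \<cdot> b) = pr \<alpha> a * pr e b + pr e a * pr \<alpha> b))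
    \<or> (\<exists>\<alpha>. \<alpha> \<noteq> e \<and> (\<forall>a b. pr \<alpha> (a \<cdot> b) = pr \<alpha> a * pr \<alpha> b) \<and> pr \<alpha> u = 1)"
proof -
  have ind: "fam_indep (pw x) CARD('n)" and pr: "primitive x" using x by (simp_all add: prim_gen_def)
  have p2: "CARD('n) \<ge> 2" using p(1) by (simp add: prime_ge_2_nat)
  have ei: "pr e (pw x i) = (if i = 0 then 1 else 0)" for i
    by (cases i) (simp_all add: pw_Suc eps_mul primitive_eps[OF pr])
  from x consider "pw x CARD('n) = 0" | "pw x CARD('n) = x" by (auto simp: prim_gen_def)
  then show ?thesis
  proof cases
    case 1
    obtain \<alpha> where \<alpha>: "\<And>i. i < CARD('n) \<Longrightarrow> pr \<alpha> (pw x i) = (if i = 1 then 1 else 0)"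
      using fam_functional[OF ind, of "\<lambda>i. if i = 1 then 1 else 0"] by blast
    have \<alpha>': "pr \<alpha> (pw x n) = (if n = 1 then 1 else 0)" for n
    proof (cases "n < CARD('n)")
      case False
      then have n: "n = CARD('n) + (n - CARD('n))" by simp
      have "0 \<cdot> b = 0" for b by (rule vlin_zero) (intro lin)
      then have "pw x n = 0" by (subst n, subst pw_add) (simp add: 1)
      then show ?thesis using False p2 by simp
    qed (rule \<alpha>)
    have "pr \<alpha> (a \<cdot> b) = pr \<alpha> a * pr e b + pr e a * pr \<alpha> b" for a b
    proof -
      have sl: "slin (\<lambda>a. pr \<alpha> a * pr e b + pr e a * pr \<alpha> b)" "slin (\<lambda>b. pr \<alpha> a * pr e b + pr e a * pr \<alpha> b)" for a b
        by (rule slinI; simp add: pr_add_r pr_scale_r algebra_simps)+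
      show ?thesis
      proof (rule fam_slin_eqI[OF ind _ sl(1)])
        fix i
        show "pr \<alpha> (pw x i \<cdot> b) = pr \<alpha> (pw x i) * pr e b + pr e (pw x i) * pr \<alpha> b"
          by (rule fam_slin_eqI[OF ind _ sl(2)]) (intro lin, auto simp: pw_add[symmetric] \<alpha>' ei)
      qed (intro lin)
    qed
    moreover have "\<alpha> \<noteq> 0" using \<alpha>'[of 1] by auto
    ultimately show ?thesis by blast
  next
    case 2
    obtain \<alpha> where \<alpha>: "\<And>i. i < CARD('n) \<Longrightarrow> pr \<alpha> (pw x i) = 1"
      using fam_functional[OF ind, of "\<lambda>i. 1"] by blast
    have \<alpha>': "pr \<alpha> (pw x n) = 1" for n
    proof (induction n rule: less_induct)
      case (less n)
      show ?case
      proof (cases "n < CARD('n)")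
        case False
        then have n: "n = CARD('n) + (n - CARD('n))" by simp
        have "pw x n = pw x (Suc (n - CARD('n)))"
          by (subst n, subst pw_add) (simp add: 2 pw_Suc')
        then show ?thesis using less[of "Suc (n - CARD('n))"] False p2 by simp
      qed (rule \<alpha>)
    qed
    have "pr \<alpha> (a \<cdot> b) = pr \<alpha> a * pr \<alpha> b" for a b
    proof -
      show ?thesis
      proof (rule fam_slin_eqI[OF ind, where a = a])
        fix i
        show "pr \<alpha> (pw x i \<cdot> b) = pr \<alpha> (pw x i) * pr \<alpha> b"
          by (rule fam_slin_eqI[OF ind, where a = b], (intro lin)+) (simp add: pw_add[symmetric] \<alpha>')
      qed (intro lin)+
    qed
    moreover have "\<alpha> \<noteq> e" using \<alpha>'[of 1] ei[of 1] by auto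
    moreover have "pr \<alpha> u = 1" using \<alpha>'[of 0] by simp
    ultimately show ?thesis by blast
  qed
qed

text \<open>Brauer's argument on minimal left ideals, followed by a Fitting argument: a minimal J
  gives b in I with b x = x for some non-zero x, so b is not nilpotent, and among the combinations
  of its powers there is a non-zero idempotent of I. As \<open>reg\<close> vanishes, that idempotent
  would have to be 1, on which \<epsilon> is not 0.\<close>

lemma augmentation_square_proper:
  assumes p: "Factorial_Ring.prime CARD('n)" "of_nat CARD('n) = (0::'a)" and reg0: "\<And>a. pr reg a = 0"
  shows "\<exists>x. pr e x = 0 \<and> x \<notin> vec.span {a \<cdot> b | a b. pr e a = 0 \<and> pr e b = 0}"
proof (rule ccontr)
  let ?W = "vec.span {a \<cdot> b | a b. pr e a = 0 \<and> pr e b = 0}"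
  assume "\<not> ?thesis"
  then have IW: "x \<in> ?W" if "pr e x = 0" for x using that by blast
  let ?I = "{a. pr e a = 0}"
  \<comment> \<open>Stability is required under I only, which is all that the minimality argument
    uses.\<close>
  define Fam where "Fam J \<longleftrightarrow> vec.subspace J \<and> J \<subseteq> ?I \<and> (\<forall>a\<in>?I. \<forall>x\<in>J. a \<cdot> x \<in> J)
    \<and> (\<exists>a\<in>?I. \<exists>x\<in>J. a \<cdot> x \<noteq> 0)" for J
  have subI: "vec.subspace ?I"
    by (rule vec.subspaceI) (simp_all add: pr_add_r pr_scale_r)
  have "Fam ?I"
  proof -
    have "\<exists>a\<in>?I. \<exists>x\<in>?I. a \<cdot> x \<noteq> 0"
    proof (rule ccontr)
      assume "\<not> ?thesis"
      then have "{a \<cdot> b | a b. pr e a = 0 \<and> pr e b = 0} \<subseteq> {0}" by auto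
      then have "?W \<subseteq> {0}" by (rule vec.span_minimal) (simp add: vec.subspace_def)
      then have I0: "x = 0" if "pr e x = 0" for x using IW[OF that] by blast
      have "CARD('n) \<ge> 2" using p(1) by (simp add: prime_ge_2_nat)
      then obtain i j :: 'n where ij: "i \<noteq> j"
        by (metis card_2_iff' ex_card numeral_2_eq_2 obtain_subset_with_card_n)
      \<comment> \<open>This combination of two basis vectors always lies in I; if I were zero,
        \<epsilon> would vanish at b_j, and then b_j itself would lie in I.\<close>
      have "e $ j *s axis i 1 - e $ i *s axis j 1 = 0"
        by (rule I0) (simp add: pr_diff_r pr_scale_r)
      then have "(e $ j *s axis i 1 - e $ i *s axis j 1) $ i = 0" by simp
      then have "e $ j = 0" using ij by (simp add: axis_def)
      then have "axis j 1 = (0 :: 'a^'n)" by (intro I0) simp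
      then show False by (simp add: axis_eq_0_iff)
    qed
    then show ?thesis unfolding Fam_def using subI by (auto simp: eps_mul)
  qed
  then obtain J where J: "Fam J" "\<And>J'. Fam J' \<Longrightarrow> vec.dim J \<le> vec.dim J'"
    using ex_has_least_nat[of Fam ?I vec.dim] by blast
  obtain a x where ax: "pr e a = 0" "x \<in> J" "a \<cdot> x \<noteq> 0" using J(1) unfolding Fam_def by blast
  \<comment> \<open>I x is again admissible: if I annihilated it, then I^2 = I would annihilate x.
    By minimality I x = J, which contains x.\<close>
  define J' where "J' = (\<lambda>b. b \<cdot> x) ` ?I"
  have linx: "Vector_Spaces.linear (*s) (*s) (\<lambda>b. b \<cdot> x)"
    unfolding vlin_linear[symmetric] by (intro lin)
  have subJ': "vec.subspace J'"
    unfolding J'_def by (rule vec.linear_subspace_image[OF linx subI])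
  have J'J: "J' \<subseteq> J" using J(1) ax(2) unfolding J'_def Fam_def by auto
  have "\<exists>a\<in>?I. \<exists>y\<in>J'. a \<cdot> y \<noteq> 0"
  proof (rule ccontr)
    assume "\<not> ?thesis"
    then have 0: "(a \<cdot> b) \<cdot> x = 0" if "pr e a = 0" "pr e b = 0" for a b
      using that unfolding J'_def by (auto simp: mul_assoc)
    have "w \<cdot> x = 0" if "w \<in> ?W" for w
      using that
    proof (induction rule: vec.span_induct)
      case base show ?case by (rule vlin_subspace_kernel) (intro lin)
    qed (auto simp: 0)
    then show False using IW[OF ax(1)] ax(3) by blast
  qed
  moreover have "\<forall>a\<in>?I. \<forall>y\<in>J'. a \<cdot> y \<in> J'"
    unfolding J'_def by (auto simp: mul_assoc[symmetric] eps_mul)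
  ultimately have "Fam J'" using subJ' J'J J(1) unfolding Fam_def by blast
  then have "J' = J"
    using J(2) by (intro vec.subspace_dim_equal[OF subJ' _ J'J]) (use J(1) in \<open>auto simp: Fam_def\<close>)
  then obtain b where b: "pr e b = 0" "x = b \<cdot> x" using ax(2) unfolding J'_def by blast
  have "pw b n \<cdot> x = x" for n by (induction n) (simp_all add: pw_Suc mul_assoc b(2)[symmetric])
  moreover have "x \<noteq> 0"
    using ax(3) vlin_zero[of "\<lambda>z. a \<cdot> z"] by (auto simp: lin)
  moreover have "0 \<cdot> x = 0" by (rule vlin_zero) (intro lin)
  ultimately have bn: "pw b n \<noteq> 0" for n by metis
  \<comment> \<open>The spans of b^k, b^(k+1), ... decrease, so one of minimal dimension equals its
    image under b^k. The bound 1 \<le> k keeps it inside I.\<close>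
  define U where "U k = vec.span (pw b ` {k..})" for k
  have U_mono: "U k \<subseteq> U j" if "j \<le> k" for j k
    unfolding U_def using that by (intro vec.span_mono) auto
  obtain k where k: "1 \<le> k" "\<And>j. 1 \<le> j \<Longrightarrow> vec.dim (U k) \<le> vec.dim (U j)"
    using ex_has_least_nat[of "\<lambda>k. 1 \<le> k" 1 "\<lambda>k. vec.dim (U k)"] by blast
  have Uk: "U (k + k) = U k"
    using k by (intro vec.subspace_dim_equal) (simp_all add: U_mono, simp_all add: U_def vec.subspace_span)
  have shift: "U (k + k) = (\<lambda>y. pw b k \<cdot> y) ` U k"
  proof -
    have "pw b ` {k + k..} = (\<lambda>y. pw b k \<cdot> y) ` (pw b ` {k..})"
    proof -
      have eq: "{k + k..} = (\<lambda>j. k + j) ` {k..}"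
        by (auto simp: image_iff intro!: bexI[of _ "_ - k"])
      show ?thesis by (simp only: eq image_image pw_add)
    qed
    moreover have "Vector_Spaces.linear (*s) (*s) (\<lambda>y. pw b k \<cdot> y)"
      unfolding vlin_linear[symmetric] by (intro lin)
    ultimately show ?thesis unfolding U_def using vec.linear_span_image by metis
  qed
  have "pw b k \<in> U k" unfolding U_def by (intro vec.span_base) auto
  \<comment> \<open>b^k = b^k y and y = b^k z, where z commutes with b^k; hence y y = z b^k y = z
    b^k = y.\<close>
  then obtain y where y: "y \<in> U k" "pw b k = pw b k \<cdot> y" using shift Uk by auto
  obtain z where z: "z \<in> U k" "y = pw b k \<cdot> z" using y(1) shift Uk by auto
  have comm: "z \<cdot> pw b k = pw b k \<cdot> z"
  proof -
    have "z \<cdot> pw b k - pw b k \<cdot> z = 0" using z(1) unfolding U_def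
    proof (induction rule: vec.span_induct)
      case base
      have "vlin (\<lambda>z. z \<cdot> pw b k - pw b k \<cdot> z)" by (intro lin)
      then show ?case by (rule vlin_subspace_kernel)
    qed (auto simp: pw_add[symmetric] add.commute)
    then show ?thesis by simp
  qed
  have "y \<cdot> y = z \<cdot> (pw b k \<cdot> y)" unfolding z(2) by (simp add: comm mul_assoc[symmetric])
  then have yy: "y \<cdot> y = y" using y(2) comm z(2) by simp
  have "pr e y = 0" using y(1) unfolding U_def
  proof (induction rule: vec.span_induct)
    case base then show ?case using subI by simp
  next
    case (step y)
    then obtain j where "y = pw b j" "k \<le> j" by auto
    then show ?case using k(1) by (cases j) (simp_all add: pw_Suc eps_mul b(1))
  qed
  have "(\<forall>x. y \<cdot> x = 0) \<or> (\<forall>x. y \<cdot> x = x)"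
    using reg0[of y] by (intro idempotent_trace_0[OF p]) (intro lin, simp_all add: mul_assoc[symmetric] yy pr_reg)
  then have "y = 0 \<or> y = u" by (metis unit_r)
  moreover have "y \<noteq> 0"
  proof
    assume "y = 0"
    then show False using y(2) bn[of k] vlin_zero[of "\<lambda>z. pw b k \<cdot> z"] by (simp add: lin)
  qed
  ultimately show False using \<open>pr e y = 0\<close> by auto
qed

text \<open>A functional that vanishes on I^2 but not on I becomes a derivation along \<epsilon>
  once its value at 1 is removed.\<close>

lemma derivation_exists:
  assumes p: "Factorial_Ring.prime CARD('n)" "of_nat CARD('n) = (0::'a)" and reg0: "\<And>a. pr reg a = 0"
  shows "\<exists>\<alpha>. \<alpha> \<noteq> 0 \<and> (\<forall>a b. pr \<alpha> (a \<cdot> b) = pr \<alpha> a * pr e b + pr e a * pr \<alpha> b)"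
proof -
  let ?W = "vec.span {a \<cdot> b | a b. pr e a = 0 \<and> pr e b = 0}"
  obtain x where x: "pr e x = 0" "x \<notin> ?W" using augmentation_square_proper[OF assms] by blast
  obtain B where B: "B \<subseteq> ?W" "vec.independent B" "?W \<subseteq> vec.span B"
    by (rule vec.basis_exists[of ?W])
  have "vec.span B = ?W"
    using B(3) vec.span_mono[OF B(1)] by (simp only: vec.span_span subset_antisym)
  then have "vec.independent (insert x B)" "x \<notin> B"
    using x B(2) vec.span_base[of x B] by (auto simp: vec.independent_insert)
  then obtain G where G: "Vector_Spaces.linear (*s) (*s) G"
    "\<forall>z\<in>insert x B. G z = (if z = x then axis undefined 1 else 0 :: 'a^'n)"
    using vec.linear_independent_extend[of "insert x B" "\<lambda>z. if z = x then axis undefined 1 else 0"] by blast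
  have "slin (\<lambda>x. G x $ undefined)"
    using G(1) by (intro slin_nth) (simp add: vlin_linear)
  define \<beta> where "\<beta> = (\<chi> i. G (axis i 1) $ undefined)"
  have \<beta>: "pr \<beta> z = G z $ undefined" for z unfolding \<beta>_def by (rule pr_chi) fact
  have \<beta>W: "pr \<beta> w = 0" if "w \<in> ?W" for w
    using that unfolding \<open>vec.span B = ?W\<close>[symmetric]
  proof (induction rule: vec.span_induct)
    case base show ?case by (rule vec.subspaceI) (simp_all add: pr_add_r pr_scale_r)
  qed (use G(2) \<open>x \<notin> B\<close> in \<open>auto simp: \<beta>\<close>)
  define \<alpha> where "\<alpha> = \<beta> - pr \<beta> u *s e"
  have \<alpha>: "pr \<alpha> z = pr \<beta> z - pr \<beta> u * pr e z" for z by (simp add: \<alpha>_def pr_diff_l pr_scale_l)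
  have \<alpha>u: "pr \<alpha> u = 0" by (simp add: \<alpha>)
  have "pr \<alpha> x = 1" using G(2) x(1) by (simp add: \<alpha> \<beta>)
  then have "\<alpha> \<noteq> 0" by auto
  moreover have "pr \<alpha> (a \<cdot> b) = pr \<alpha> a * pr e b + pr e a * pr \<alpha> b" for a b
  proof -
    \<comment> \<open>The derivation rule is the expansion of \<alpha>((a - \<epsilon>(a))(b -
      \<epsilon>(b))) = 0 with \<alpha>(1) = 0.\<close>
    let ?a = "a - pr e a *s u" and ?b = "b - pr e b *s u"
    have I: "pr e ?a = 0" "pr e ?b = 0" by (simp_all add: pr_diff_r pr_scale_r)
    then have "?a \<cdot> ?b \<in> ?W" by (intro vec.span_base) blast
    then have "pr \<beta> (?a \<cdot> ?b) = 0" by (rule \<beta>W)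
    then have 0: "pr \<alpha> (?a \<cdot> ?b) = 0" using I by (simp add: \<alpha> eps_mul)
    have eq: "?a \<cdot> ?b = a \<cdot> b - pr e b *s a - pr e a *s b + (pr e a * pr e b) *s u"
      by (simp add: vlin_diff[of "\<lambda>z. z \<cdot> y" for y] vlin_diff[of "\<lambda>z. y \<cdot> z" for y]
          vlin_scale[of "\<lambda>z. z \<cdot> y" for y] vlin_scale[of "\<lambda>z. y \<cdot> z" for y] lin algebra_simps)
    show ?thesis using 0 unfolding eq by (simp add: pr_diff_r pr_add_r pr_scale_r \<alpha>u algebra_simps)
  qed
  ultimately show ?thesis by blast
qed

end

section \<open>Vanishing traces and S^2 = 1\<close>

context unimodular_hopf begin

text \<open>\<epsilon>(L) and l(1) being non-zero are the Maschke criteria for semisimplicity of H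
  and of its dual. The regular character x of the dual satisfies x^2 = p x = 0 and S^2(x) = x, so z
  -> x S^2(z) squares to zero; its trace is then zero, and the trace formula applies with l(x) =
  l(1).\<close>

lemma not_semisimple_and_cosemisimple:
  assumes p: "of_nat CARD('n) = (0::'a)"
  shows "pr e L = 0 \<or> pr l u = 0"
proof (rule ccontr)
  assume nz: "\<not> ?thesis"
  interpret D: hopf_constants "\<lambda>i j k. d k i j" "\<lambda>k i j. m i j k" e u "\<lambda>i j. s j i" by (rule dual)
  define x where "x = D.reg"
  have S'4: "S' (S' (S' (S' f))) = f" for f
    by (rule pr_eqI2) (simp add: pr_antipode' antipode_four)
  have "x \<cdot> x = 0"
    using D.reg_conv_reg p by (intro pr_eqI) (simp add: x_def pr_commute[of _ "_ \<cdot> _"])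
  have SSx: "S (S x) = x"
  proof (rule pr_eqI)
    fix f
    have "pr f (S (S x)) = pr x (S' (S' f))" by (metis pr_antipode' pr_commute)
    also have "\<dots> = pr x f" unfolding x_def by (rule D.reg_antipode_squared) (rule S'4)
    finally show "pr f (S (S x)) = pr f x" by (simp only: pr_commute)
  qed
  \<comment> \<open>l(x) is the trace of left convolution by l, the rank one map g -> g(1) l, which
    is l(1).\<close>
  have "pr l x = tr (\<lambda>g. l \<star> g)" unfolding x_def by (subst pr_commute) (rule D.pr_reg)
  also have "\<dots> = pr l u" unfolding tr_def l_right by (simp, simp add: pr_def mult.commute)
  finally have lx: "pr l x = pr l u" .
  let ?N = "\<lambda>z. x \<cdot> S (S z)"
  have "0 \<cdot> z = 0" for z by (rule vlin_zero) (intro lin)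
  then have NN: "?N (?N z) = 0 *s ?N z" for z
    by (simp add: antipode_mul antipode_four SSx mul_assoc[symmetric] \<open>x \<cdot> x = 0\<close>)
  have "tr ?N = 0" using tr_range[of ?N 0, OF _ NN] by (simp add: lin)
  then have "pr e L * pr l (S x) = 0" using trace_antipode_squared[of x] by simp
  then show False using nz lx integral_antipode by auto
qed

lemma antipode_square_id:
  assumes p: "Factorial_Ring.prime CARD('n)" "of_nat CARD('n) = (0::'a)"
  shows "S (S x) = x"
proof -
  \<comment> \<open>The trace formula at a = 1 has the right side \<epsilon>(L) l(1), one factor of
    which is zero.\<close>
  have "pr l L * tr (\<lambda>x. S (S x)) = 0"
    using trace_antipode_squared[of u] not_semisimple_and_cosemisimple[OF p(2)] by auto
  then have tr0: "tr (\<lambda>x. S (S x)) = 0" using pairing_nz by simp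
  show ?thesis
  proof (cases "CARD('n) = 2")
    case False
    have two: "(2::'a) \<noteq> 0"
    proof
      assume "(2::'a) = 0"
      then have "CARD('n) dvd 2" using of_nat_eq_0_prime[OF p, of 2] by simp
      then show False using False p(1) primes_dvd_imp_eq two_is_prime_nat by blast
    qed
    have half: "(1/2) *s (v + v) = v" for v :: "'a^'n" using two by (simp add: vec_eq_iff mult_2[symmetric])
    \<comment> \<open>The projection onto the fixed space of the involution S^2. Its trace is (p +
      0)/2 = 0, and it is not the zero map because it fixes 1.\<close>
    let ?N = "\<lambda>x. (1/2) *s (x + S (S x))"
    have SS: "vlin (\<lambda>x. S (S x))" by (intro lin)
    have "?N (?N x) = ?N x" for x
    proof -
      have "S (S (?N x)) = ?N x"
        by (simp only: vlin_scale[OF SS] vlin_add[OF SS] antipode_four add.commute)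
      then have "?N (?N x) = (1/2) *s (?N x + ?N x)" by simp
      also have "\<dots> = ?N x" by (rule half)
      finally show ?thesis .
    qed
    moreover have "tr ?N = 0"
      using tr0 p(2) by (simp add: tr_def sum_distrib_left[symmetric] sum.distrib axis_def
          add_divide_distrib sum_divide_distrib[symmetric])
    ultimately have "(\<forall>x. ?N x = 0) \<or> (\<forall>x. ?N x = x)"
      by (intro idempotent_trace_0[OF p]) (intro lin, assumption+)
    moreover have "?N u = u" by (simp only: antipode_unit half)
    moreover have "u \<noteq> 0" using eps_unit by force
    ultimately have "?N x = x" by metis
    then have "x $ i + S (S x) $ i = x $ i + x $ i" for i
      using two by (simp add: vec_eq_iff divide_eq_eq mult_2_right)
    then show ?thesis by (simp add: vec_eq_iff)
  next
    case True
    then have two: "(2::'a) = 0" using p(2) by simp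
    show ?thesis
    proof (rule ccontr)
      \<comment> \<open>For p = 2 the square of S^2 - 1 is 2 - 2 S^2 = 0. The map kills 1 and its
        own values; a non-zero value lies in the kernel of \<epsilon>, so with 1 it spans the plane,
        and the map would be zero.\<close>
      let ?N = "\<lambda>x. S (S x) - x"
      assume "S (S x) \<noteq> x"
      then have w: "?N x \<noteq> 0" by simp
      define w where "w = ?N x"
      have vN: "vlin ?N" by (intro lin)
      have SSw: "S (S w) = x - S (S x)"
        unfolding w_def by (subst vlin_diff[of "\<lambda>x. S (S x)"]) (intro lin, simp add: antipode_four)
      have "?N w = 0" unfolding SSw unfolding w_def using two
        by (simp add: vec_eq_iff algebra_simps)
      have ew: "pr e w = 0" by (simp add: w_def pr_diff_r)
      have "u \<noteq> 0" using eps_unit by force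
      have "w \<notin> vec.span {u}"
      proof
        assume "w \<in> vec.span {u}"
        then obtain c where "w = c *s u" by (auto simp: vec.span_singleton)
        then show False using ew w by (simp add: pr_scale_r w_def)
      qed
      then have ind: "vec.independent {w, u}"
        using \<open>u \<noteq> 0\<close> by (simp add: vec.independent_insert)
      have "w \<noteq> u" using ew by auto
      then have "UNIV \<subseteq> vec.span {w, u}"
        using True by (intro vec.card_ge_dim_independent[OF _ ind]) (simp_all add: card_cart_basis)
      then have "x \<in> vec.span {w, u}" by blast
      then have "?N x = 0"
      proof (induction rule: vec.span_induct)
        case base
        show ?case by (rule vlin_subspace_kernel[OF vN])
      qed (use \<open>?N w = 0\<close> in auto)
      then show False using w by simp
    qed
  qed
qed

text \<open>Since S^2 = 1, the left side of the trace formula is the regular character, up to the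
  factor l(L).\<close>

lemma reg_zero:
  assumes p: "Factorial_Ring.prime CARD('n)" "of_nat CARD('n) = (0::'a)" and "pr e L = 0"
  shows "pr reg a = 0"
  using trace_antipode_squared[of a] assms(3) pairing_nz by (simp add: pr_reg antipode_square_id[OF p])

end

section \<open>Existence of a group-like or a primitive generator\<close>

context hopf_constants begin

theorem prime_dimension_generator:
  assumes p: "Factorial_Ring.prime CARD('n)" "of_nat CARD('n) = (0::'a)"
    and root: "\<And>a::'a. \<exists>c. c ^ (CARD('n) - 1) = a"
  shows "(\<exists>g. group_gen g) \<or> (\<exists>x. prim_gen x)"
proof -
  interpret D: hopf_constants "\<lambda>i j k. d k i j" "\<lambda>k i j. m i j k" e u "\<lambda>i j. s j i" by (rule dual)
  have A: ?thesis if "glike g" "g \<noteq> u" for g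
    using glike_order[OF p that] that unfolding group_gen_def by blast
  have P: ?thesis if "primitive x" "x \<noteq> 0" for x
    using primitive_gen[OF p root that] by blast
  have B: ?thesis if \<alpha>: "D.glike \<alpha>" "\<alpha> \<noteq> e" for \<alpha>
  proof -
    have "D.group_gen \<alpha>" using D.glike_order[OF p \<alpha>] \<alpha> unfolding D.group_gen_def by blast
    then obtain x where "x \<noteq> 0" "\<And>f h. pr x (f \<star> h) = pr x f * pr u h + pr u f * pr x h"
      using D.group_gen_derivation[OF p] by blast
    then show ?thesis by (intro P[of x]) (simp_all add: primitive_def pr_commute[of _ x] pr_commute[of _ u])
  qed
  have C: ?thesis if \<alpha>: "D.primitive \<alpha>" "\<alpha> \<noteq> 0" for \<alpha>
  proof -
    obtain \<beta> where "D.prim_gen \<beta>" using D.primitive_gen[OF p root \<alpha>] by blast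
    from D.prim_gen_dual[OF p this] show ?thesis
    proof
      assume "\<exists>x. x \<noteq> 0 \<and> (\<forall>f h. pr x (f \<star> h) = pr x f * pr u h + pr u f * pr x h)"
      then obtain x where "x \<noteq> 0" "\<And>f h. pr x (f \<star> h) = pr x f * pr u h + pr u f * pr x h" by blast
      then show ?thesis by (intro P[of x]) (simp_all add: primitive_def pr_commute[of _ x] pr_commute[of _ u])
    next
      assume "\<exists>g. g \<noteq> u \<and> (\<forall>f h. pr g (f \<star> h) = pr g f * pr g h) \<and> pr g e = 1"
      then obtain g where "g \<noteq> u" "\<And>f h. pr g (f \<star> h) = pr g f * pr g h" "pr g e = 1" by blast
      then show ?thesis by (intro A[of g]) (simp_all add: glike_def pr_commute[of _ g])
    qed
  qed
  show ?thesis
  proof (cases "(\<exists>g. glike g \<and> g \<noteq> u) \<or> (\<exists>\<alpha>. D.glike \<alpha> \<and> \<alpha> \<noteq> e)")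
    case True then show ?thesis using A B by blast
  next
    case False
    obtain l where l: "l \<noteq> 0" "\<And>g. g \<star> l = pr g u *s l" using left_integral_exists by blast
    \<comment> \<open>The distinguished group-like elements on both sides are trivial by assumption,
      so the left integrals are two-sided.\<close>
    obtain g where "glike g" "\<And>f. l \<star> f = pr f g *s l"
      using distinguished_grouplike[OF l] unfolding glike_def by blast
    then have l2: "l \<star> f = pr f u *s l" for f using False by metis
    obtain L where L: "L \<noteq> 0" "\<And>a. a \<cdot> L = pr a e *s L" using D.left_integral_exists by blast
    obtain \<gamma> where "D.glike \<gamma>" "\<And>a. L \<cdot> a = pr a \<gamma> *s L"
      using D.distinguished_grouplike[OF L] unfolding D.glike_def by blast
    then have L2: "L \<cdot> a = pr a e *s L" for a using False by metis
    interpret U: unimodular_hopf m d u e s l L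
      by unfold_locales (fact l l2 L L2)+
    interpret UD: unimodular_hopf "\<lambda>i j k. d k i j" "\<lambda>k i j. m i j k" e u "\<lambda>i j. s j i" L l
      by (rule U.unimodular_dual)
    from U.not_semisimple_and_cosemisimple[OF p(2)] show ?thesis
    proof
      assume "pr e L = 0"
      then obtain \<alpha> where "\<alpha> \<noteq> 0" "\<And>a b. pr \<alpha> (a \<cdot> b) = pr \<alpha> a * pr e b + pr e a * pr \<alpha> b"
        using derivation_exists[OF p U.reg_zero[OF p]] by blast
      then show ?thesis by (intro C[of \<alpha>]) (simp_all add: D.primitive_def pr_commute[of _ \<alpha>] pr_commute[of _ e])
    next
      assume "pr l u = 0"
      then have "pr u l = 0" by (simp only: pr_commute)
      then obtain x where "x \<noteq> 0" "\<And>f h. pr x (f \<star> h) = pr x f * pr u h + pr u f * pr x h"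
        using D.derivation_exists[OF p UD.reg_zero[OF p]] by blast
      then show ?thesis by (intro P[of x]) (simp_all add: primitive_def pr_commute[of _ x] pr_commute[of _ u])
    qed
  qed
qed

end

section \<open>Tensor products of modules\<close>

abbreviation is_module :: "('k, 'm) ring_scheme \<Rightarrow> ('k, 'a, 'n) module_scheme \<Rightarrow> bool"
  where "is_module K M \<equiv> Module.module K M"

lemma module_homI:
  assumes "\<And>x. x \<in> carrier M \<Longrightarrow> f x \<in> carrier N"
    and "\<And>x y. x \<in> carrier M \<Longrightarrow> y \<in> carrier M \<Longrightarrow> f (x \<oplus>\<^bsub>M\<^esub> y) = f x \<oplus>\<^bsub>N\<^esub> f y"
    and "\<And>c x. c \<in> carrier K \<Longrightarrow> x \<in> carrier M \<Longrightarrow> f (c \<odot>\<^bsub>M\<^esub> x) = c \<odot>\<^bsub>N\<^esub> f x"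
  shows "f \<in> module_hom K M N"
  using assms by (auto simp: module_hom_def)

lemma module_homD:
  assumes "f \<in> module_hom K M N"
  shows "x \<in> carrier M \<Longrightarrow> f x \<in> carrier N"
    and "x \<in> carrier M \<Longrightarrow> y \<in> carrier M \<Longrightarrow> f (x \<oplus>\<^bsub>M\<^esub> y) = f x \<oplus>\<^bsub>N\<^esub> f y"
    and "c \<in> carrier K \<Longrightarrow> x \<in> carrier M \<Longrightarrow> f (c \<odot>\<^bsub>M\<^esub> x) = c \<odot>\<^bsub>N\<^esub> f x"
  using assms by (auto simp: module_hom_def)

lemma module_hom_comp:
  "f \<in> module_hom K M N \<Longrightarrow> g \<in> module_hom K N P \<Longrightarrow> (\<lambda>x. g (f x)) \<in> module_hom K M P"
  by (auto simp: module_hom_def Pi_iff)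

lemma module_hom_id: "(\<lambda>x. x) \<in> module_hom K M M"
  by (auto simp: module_hom_def)

lemma module_hom_zero:
  assumes "is_module K M" "is_module K N" "f \<in> module_hom K M N"
  shows "f \<zero>\<^bsub>M\<^esub> = \<zero>\<^bsub>N\<^esub>"
  using assms by (intro mod_hom.f0_is_0) (simp add: mod_hom_def mod_hom_axioms_def)

lemma module_hom_finsum:
  assumes "is_module K M" "is_module K N" "f \<in> module_hom K M N" "g \<in> A \<rightarrow> carrier M"
  shows "f (\<Oplus>\<^bsub>M\<^esub>a\<in>A. g a) = (\<Oplus>\<^bsub>N\<^esub>a\<in>A. f (g a))"
proof -
  interpret M: abelian_group M by (rule Module.module.axioms(2)) fact
  interpret N: abelian_group N by (rule Module.module.axioms(2)) fact
  show ?thesis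
    using assms(4)
  proof (induction A rule: infinite_finite_induct)
    case (insert a A)
    then have "g a \<in> carrier M" "g \<in> A \<rightarrow> carrier M" "(\<lambda>a. f (g a)) \<in> A \<rightarrow> carrier N"
      using module_homD(1)[OF assms(3)] by auto
    then show ?case
      using insert by (simp add: M.finsum_insert N.finsum_insert module_homD[OF assms(3)] M.finsum_closed)
  qed (simp_all add: M.add.finprod_infinite N.add.finprod_infinite module_hom_zero[OF assms(1-3)])
qed

section \<open>Free modules and linear extension\<close>

lemma mem_free_module: "u \<in> carrier (free_module K V) \<longleftrightarrow>
    (\<forall>x. u x \<in> carrier K) \<and> finite {x. u x \<noteq> \<zero>\<^bsub>K\<^esub>} \<and> {x. u x \<noteq> \<zero>\<^bsub>K\<^esub>} \<subseteq> V"
  and add_free_module: "u \<oplus>\<^bsub>free_module K V\<^esub> v = (\<lambda>x. u x \<oplus>\<^bsub>K\<^esub> v x)"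
  and zero_free_module: "\<zero>\<^bsub>free_module K V\<^esub> = (\<lambda>x. \<zero>\<^bsub>K\<^esub>)"
  and smult_free_module: "c \<odot>\<^bsub>free_module K V\<^esub> u = (\<lambda>x. c \<otimes>\<^bsub>K\<^esub> u x)"
  by (auto simp: free_module_def)

lemma free_module_module:
  fixes K :: "('k, 'm) ring_scheme"
  assumes "cring K" shows "is_module K (free_module K V)"
proof -
  interpret cring K by fact
  have sup: "(\<lambda>x. f (u x) (v x)) \<in> carrier (free_module K V)"
    if "u \<in> carrier (free_module K V)" "v \<in> carrier (free_module K V)"
      "\<And>a b. a \<in> carrier K \<Longrightarrow> b \<in> carrier K \<Longrightarrow> f a b \<in> carrier K" "f \<zero>\<^bsub>K\<^esub> \<zero>\<^bsub>K\<^esub> = \<zero>\<^bsub>K\<^esub>" for u v f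
  proof -
    have "{x. f (u x) (v x) \<noteq> \<zero>\<^bsub>K\<^esub>} \<subseteq> {x. u x \<noteq> \<zero>\<^bsub>K\<^esub>} \<union> {x. v x \<noteq> \<zero>\<^bsub>K\<^esub>}" using that(4) by auto
    moreover have "finite ({x. u x \<noteq> \<zero>\<^bsub>K\<^esub>} \<union> {x. v x \<noteq> \<zero>\<^bsub>K\<^esub>})"
      "{x. u x \<noteq> \<zero>\<^bsub>K\<^esub>} \<union> {x. v x \<noteq> \<zero>\<^bsub>K\<^esub>} \<subseteq> V"
      using that(1,2) by (auto simp: mem_free_module)
    ultimately show ?thesis
      using that unfolding mem_free_module by (meson finite_subset subset_trans)
  qed
  show ?thesis
  proof (rule LinearCombinations.module_criteria, goal_cases)
    case 4
    show ?case
    proof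
      fix u assume u: "u \<in> carrier (free_module K V)"
      then have "(\<lambda>x. \<ominus>\<^bsub>K\<^esub> u x) \<in> carrier (free_module K V)"
        by (intro sup[of u u "\<lambda>a b. \<ominus>\<^bsub>K\<^esub> a"]) auto
      then show "\<exists>v\<in>carrier (free_module K V). u \<oplus>\<^bsub>free_module K V\<^esub> v = \<zero>\<^bsub>free_module K V\<^esub>"
        using u by (intro bexI[of _ "\<lambda>x. \<ominus>\<^bsub>K\<^esub> u x"])
          (auto simp: add_free_module zero_free_module mem_free_module r_neg)
    qed
  next
    case 3 then show ?case
    proof (intro allI impI)
      fix u v assume "u \<in> carrier (free_module K V) \<and> v \<in> carrier (free_module K V)"
      then show "u \<oplus>\<^bsub>free_module K V\<^esub> v \<in> carrier (free_module K V)"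
        unfolding add_free_module by (intro sup[of u v "\<lambda>a b. a \<oplus>\<^bsub>K\<^esub> b"]) auto
    qed
  next
    case 5 then show ?case
    proof (intro allI impI)
      fix c u assume "c \<in> carrier K \<and> u \<in> carrier (free_module K V)"
      then show "c \<odot>\<^bsub>free_module K V\<^esub> u \<in> carrier (free_module K V)"
        unfolding smult_free_module by (intro sup[of u u "\<lambda>a b. c \<otimes>\<^bsub>K\<^esub> a"]) auto
    qed
  qed (auto simp: mem_free_module add_free_module zero_free_module smult_free_module
      is_cring a_ac m_ac l_distr r_distr fun_eq_iff)
qed

lemma free_gen_closed: "cring K \<Longrightarrow> x \<in> V \<Longrightarrow> free_gen K x \<in> carrier (free_module K V)"
proof -
  assume "cring K" "x \<in> V"
  interpret cring K by fact
  have "{y. free_gen K x y \<noteq> \<zero>\<^bsub>K\<^esub>} \<subseteq> {x}" by (auto simp: free_gen_def)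
  then show ?thesis using \<open>x \<in> V\<close>
    by (auto simp: mem_free_module free_gen_def intro: finite_subset)
qed

lemma finsum_free_module:
  assumes "cring K" "finite A" "g \<in> A \<rightarrow> carrier (free_module K V)"
  shows "(\<Oplus>\<^bsub>free_module K V\<^esub>a\<in>A. g a) x = (\<Oplus>\<^bsub>K\<^esub>a\<in>A. g a x)"
  using assms(2,3)
proof (induction A rule: finite_induct)
  interpret cring K by fact
  interpret F: Module.module K "free_module K V" by (rule free_module_module) fact
  {
    case empty then show ?case by (simp add: zero_free_module)
  next
    case (insert a A)
    then show ?case
      by (subst F.finsum_insert) (auto simp: add_free_module mem_free_module finsum_insert Pi_iff)
  }
qed

text \<open>\<open>lin_ext\<close> sums over the support, which changes with u; a common finite
  superset is needed to compare several vectors.\<close>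

lemma lin_ext_superset:
  assumes M: "is_module K M" and f: "f \<in> V \<rightarrow> carrier M" and u: "u \<in> carrier (free_module K V)"
    and S: "finite S" "S \<subseteq> V" "{x. u x \<noteq> \<zero>\<^bsub>K\<^esub>} \<subseteq> S"
  shows "lin_ext K M f u = (\<Oplus>\<^bsub>M\<^esub>x\<in>S. u x \<odot>\<^bsub>M\<^esub> f x)"
proof -
  interpret M: Module.module K M by fact
  show ?thesis unfolding lin_ext_def
    by (rule M.add.finprod_mono_neutral_cong_left) (use S f u in \<open>auto simp: mem_free_module Pi_iff subset_iff\<close>)
qed

lemma lin_ext_hom:
  assumes M: "is_module K M" and f: "f \<in> V \<rightarrow> carrier M"
  shows "lin_ext K M f \<in> module_hom K (free_module K V) M"
proof -
  interpret M: Module.module K M by fact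
  interpret F: Module.module K "free_module K V" by (rule free_module_module) (rule M.R.is_cring)
  show ?thesis
  proof (rule module_homI)
    fix u assume u: "u \<in> carrier (free_module K V)"
    show "lin_ext K M f u \<in> carrier M" unfolding lin_ext_def
      using u f by (intro M.finsum_closed) (auto simp: mem_free_module Pi_iff subset_iff)
    fix v assume v: "v \<in> carrier (free_module K V)"
    let ?S = "{x. u x \<noteq> \<zero>\<^bsub>K\<^esub>} \<union> {x. v x \<noteq> \<zero>\<^bsub>K\<^esub>}"
    have S: "finite ?S" "?S \<subseteq> V" using u v by (auto simp: mem_free_module)
    have uv: "u \<oplus>\<^bsub>free_module K V\<^esub> v \<in> carrier (free_module K V)" using u v by simp
    have "lin_ext K M f (u \<oplus>\<^bsub>free_module K V\<^esub> v) = (\<Oplus>\<^bsub>M\<^esub>x\<in>?S. (u \<oplus>\<^bsub>free_module K V\<^esub> v) x \<odot>\<^bsub>M\<^esub> f x)"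
      by (rule lin_ext_superset[OF M f uv S]) (auto simp: add_free_module)
    also have "\<dots> = (\<Oplus>\<^bsub>M\<^esub>x\<in>?S. u x \<odot>\<^bsub>M\<^esub> f x \<oplus>\<^bsub>M\<^esub> v x \<odot>\<^bsub>M\<^esub> f x)"
      using u v f S by (intro M.finsum_cong') (auto simp: add_free_module mem_free_module M.smult_l_distr Pi_iff)
    also have "\<dots> = (\<Oplus>\<^bsub>M\<^esub>x\<in>?S. u x \<odot>\<^bsub>M\<^esub> f x) \<oplus>\<^bsub>M\<^esub> (\<Oplus>\<^bsub>M\<^esub>x\<in>?S. v x \<odot>\<^bsub>M\<^esub> f x)"
      using u v f S by (intro M.finsum_addf) (auto simp: mem_free_module Pi_iff)
    also have "\<dots> = lin_ext K M f u \<oplus>\<^bsub>M\<^esub> lin_ext K M f v"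
      using lin_ext_superset[OF M f u S] lin_ext_superset[OF M f v S] by auto
    finally show "lin_ext K M f (u \<oplus>\<^bsub>free_module K V\<^esub> v) = lin_ext K M f u \<oplus>\<^bsub>M\<^esub> lin_ext K M f v" .
  next
    fix c u assume c: "c \<in> carrier K" and u: "u \<in> carrier (free_module K V)"
    let ?S = "{x. u x \<noteq> \<zero>\<^bsub>K\<^esub>}"
    have S: "finite ?S" "?S \<subseteq> V" using u by (auto simp: mem_free_module)
    have cu: "c \<odot>\<^bsub>free_module K V\<^esub> u \<in> carrier (free_module K V)" using c u by simp
    have "lin_ext K M f (c \<odot>\<^bsub>free_module K V\<^esub> u) = (\<Oplus>\<^bsub>M\<^esub>x\<in>?S. (c \<odot>\<^bsub>free_module K V\<^esub> u) x \<odot>\<^bsub>M\<^esub> f x)"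
      by (rule lin_ext_superset[OF M f cu S]) (use c in \<open>auto simp: smult_free_module\<close>)
    also have "\<dots> = (\<Oplus>\<^bsub>M\<^esub>x\<in>?S. c \<odot>\<^bsub>M\<^esub> (u x \<odot>\<^bsub>M\<^esub> f x))"
      using u c f S by (intro M.finsum_cong') (auto simp: smult_free_module mem_free_module M.smult_assoc1 Pi_iff)
    also have "\<dots> = c \<odot>\<^bsub>M\<^esub> lin_ext K M f u"
      unfolding lin_ext_def using u c f S
      by (intro M.finsum_smult_ldistr[symmetric]) (auto simp: mem_free_module Pi_iff)
    finally show "lin_ext K M f (c \<odot>\<^bsub>free_module K V\<^esub> u) = c \<odot>\<^bsub>M\<^esub> lin_ext K M f u" .
  qed
qed

lemma lin_ext_gen:
  assumes M: "is_module K M" and f: "f \<in> V \<rightarrow> carrier M" and x: "x \<in> V"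
  shows "lin_ext K M f (free_gen K x) = f x"
proof -
  interpret M: Module.module K M by fact
  have "lin_ext K M f (free_gen K x) = (\<Oplus>\<^bsub>M\<^esub>y\<in>{x}. free_gen K x y \<odot>\<^bsub>M\<^esub> f y)"
    by (rule lin_ext_superset[OF M f free_gen_closed[OF M.R.is_cring x]])
       (use x in \<open>auto simp: free_gen_def\<close>)
  then show ?thesis using f x by (simp add: free_gen_def Pi_iff)
qed

lemma free_module_decomp:
  assumes "cring K" and u: "u \<in> carrier (free_module K V)"
  shows "u = lin_ext K (free_module K V) (free_gen K) u"
proof
  fix y
  interpret cring K by fact
  interpret F: Module.module K "free_module K V" by (rule free_module_module) fact
  let ?S = "{x. u x \<noteq> \<zero>\<^bsub>K\<^esub>}"
  have S: "finite ?S" "?S \<subseteq> V" and uc: "\<And>x. u x \<in> carrier K" using u by (auto simp: mem_free_module)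
  have g: "(\<lambda>x. u x \<odot>\<^bsub>free_module K V\<^esub> free_gen K x) \<in> ?S \<rightarrow> carrier (free_module K V)"
    using S(2) by (intro Pi_I F.smult_closed uc free_gen_closed assms(1)) auto
  have "lin_ext K (free_module K V) (free_gen K) u y = (\<Oplus>\<^bsub>K\<^esub>x\<in>?S. u x \<otimes>\<^bsub>K\<^esub> free_gen K x y)"
    unfolding lin_ext_def finsum_free_module[OF assms(1) S(1) g] by (simp add: smult_free_module)
  also have "\<dots> = (\<Oplus>\<^bsub>K\<^esub>x\<in>?S. if y = x then u x else \<zero>\<^bsub>K\<^esub>)"
    by (rule finsum_cong') (use uc in \<open>auto simp: free_gen_def\<close>)
  also have "\<dots> = u y"
  proof (cases "y \<in> ?S")
    case True then show ?thesis using add.finprod_singleton[OF True S(1), of u] uc by auto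
  next
    case False
    then have "(\<Oplus>\<^bsub>K\<^esub>x\<in>?S. if y = x then u x else \<zero>\<^bsub>K\<^esub>) = (\<Oplus>\<^bsub>K\<^esub>x\<in>?S. \<zero>\<^bsub>K\<^esub>)"
      by (intro finsum_cong') auto
    then show ?thesis using False by simp
  qed
  finally show "u y = lin_ext K (free_module K V) (free_gen K) u y" ..
qed

lemma free_module_hom_eqI:
  assumes M: "is_module K M" and fg: "f \<in> module_hom K (free_module K V) M" "g \<in> module_hom K (free_module K V) M"
    and eq: "\<And>x. x \<in> V \<Longrightarrow> f (free_gen K x) = g (free_gen K x)" and u: "u \<in> carrier (free_module K V)"
  shows "f u = g u"
proof -
  interpret M: Module.module K M by fact
  interpret F: Module.module K "free_module K V" by (rule free_module_module) (rule M.R.is_cring)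
  have uc: "u x \<in> carrier K" and uV: "u x \<noteq> \<zero>\<^bsub>K\<^esub> \<Longrightarrow> x \<in> V" for x
    using u by (auto simp: mem_free_module)
  have *: "h u = (\<Oplus>\<^bsub>M\<^esub>x\<in>{x. u x \<noteq> \<zero>\<^bsub>K\<^esub>}. u x \<odot>\<^bsub>M\<^esub> h (free_gen K x))" if h: "h \<in> module_hom K (free_module K V) M" for h
  proof -
    have g: "(\<lambda>x. u x \<odot>\<^bsub>free_module K V\<^esub> free_gen K x) \<in> {x. u x \<noteq> \<zero>\<^bsub>K\<^esub>} \<rightarrow> carrier (free_module K V)"
      using u by (intro Pi_I F.smult_closed free_gen_closed M.R.is_cring) (auto simp: mem_free_module)
    have "h u = h (\<Oplus>\<^bsub>free_module K V\<^esub>x\<in>{x. u x \<noteq> \<zero>\<^bsub>K\<^esub>}. u x \<odot>\<^bsub>free_module K V\<^esub> free_gen K x)"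
      by (subst free_module_decomp[OF M.R.is_cring u]) (simp add: lin_ext_def)
    also have "\<dots> = (\<Oplus>\<^bsub>M\<^esub>x\<in>{x. u x \<noteq> \<zero>\<^bsub>K\<^esub>}. h (u x \<odot>\<^bsub>free_module K V\<^esub> free_gen K x))"
      by (rule module_hom_finsum[OF F.module_axioms M h g])
    also have "\<dots> = (\<Oplus>\<^bsub>M\<^esub>x\<in>{x. u x \<noteq> \<zero>\<^bsub>K\<^esub>}. u x \<odot>\<^bsub>M\<^esub> h (free_gen K x))"
    proof (rule M.finsum_cong')
      show "(\<lambda>x. u x \<odot>\<^bsub>M\<^esub> h (free_gen K x)) \<in> {x. u x \<noteq> \<zero>\<^bsub>K\<^esub>} \<rightarrow> carrier M"
        by (intro Pi_I M.smult_closed module_homD(1)[OF h] free_gen_closed M.R.is_cring uc uV) simp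
      fix x assume "x \<in> {x. u x \<noteq> \<zero>\<^bsub>K\<^esub>}"
      then have "x \<in> V" "u x \<in> carrier K" using u by (auto simp: mem_free_module)
      then show "h (u x \<odot>\<^bsub>free_module K V\<^esub> free_gen K x) = u x \<odot>\<^bsub>M\<^esub> h (free_gen K x)"
        by (intro module_homD(3)[OF h] free_gen_closed M.R.is_cring)
    qed simp
    finally show ?thesis .
  qed
  have "(\<Oplus>\<^bsub>M\<^esub>x\<in>{x. u x \<noteq> \<zero>\<^bsub>K\<^esub>}. u x \<odot>\<^bsub>M\<^esub> f (free_gen K x)) = (\<Oplus>\<^bsub>M\<^esub>x\<in>{x. u x \<noteq> \<zero>\<^bsub>K\<^esub>}. u x \<odot>\<^bsub>M\<^esub> g (free_gen K x))"
    by (intro M.finsum_cong' Pi_I M.smult_closed module_homD(1)[OF fg(2)] free_gen_closed M.R.is_cring uc uV)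
       (simp_all add: eq uV)
  then show ?thesis using *[OF fg(1)] *[OF fg(2)] by simp
qed

section \<open>Quotients by submodules\<close>

lemma quot_module_sel:
  "carrier (quot_module M N) = carrier (M Quot N)"
  "\<zero>\<^bsub>quot_module M N\<^esub> = N"
  "S \<oplus>\<^bsub>quot_module M N\<^esub> T = S <+>\<^bsub>M\<^esub> T"
  "\<one>\<^bsub>quot_module M N\<^esub> = N +>\<^bsub>M\<^esub> \<one>\<^bsub>M\<^esub>"
  "S \<otimes>\<^bsub>quot_module M N\<^esub> T = rcoset_mult M N S T"
  "c \<odot>\<^bsub>quot_module M N\<^esub> T = (\<Union>t\<in>T. N +>\<^bsub>M\<^esub> (c \<odot>\<^bsub>M\<^esub> t))"
  by (simp_all add: quot_module_def ring.defs module.defs FactRing_def)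

text \<open>The multiplication of M may be a dummy, so the quotient is studied through additive
  cosets rather than ideals.\<close>

locale quotient_by_submodule = Module.module K M + N?: submodule K N M
  for K :: "('k, 'm) ring_scheme" and M :: "('k, 'a, 'n) module_scheme" (structure) and N
begin

lemma abelian_subgroup_N: "abelian_subgroup N M"
proof -
  have "\<ominus>\<^bsub>M\<^esub> v \<in> N" if "v \<in> N" for v
  proof -
    have "\<ominus>\<^bsub>M\<^esub> v = (\<ominus>\<^bsub>K\<^esub> \<one>\<^bsub>K\<^esub>) \<odot> v" using that subset smult_l_minus[of "\<one>\<^bsub>K\<^esub>" v] by auto
    then show ?thesis using that by simp
  qed
  moreover have "N \<noteq> {}" using N.zero_closed by blast
  ultimately have "subgroup N (add_monoid M)"
    using subset by (intro M.add.subgroupI) (auto simp: a_inv_def)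
  then show ?thesis
    by (intro abelian_subgroupI3 additive_subgroup.intro M.abelian_group_axioms)
qed

interpretation abelian_subgroup N M by (rule abelian_subgroup_N)

lemma carrier_quot: "carrier (quot_module M N) = (\<lambda>x. N +> x) ` carrier M"
  by (auto simp: quot_module_sel FactRing_def A_RCOSETS_def')

lemma coset_eq_iff: "x \<in> carrier M \<Longrightarrow> y \<in> carrier M \<Longrightarrow> N +> x = N +> y \<longleftrightarrow> x \<ominus> y \<in> N"
  using a_repr_independence'[of x y] a_repr_independence'[of x y] a_rcos_self[of x]
    a_rcos_module[of y x] by (auto simp: a_minus_def)

lemma mem_coset: "x \<in> carrier M \<Longrightarrow> y \<in> N +> x \<Longrightarrow> y \<in> carrier M \<and> N +> y = N +> x"
  using a_repr_independence'[of y x] a_r_coset_subset_G[OF subset, of x] by auto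

text \<open>All representatives t yield the same coset of c t, so the union in the definition of
  scalar multiplication is over equal sets.\<close>

lemma smult_coset:
  assumes c: "c \<in> carrier K" and x: "x \<in> carrier M"
  shows "c \<odot>\<^bsub>quot_module M N\<^esub> (N +> x) = N +> (c \<odot> x)"
proof -
  have eq: "N +> (c \<odot> t) = N +> (c \<odot> x)" if "t \<in> N +> x" for t
  proof -
    have t: "t \<in> carrier M" "N +> t = N +> x" using mem_coset[OF x that] by auto
    then have "t \<ominus> x \<in> N" using coset_eq_iff x by blast
    then have "c \<odot> (t \<ominus> x) \<in> N" using c by simp
    moreover have "c \<odot> (t \<ominus> x) = c \<odot> t \<ominus> c \<odot> x"
      using c t(1) x by (simp add: a_minus_def smult_r_distr smult_r_minus)
    ultimately show ?thesis using coset_eq_iff c t(1) x by simp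
  qed
  have "(\<Union>t\<in>N +> x. N +> (c \<odot> t)) = (\<Union>t\<in>N +> x. N +> (c \<odot> x))"
    by (rule SUP_cong[OF refl]) (rule eq)
  also have "\<dots> = N +> (c \<odot> x)" using a_rcos_self[OF x] by blast
  finally show ?thesis by (simp only: quot_module_sel)
qed

lemma add_coset: "x \<in> carrier M \<Longrightarrow> y \<in> carrier M \<Longrightarrow>
    (N +> x) \<oplus>\<^bsub>quot_module M N\<^esub> (N +> y) = N +> (x \<oplus> y)"
  by (simp add: quot_module_sel a_rcos_sum)

lemma zero_coset: "\<zero>\<^bsub>quot_module M N\<^esub> = N +> \<zero>"
proof -
  have "N +> \<zero> = N" using a_coset_add_zero[OF subset] .
  then show ?thesis by (simp add: quot_module_sel)
qed

lemma quot_module_module: "is_module K (quot_module M N)"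
  by (rule LinearCombinations.module_criteria)
     (auto simp: carrier_quot smult_coset add_coset zero_coset R.is_cring M.a_ac smult_r_distr
       smult_l_distr smult_assoc1 intro!: bexI[of _ "\<ominus>_"] simp: M.r_neg)

lemma proj_hom: "(\<lambda>x. N +> x) \<in> module_hom K M (quot_module M N)"
  by (rule module_homI) (auto simp: carrier_quot smult_coset add_coset)

lemma coset_nonempty: "x \<in> carrier M \<Longrightarrow> x \<in> N +> x"
  by (rule a_rcos_self)

end

section \<open>The universal property of the tensor product\<close>

definition bilinear_map where
  "bilinear_map K A B M f \<longleftrightarrow> (\<forall>b\<in>carrier B. (\<lambda>a. f a b) \<in> module_hom K A M)
    \<and> (\<forall>a\<in>carrier A. f a \<in> module_hom K B M)"

lemma bilinear_mapI:
  "(\<And>b. b \<in> carrier B \<Longrightarrow> (\<lambda>a. f a b) \<in> module_hom K A M) \<Longrightarrow>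
   (\<And>a. a \<in> carrier A \<Longrightarrow> f a \<in> module_hom K B M) \<Longrightarrow> bilinear_map K A B M f"
  by (simp add: bilinear_map_def)

locale module_pair = A?: Module.module K A + B?: Module.module K B
  for K :: "('k, 'm) ring_scheme" and A :: "('k, 'a, 'r) module_scheme" and B :: "('k, 'b, 's) module_scheme"
begin

abbreviation "FM \<equiv> free_module K (carrier A \<times> carrier B)"

lemma FM_module: "is_module K FM" by (rule free_module_module) (rule A.R.is_cring)

lemma gen_closed: "a \<in> carrier A \<Longrightarrow> b \<in> carrier B \<Longrightarrow> free_gen K (a, b) \<in> carrier FM"
  by (rule free_gen_closed) (auto simp: A.R.is_cring)

interpretation FM: Module.module K FM by (rule FM_module)

lemma relations_subset: "tensor_relations K A B \<subseteq> carrier FM"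
  unfolding tensor_relations_def Let_def
  by (auto intro!: FM.M.minus_closed FM.M.a_closed FM.smult_closed gen_closed)

lemma null_submodule: "submodule K (tensor_null K A B) FM"
  unfolding tensor_null_def by (rule FM.span_is_submodule) (rule relations_subset)

sublocale Q: quotient_by_submodule K FM "tensor_null K A B"
  using FM_module null_submodule by (simp add: quotient_by_submodule_def)

lemma tensor_module_module: "is_module K (tensor_module K A B)"
  unfolding tensor_module_def by (rule Q.quot_module_module)

lemma pure_closed: "a \<in> carrier A \<Longrightarrow> b \<in> carrier B \<Longrightarrow> pure_tensor K A B a b \<in> carrier (tensor_module K A B)"
  unfolding tensor_module_def pure_tensor_def Q.carrier_quot using gen_closed by auto

lemma relation_coset:
  "x \<in> carrier FM \<Longrightarrow> y \<in> carrier FM \<Longrightarrow> x \<ominus>\<^bsub>FM\<^esub> y \<in> tensor_relations K A B \<Longrightarrow>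
    tensor_null K A B +>\<^bsub>FM\<^esub> x = tensor_null K A B +>\<^bsub>FM\<^esub> y"
  using Q.coset_eq_iff[of x y] FM.in_own_span[OF relations_subset] unfolding tensor_null_def by auto

lemma pure_bilinear: "bilinear_map K A B (tensor_module K A B) (pure_tensor K A B)"
proof (intro bilinear_mapI module_homI)
  note simps = tensor_module_def pure_tensor_def
  let ?g = "free_gen K"
  {
    fix a a' b assume *: "a \<in> carrier A" "a' \<in> carrier A" "b \<in> carrier B"
    have "?g (a \<oplus>\<^bsub>A\<^esub> a', b) \<ominus>\<^bsub>FM\<^esub> (?g (a, b) \<oplus>\<^bsub>FM\<^esub> ?g (a', b)) \<in> tensor_relations K A B"
      unfolding tensor_relations_def Let_def using * by blast
    then have "tensor_null K A B +>\<^bsub>FM\<^esub> ?g (a \<oplus>\<^bsub>A\<^esub> a', b) = tensor_null K A B +>\<^bsub>FM\<^esub> (?g (a, b) \<oplus>\<^bsub>FM\<^esub> ?g (a', b))"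
      using * by (intro relation_coset gen_closed FM.a_closed A.M.a_closed)
    then show "pure_tensor K A B (a \<oplus>\<^bsub>A\<^esub> a') b = pure_tensor K A B a b \<oplus>\<^bsub>tensor_module K A B\<^esub> pure_tensor K A B a' b"
      unfolding simps using * by (simp add: Q.add_coset gen_closed)
  next
    fix a b b' assume *: "a \<in> carrier A" "b \<in> carrier B" "b' \<in> carrier B"
    have "?g (a, b \<oplus>\<^bsub>B\<^esub> b') \<ominus>\<^bsub>FM\<^esub> (?g (a, b) \<oplus>\<^bsub>FM\<^esub> ?g (a, b')) \<in> tensor_relations K A B"
      unfolding tensor_relations_def Let_def using * by blast
    then have "tensor_null K A B +>\<^bsub>FM\<^esub> ?g (a, b \<oplus>\<^bsub>B\<^esub> b') = tensor_null K A B +>\<^bsub>FM\<^esub> (?g (a, b) \<oplus>\<^bsub>FM\<^esub> ?g (a, b'))"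
      using * by (intro relation_coset gen_closed FM.a_closed B.M.a_closed)
    then show "pure_tensor K A B a (b \<oplus>\<^bsub>B\<^esub> b') = pure_tensor K A B a b \<oplus>\<^bsub>tensor_module K A B\<^esub> pure_tensor K A B a b'"
      unfolding simps using * by (simp add: Q.add_coset gen_closed)
  next
    fix a b c assume *: "a \<in> carrier A" "b \<in> carrier B" "c \<in> carrier K"
    have "?g (c \<odot>\<^bsub>A\<^esub> a, b) \<ominus>\<^bsub>FM\<^esub> c \<odot>\<^bsub>FM\<^esub> ?g (a, b) \<in> tensor_relations K A B"
      unfolding tensor_relations_def Let_def using * by blast
    then have "tensor_null K A B +>\<^bsub>FM\<^esub> ?g (c \<odot>\<^bsub>A\<^esub> a, b) = tensor_null K A B +>\<^bsub>FM\<^esub> (c \<odot>\<^bsub>FM\<^esub> ?g (a, b))"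
      using * by (intro relation_coset gen_closed FM.smult_closed A.smult_closed)
    then show "pure_tensor K A B (c \<odot>\<^bsub>A\<^esub> a) b = c \<odot>\<^bsub>tensor_module K A B\<^esub> pure_tensor K A B a b"
      unfolding simps using * by (simp add: Q.smult_coset gen_closed)
    have "?g (a, c \<odot>\<^bsub>B\<^esub> b) \<ominus>\<^bsub>FM\<^esub> c \<odot>\<^bsub>FM\<^esub> ?g (a, b) \<in> tensor_relations K A B"
      unfolding tensor_relations_def Let_def using * by blast
    then have "tensor_null K A B +>\<^bsub>FM\<^esub> ?g (a, c \<odot>\<^bsub>B\<^esub> b) = tensor_null K A B +>\<^bsub>FM\<^esub> (c \<odot>\<^bsub>FM\<^esub> ?g (a, b))"
      using * by (intro relation_coset gen_closed FM.smult_closed B.smult_closed)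
    then show "pure_tensor K A B a (c \<odot>\<^bsub>B\<^esub> b) = c \<odot>\<^bsub>tensor_module K A B\<^esub> pure_tensor K A B a b"
      unfolding simps using * by (simp add: Q.smult_coset gen_closed)
  }
qed (rule pure_closed; assumption)+

text \<open>The arbitrary representative inside \<open>tensor_lift\<close> is harmless: for bilinear
  f the linear extension kills the tensor relations, hence their span, and so is constant on
  cosets.\<close>

lemma tensor_lift_coset:
  assumes M: "is_module K M" and f: "bilinear_map K A B M f" and u: "u \<in> carrier FM"
  shows "tensor_lift K M f (tensor_null K A B +>\<^bsub>FM\<^esub> u) = lin_ext K M (\<lambda>(a, b). f a b) u"
proof -
  interpret M: Module.module K M by fact
  let ?h = "lin_ext K M (\<lambda>(a, b). f a b)"
  have fl: "(\<lambda>b. f a b) \<in> module_hom K B M" if "a \<in> carrier A" for a using f that by (auto simp: bilinear_map_def)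
  have fr: "(\<lambda>a. f a b) \<in> module_hom K A M" if "b \<in> carrier B" for b using f that by (auto simp: bilinear_map_def)
  have fc: "(\<lambda>(a, b). f a b) \<in> carrier A \<times> carrier B \<rightarrow> carrier M"
    using module_homD(1)[OF fl] by auto
  have h: "?h \<in> module_hom K FM M" by (rule lin_ext_hom[OF M fc])
  interpret h: mod_hom K FM M ?h
    using FM_module M h by (simp add: mod_hom_def mod_hom_axioms_def)
  have gen: "?h (free_gen K (a, b)) = f a b" if "a \<in> carrier A" "b \<in> carrier B" for a b
    using lin_ext_gen[OF M fc, of "(a, b)"] that by simp
  have fcl: "f a b \<in> carrier M" if "a \<in> carrier A" "b \<in> carrier B" for a b
    using module_homD(1)[OF fl] that by auto
  have "tensor_relations K A B \<subseteq> h.ker"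
    unfolding tensor_relations_def Let_def
    by (auto simp: h.ker_def gen gen_closed module_homD[OF fl] module_homD[OF fr] fcl
        M.minus_eq M.r_neg module_homD[OF h] h.f_minus)
  then have "tensor_null K A B \<subseteq> h.ker"
    unfolding tensor_null_def by (rule FM.span_is_subset) (rule h.ker_is_submodule)
  moreover define v where "v = (SOME v. v \<in> tensor_null K A B +>\<^bsub>FM\<^esub> u)"
  have "v \<in> tensor_null K A B +>\<^bsub>FM\<^esub> u"
    unfolding v_def by (rule someI[of _ u]) (rule Q.coset_nonempty[OF u])
  then have v: "v \<in> carrier FM" "v \<ominus>\<^bsub>FM\<^esub> u \<in> tensor_null K A B"
    using Q.mem_coset[OF u] Q.coset_eq_iff[of v u] u by auto
  ultimately have "?h (v \<ominus>\<^bsub>FM\<^esub> u) = \<zero>\<^bsub>M\<^esub>" by (auto simp: h.ker_def)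
  then have "?h v \<ominus>\<^bsub>M\<^esub> ?h u = \<zero>\<^bsub>M\<^esub>" using v(1) u by simp
  then have "?h v = ?h u" using v(1) u M.minus_equality[of "?h v" "\<ominus>\<^bsub>M\<^esub> ?h u"] by (simp add: a_minus_def)
  then show ?thesis by (simp add: tensor_lift_def v_def)
qed

lemma tensor_lift_hom:
  assumes M: "is_module K M" and f: "bilinear_map K A B M f"
  shows "tensor_lift K M f \<in> module_hom K (tensor_module K A B) M"
proof -
  have fc: "(\<lambda>(a, b). f a b) \<in> carrier A \<times> carrier B \<rightarrow> carrier M"
    using f by (auto simp: bilinear_map_def module_hom_def Pi_iff)
  note h = lin_ext_hom[OF M fc]
  show ?thesis
    by (rule module_homI)
       (auto simp: tensor_module_def Q.carrier_quot tensor_lift_coset[OF M f] Q.add_coset Q.smult_coset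
          module_homD[OF h])
qed

lemma tensor_lift_pure:
  assumes M: "is_module K M" and f: "bilinear_map K A B M f" and "a \<in> carrier A" "b \<in> carrier B"
  shows "tensor_lift K M f (pure_tensor K A B a b) = f a b"
proof -
  have fc: "(\<lambda>(a, b). f a b) \<in> carrier A \<times> carrier B \<rightarrow> carrier M"
    using f by (auto simp: bilinear_map_def module_hom_def Pi_iff)
  show ?thesis
    using lin_ext_gen[OF M fc, of "(a, b)"] assms
    by (simp add: pure_tensor_def tensor_lift_coset gen_closed)
qed

lemma tensor_hom_eqI:
  assumes M: "is_module K M"
    and f: "f \<in> module_hom K (tensor_module K A B) M" and g: "g \<in> module_hom K (tensor_module K A B) M"
    and eq: "\<And>a b. a \<in> carrier A \<Longrightarrow> b \<in> carrier B \<Longrightarrow> f (pure_tensor K A B a b) = g (pure_tensor K A B a b)"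
    and t: "t \<in> carrier (tensor_module K A B)"
  shows "f t = g t"
proof -
  obtain u where u: "u \<in> carrier FM" "t = tensor_null K A B +>\<^bsub>FM\<^esub> u"
    using t by (auto simp: tensor_module_def Q.carrier_quot)
  note pr = Q.proj_hom[folded tensor_module_def]
  show ?thesis unfolding u(2)
    by (rule free_module_hom_eqI[OF M module_hom_comp[OF pr f] module_hom_comp[OF pr g] _ u(1)])
       (auto simp: pure_tensor_def[symmetric] eq)
qed

end

lemma module_hom_add:
  assumes "is_module K N" "f \<in> module_hom K M N" "g \<in> module_hom K M N"
  shows "(\<lambda>x. f x \<oplus>\<^bsub>N\<^esub> g x) \<in> module_hom K M N"
proof -
  interpret N: Module.module K N by fact
  show ?thesis
    by (rule module_homI)
       (auto simp: module_homD[OF assms(2)] module_homD[OF assms(3)] N.smult_r_distr N.M.a_ac)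
qed

lemma module_hom_smult_left:
  assumes "is_module K N" "f \<in> module_hom K M N" "c \<in> carrier K"
  shows "(\<lambda>x. c \<odot>\<^bsub>N\<^esub> f x) \<in> module_hom K M N"
proof -
  interpret N: Module.module K N by fact
  show ?thesis
    using assms(3) by (intro module_homI)
       (auto simp: module_homD[OF assms(2)] N.smult_r_distr N.smult_assoc1[symmetric] N.R.m_comm)
qed

lemma module_hom_finsum_pointwise:
  assumes "is_module K N" "finite A" "\<And>a. a \<in> A \<Longrightarrow> f a \<in> module_hom K M N"
  shows "(\<lambda>x. \<Oplus>\<^bsub>N\<^esub>a\<in>A. f a x) \<in> module_hom K M N"
proof -
  interpret N: Module.module K N by fact
  have fc: "f a x \<in> carrier N" if "a \<in> A" "x \<in> carrier M" for a x
    using assms(3)[OF that(1)] that(2) by (rule module_homD(1))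
  show ?thesis
  proof (rule module_homI)
    fix x y assume "x \<in> carrier M" "y \<in> carrier M"
    then have "(\<Oplus>\<^bsub>N\<^esub>a\<in>A. f a (x \<oplus>\<^bsub>M\<^esub> y)) = (\<Oplus>\<^bsub>N\<^esub>a\<in>A. f a x \<oplus>\<^bsub>N\<^esub> f a y)"
      by (intro N.finsum_cong') (auto simp: fc module_homD(2)[OF assms(3)])
    also have "\<dots> = (\<Oplus>\<^bsub>N\<^esub>a\<in>A. f a x) \<oplus>\<^bsub>N\<^esub> (\<Oplus>\<^bsub>N\<^esub>a\<in>A. f a y)"
      using \<open>x \<in> carrier M\<close> \<open>y \<in> carrier M\<close> by (intro N.finsum_addf) (auto simp: fc)
    finally show "(\<Oplus>\<^bsub>N\<^esub>a\<in>A. f a (x \<oplus>\<^bsub>M\<^esub> y)) = (\<Oplus>\<^bsub>N\<^esub>a\<in>A. f a x) \<oplus>\<^bsub>N\<^esub> (\<Oplus>\<^bsub>N\<^esub>a\<in>A. f a y)" .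
  next
    fix c x assume "c \<in> carrier K" "x \<in> carrier M"
    then show "(\<Oplus>\<^bsub>N\<^esub>a\<in>A. f a (c \<odot>\<^bsub>M\<^esub> x)) = c \<odot>\<^bsub>N\<^esub> (\<Oplus>\<^bsub>N\<^esub>a\<in>A. f a x)"
      by (subst N.finsum_smult_ldistr[OF assms(2)])
         (auto simp: fc module_homD(3)[OF assms(3)] intro!: N.finsum_cong')
  qed (auto intro!: N.finsum_closed fc)
qed

lemma bilinear_mapD:
  assumes "bilinear_map K A B M f"
  shows "b \<in> carrier B \<Longrightarrow> (\<lambda>a. f a b) \<in> module_hom K A M"
    and "a \<in> carrier A \<Longrightarrow> f a \<in> module_hom K B M"
    and "a \<in> carrier A \<Longrightarrow> b \<in> carrier B \<Longrightarrow> f a b \<in> carrier M"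
  using assms module_homD(1)[of "f a" K B M b] by (auto simp: bilinear_map_def)

lemma bilinear_map_comp:
  assumes "bilinear_map K A B M f" "h \<in> module_hom K M N"
  shows "bilinear_map K A B N (\<lambda>a b. h (f a b))"
  by (rule bilinear_mapI; rule module_hom_comp[OF _ assms(2)]) (auto intro: bilinear_mapD[OF assms(1)])

lemma bilinear_map_precomp:
  assumes "bilinear_map K A B M f" "g \<in> module_hom K C A" "h \<in> module_hom K D B"
  shows "bilinear_map K C D M (\<lambda>c d. f (g c) (h d))"
proof (rule bilinear_mapI)
  fix d assume "d \<in> carrier D"
  then show "(\<lambda>c. f (g c) (h d)) \<in> module_hom K C M"
    by (rule module_hom_comp[OF assms(2) bilinear_mapD(1)[OF assms(1) module_homD(1)[OF assms(3)]]])
next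
  fix c assume "c \<in> carrier C"
  then show "(\<lambda>d. f (g c) (h d)) \<in> module_hom K D M"
    by (rule module_hom_comp[OF assms(3) bilinear_mapD(2)[OF assms(1) module_homD(1)[OF assms(2)]]])
qed

lemma module_pairI: "is_module K A \<Longrightarrow> is_module K B \<Longrightarrow> module_pair K A B"
  by (simp add: module_pair_def)

text \<open>Linearity in a parameter of the bilinear map. It is what makes nested lifts bilinear, as
  in \<open>tensor_assoc\<close> and in the product of tensor algebras.\<close>

lemma (in module_pair) tensor_lift_param:
  assumes M: "is_module K M" and C: "\<And>a b. a \<in> carrier A \<Longrightarrow> b \<in> carrier B \<Longrightarrow> (\<lambda>c. F c a b) \<in> module_hom K C M"
    and CM: "is_module K C"
    and F: "\<And>c. c \<in> carrier C \<Longrightarrow> bilinear_map K A B M (F c)" and t: "t \<in> carrier (tensor_module K A B)"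
  shows "(\<lambda>c. tensor_lift K M (F c) t) \<in> module_hom K C M"
proof -
  interpret C: Module.module K C by fact
  note h = tensor_lift_hom[OF M F]
  show ?thesis
  proof (rule module_homI)
    fix c assume c: "c \<in> carrier C"
    show "tensor_lift K M (F c) t \<in> carrier M" by (rule module_homD(1)[OF h[OF c] t])
    fix c' assume c': "c' \<in> carrier C"
    have cc: "c \<oplus>\<^bsub>C\<^esub> c' \<in> carrier C" using c c' by simp
    show "tensor_lift K M (F (c \<oplus>\<^bsub>C\<^esub> c')) t = tensor_lift K M (F c) t \<oplus>\<^bsub>M\<^esub> tensor_lift K M (F c') t"
      by (rule tensor_hom_eqI[OF M h[OF cc] module_hom_add[OF M h[OF c] h[OF c']] _ t])
         (simp add: tensor_lift_pure[OF M F] c c' cc module_homD(2)[OF C])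
  next
    fix k c assume k: "k \<in> carrier K" and c: "c \<in> carrier C"
    have kc: "k \<odot>\<^bsub>C\<^esub> c \<in> carrier C" using k c by simp
    show "tensor_lift K M (F (k \<odot>\<^bsub>C\<^esub> c)) t = k \<odot>\<^bsub>M\<^esub> tensor_lift K M (F c) t"
      by (rule tensor_hom_eqI[OF M h[OF kc] module_hom_smult_left[OF M h[OF c] k] _ t])
         (simp add: tensor_lift_pure[OF M F] k c kc module_homD(3)[OF C])
  qed
qed

lemma
  assumes AB: "is_module K A" "is_module K B" and CD: "is_module K C" "is_module K D"
    and f: "f \<in> module_hom K C A" and g: "g \<in> module_hom K D B"
  shows tensor_map_hom: "tensor_map K A B f g \<in> module_hom K (tensor_module K C D) (tensor_module K A B)"
    and tensor_map_pure: "c \<in> carrier C \<Longrightarrow> d \<in> carrier D \<Longrightarrow>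
      tensor_map K A B f g (pure_tensor K C D c d) = pure_tensor K A B (f c) (g d)"
proof -
  interpret AB: module_pair K A B using AB by (rule module_pairI)
  interpret CD: module_pair K C D using CD by (rule module_pairI)
  note b = bilinear_map_precomp[OF AB.pure_bilinear f g]
  show "tensor_map K A B f g \<in> module_hom K (tensor_module K C D) (tensor_module K A B)"
    unfolding tensor_map_def by (rule CD.tensor_lift_hom[OF AB.tensor_module_module b])
  show "c \<in> carrier C \<Longrightarrow> d \<in> carrier D \<Longrightarrow>
      tensor_map K A B f g (pure_tensor K C D c d) = pure_tensor K A B (f c) (g d)"
    unfolding tensor_map_def by (rule CD.tensor_lift_pure[OF AB.tensor_module_module b])
qed

lemma
  assumes A: "is_module K A" and B: "is_module K B" and C: "is_module K C"
  shows tensor_assoc_hom: "tensor_assoc K A B C \<in> module_hom K (tensor_module K (tensor_module K A B) C)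
        (tensor_module K A (tensor_module K B C))"
    and tensor_assoc_pure: "a \<in> carrier A \<Longrightarrow> b \<in> carrier B \<Longrightarrow> c \<in> carrier C \<Longrightarrow>
      tensor_assoc K A B C (pure_tensor K (tensor_module K A B) C (pure_tensor K A B a b) c)
        = pure_tensor K A (tensor_module K B C) a (pure_tensor K B C b c)"
proof -
  interpret AB: module_pair K A B using A B by (rule module_pairI)
  interpret BC: module_pair K B C using B C by (rule module_pairI)
  interpret ABC: module_pair K A "tensor_module K B C" using A BC.tensor_module_module by (rule module_pairI)
  interpret ABC': module_pair K "tensor_module K A B" C using AB.tensor_module_module C by (rule module_pairI)
  let ?M = "tensor_module K A (tensor_module K B C)"
  let ?f = "\<lambda>c a b. pure_tensor K A (tensor_module K B C) a (pure_tensor K B C b c)"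
  have M: "is_module K ?M" by (rule ABC.tensor_module_module)
  have f: "bilinear_map K A B ?M (?f c)" if "c \<in> carrier C" for c
    by (rule bilinear_map_precomp[OF ABC.pure_bilinear module_hom_id bilinear_mapD(1)[OF BC.pure_bilinear that]])
  have fc: "(\<lambda>c. ?f c a b) \<in> module_hom K C ?M" if "a \<in> carrier A" "b \<in> carrier B" for a b
    by (rule module_hom_comp[OF bilinear_mapD(2)[OF BC.pure_bilinear that(2)] bilinear_mapD(2)[OF ABC.pure_bilinear that(1)]])
  have b: "bilinear_map K (tensor_module K A B) C ?M (\<lambda>t c. tensor_lift K ?M (?f c) t)"
    by (rule bilinear_mapI[OF AB.tensor_lift_hom[OF M f] AB.tensor_lift_param[OF M fc C f]])
  show "tensor_assoc K A B C \<in> module_hom K (tensor_module K (tensor_module K A B) C) ?M"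
    unfolding tensor_assoc_def Let_def by (rule ABC'.tensor_lift_hom[OF M b])
  assume "a \<in> carrier A" "b \<in> carrier B" "c \<in> carrier C"
  then show "tensor_assoc K A B C (pure_tensor K (tensor_module K A B) C (pure_tensor K A B a b) c)
        = pure_tensor K A (tensor_module K B C) a (pure_tensor K B C b c)"
    unfolding tensor_assoc_def Let_def
    by (subst ABC'.tensor_lift_pure[OF M b]) (simp_all add: AB.pure_closed AB.tensor_lift_pure[OF M f])
qed

lemma tensor_algebra_sel [simp]:
  "carrier (tensor_algebra K A B) = carrier (tensor_module K A B)"
  "\<zero>\<^bsub>tensor_algebra K A B\<^esub> = \<zero>\<^bsub>tensor_module K A B\<^esub>"
  "x \<oplus>\<^bsub>tensor_algebra K A B\<^esub> y = x \<oplus>\<^bsub>tensor_module K A B\<^esub> y"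
  "c \<odot>\<^bsub>tensor_algebra K A B\<^esub> y = c \<odot>\<^bsub>tensor_module K A B\<^esub> y"
  "\<one>\<^bsub>tensor_algebra K A B\<^esub> = pure_tensor K A B \<one>\<^bsub>A\<^esub> \<one>\<^bsub>B\<^esub>"
  by (simp_all add: tensor_algebra_def)

lemma finsum_tensor_algebra: "finsum (tensor_algebra K A B) = finsum (tensor_module K A B)"
  unfolding finsum_def by (simp add: tensor_algebra_def)

lemma module_hom_tensor_algebra: "module_hom K M (tensor_algebra K A B) = module_hom K M (tensor_module K A B)"
  by (simp add: module_hom_def)

lemma
  assumes A: "is_module K A" "bilinear_map K A A A (\<otimes>\<^bsub>A\<^esub>)" and B: "is_module K B" "bilinear_map K B B B (\<otimes>\<^bsub>B\<^esub>)"
  shows tensor_mult_bilinear: "bilinear_map K (tensor_module K A B) (tensor_module K A B) (tensor_module K A B)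
        (\<otimes>\<^bsub>tensor_algebra K A B\<^esub>)"
    and tensor_mult_pure: "a \<in> carrier A \<Longrightarrow> a' \<in> carrier A \<Longrightarrow> b \<in> carrier B \<Longrightarrow> b' \<in> carrier B \<Longrightarrow>
      pure_tensor K A B a b \<otimes>\<^bsub>tensor_algebra K A B\<^esub> pure_tensor K A B a' b'
        = pure_tensor K A B (a \<otimes>\<^bsub>A\<^esub> a') (b \<otimes>\<^bsub>B\<^esub> b')"
proof -
  interpret AB: module_pair K A B using A(1) B(1) by (rule module_pairI)
  let ?M = "tensor_module K A B"
  note M = AB.tensor_module_module
  let ?f = "\<lambda>a b a' b'. pure_tensor K A B (a \<otimes>\<^bsub>A\<^esub> a') (b \<otimes>\<^bsub>B\<^esub> b')"
  have f1: "bilinear_map K A B ?M (?f a b)" if "a \<in> carrier A" "b \<in> carrier B" for a b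
    by (rule bilinear_map_precomp[OF AB.pure_bilinear bilinear_mapD(2)[OF A(2) that(1)] bilinear_mapD(2)[OF B(2) that(2)]])
  have f2: "bilinear_map K A B ?M (\<lambda>a b. ?f a b a' b')" if "a' \<in> carrier A" "b' \<in> carrier B" for a' b'
    by (rule bilinear_map_precomp[OF AB.pure_bilinear bilinear_mapD(1)[OF A(2) that(1)] bilinear_mapD(1)[OF B(2) that(2)]])
  have g: "bilinear_map K A B ?M (\<lambda>a b. tensor_lift K ?M (?f a b) T)" if T: "T \<in> carrier ?M" for T
  proof (rule bilinear_mapI)
    fix b assume b: "b \<in> carrier B"
    show "(\<lambda>a. tensor_lift K ?M (?f a b) T) \<in> module_hom K A ?M"
      by (rule AB.tensor_lift_param[OF M bilinear_mapD(1)[OF f2 b] A(1) f1[OF _ b] T])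
  next
    fix a assume a: "a \<in> carrier A"
    show "(\<lambda>b. tensor_lift K ?M (?f a b) T) \<in> module_hom K B ?M"
      by (rule AB.tensor_lift_param[OF M bilinear_mapD(2)[OF f2 a] B(1) f1[OF a] T])
  qed
  have mult: "S \<otimes>\<^bsub>tensor_algebra K A B\<^esub> T = tensor_lift K ?M (\<lambda>a b. tensor_lift K ?M (?f a b) T) S" for S T
    by (simp add: tensor_algebra_def)
  show "bilinear_map K ?M ?M ?M (\<otimes>\<^bsub>tensor_algebra K A B\<^esub>)"
  proof (rule bilinear_mapI)
    fix T assume "T \<in> carrier ?M"
    then show "(\<lambda>S. S \<otimes>\<^bsub>tensor_algebra K A B\<^esub> T) \<in> module_hom K ?M ?M"
      unfolding mult by (rule AB.tensor_lift_hom[OF M g])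
  next
    fix S assume S: "S \<in> carrier ?M"
    have "(\<lambda>T. S \<otimes>\<^bsub>tensor_algebra K A B\<^esub> T) \<in> module_hom K ?M ?M"
      unfolding mult by (rule AB.tensor_lift_param[OF M AB.tensor_lift_hom[OF M f1] M g S])
    then show "(\<otimes>\<^bsub>tensor_algebra K A B\<^esub>) S \<in> module_hom K ?M ?M" .
  qed
  assume "a \<in> carrier A" "a' \<in> carrier A" "b \<in> carrier B" "b' \<in> carrier B"
  then show "pure_tensor K A B a b \<otimes>\<^bsub>tensor_algebra K A B\<^esub> pure_tensor K A B a' b'
        = pure_tensor K A B (a \<otimes>\<^bsub>A\<^esub> a') (b \<otimes>\<^bsub>B\<^esub> b')"
    unfolding mult by (simp add: AB.tensor_lift_pure[OF M g] AB.tensor_lift_pure[OF M f1] AB.pure_closed)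
qed

section \<open>Coordinates of a finite-dimensional Hopf algebra\<close>

text \<open>The field type as a K-module along \<phi>, so that coordinate functionals are module
  homomorphisms and lift to tensor products.\<close>

definition scalar_module :: "('k \<Rightarrow> 'f::field) \<Rightarrow> ('k, 'f) module"
  where "scalar_module \<phi> = \<lparr>carrier = UNIV, monoid.mult = (*), one = 1, ring.zero = 0, add = (+), smult = (\<lambda>c x. \<phi> c * x)\<rparr>"

lemma scalar_module_sel [simp]:
  "carrier (scalar_module \<phi>) = UNIV" "\<zero>\<^bsub>scalar_module \<phi>\<^esub> = 0"
  "x \<oplus>\<^bsub>scalar_module \<phi>\<^esub> y = x + y" "c \<odot>\<^bsub>scalar_module \<phi>\<^esub> y = \<phi> c * y"
  by (simp_all add: scalar_module_def)

text \<open>\<phi> identifies the carrier of K with a field type, b is a basis, and \<xi> is its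
  dual basis with values in that type.\<close>

locale hopf_coords = hopf_algebra K H
  for K :: "('k, 'm) ring_scheme" and H :: "('k, 'h, 'q) hopf_algebra_scheme" (structure) +
  fixes \<phi> :: "'k \<Rightarrow> 'f::field" and b :: "'n::finite \<Rightarrow> 'h" and \<xi> :: "'n \<Rightarrow> 'h \<Rightarrow> 'f"
  assumes \<phi>_bij: "bij_betw \<phi> (carrier K) UNIV"
    and \<phi>_add: "\<lbrakk>x \<in> carrier K; y \<in> carrier K\<rbrakk> \<Longrightarrow> \<phi> (x \<oplus>\<^bsub>K\<^esub> y) = \<phi> x + \<phi> y"
    and \<phi>_mult: "\<lbrakk>x \<in> carrier K; y \<in> carrier K\<rbrakk> \<Longrightarrow> \<phi> (x \<otimes>\<^bsub>K\<^esub> y) = \<phi> x * \<phi> y"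
    and b_closed [simp]: "b i \<in> carrier H"
    and \<xi>_hom: "\<xi> i \<in> module_hom K H (scalar_module \<phi>)"
    and \<xi>_b: "\<xi> i (b j) = (if i = j then 1 else 0)"
    and decomp: "h \<in> carrier H \<Longrightarrow> h = (\<Oplus>i\<in>UNIV. inv_into (carrier K) \<phi> (\<xi> i h) \<odot> b i)"
begin

abbreviation "\<psi> \<equiv> inv_into (carrier K) \<phi>"
abbreviation "T \<equiv> tensor_module K H H"
abbreviation "F \<equiv> scalar_module \<phi>"

lemma \<psi>_closed [simp]: "\<psi> c \<in> carrier K"
  using \<phi>_bij by (metis UNIV_I bij_betw_imp_surj_on inv_into_into)

lemma \<phi>_\<psi> [simp]: "\<phi> (\<psi> c) = c"
  using \<phi>_bij by (metis UNIV_I bij_betw_inv_into_right)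

lemma \<psi>_\<phi> [simp]: "c \<in> carrier K \<Longrightarrow> \<psi> (\<phi> c) = c"
  using \<phi>_bij by (metis bij_betw_inv_into_left)

lemma \<phi>_eq_iff: "c \<in> carrier K \<Longrightarrow> d \<in> carrier K \<Longrightarrow> \<phi> c = \<phi> d \<longleftrightarrow> c = d"
  by (metis \<psi>_\<phi>)

lemma \<phi>_zero [simp]: "\<phi> \<zero>\<^bsub>K\<^esub> = 0"
  using \<phi>_add[OF R.zero_closed R.zero_closed] by (simp only: R.l_zero[OF R.zero_closed] add_cancel_right_right)

lemma \<phi>_one [simp]: "\<phi> \<one>\<^bsub>K\<^esub> = 1"
proof -
  have "\<phi> \<one>\<^bsub>K\<^esub> * \<phi> \<one>\<^bsub>K\<^esub> = \<phi> \<one>\<^bsub>K\<^esub>" using \<phi>_mult[of "\<one>\<^bsub>K\<^esub>" "\<one>\<^bsub>K\<^esub>"] by simp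
  moreover have "\<phi> \<one>\<^bsub>K\<^esub> \<noteq> 0" using \<phi>_eq_iff[of "\<one>\<^bsub>K\<^esub>" "\<zero>\<^bsub>K\<^esub>"] by simp
  ultimately show ?thesis by simp
qed

lemma \<psi>_add: "\<psi> (x + y) = \<psi> x \<oplus>\<^bsub>K\<^esub> \<psi> y"
  by (subst \<phi>_eq_iff[symmetric]) (simp_all add: \<phi>_add)

lemma \<psi>_mult: "\<psi> (x * y) = \<psi> x \<otimes>\<^bsub>K\<^esub> \<psi> y"
  by (subst \<phi>_eq_iff[symmetric]) (simp_all add: \<phi>_mult)

lemma H_module: "is_module K H" by (rule module_axioms)

lemma F_module: "is_module K F"
  by (rule LinearCombinations.module_criteria)
     (auto simp: R.is_cring \<phi>_add \<phi>_mult algebra_simps intro: exI[of _ "- _"])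

lemma finsum_F: "finite A \<Longrightarrow> (\<Oplus>\<^bsub>F\<^esub>a\<in>A. g a) = (\<Sum>a\<in>A. g a)"
proof (induction A rule: finite_induct)
  interpret F: Module.module K F by (rule F_module)
  {
    case empty show ?case by (simp add: F.finsum_empty)
  next
    case (insert a A) then show ?case by (subst F.finsum_insert) auto
  }
qed

interpretation HH: module_pair K H H by (rule module_pairI[OF H_module H_module])

lemma T_module: "is_module K T" by (rule HH.tensor_module_module)

lemma hom_expand:
  assumes M: "is_module K M" and f: "f \<in> module_hom K H M" and h: "h \<in> carrier H"
  shows "f h = (\<Oplus>\<^bsub>M\<^esub>i\<in>UNIV. \<psi> (\<xi> i h) \<odot>\<^bsub>M\<^esub> f (b i))"
proof -
  have "f h = f (\<Oplus>i\<in>UNIV. \<psi> (\<xi> i h) \<odot> b i)" using decomp[OF h] by simp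
  also have "\<dots> = (\<Oplus>\<^bsub>M\<^esub>i\<in>UNIV. f (\<psi> (\<xi> i h) \<odot> b i))"
    by (rule module_hom_finsum[OF H_module M f]) auto
  finally show ?thesis by (simp add: module_homD(3)[OF f])
qed

lemma functional_expand:
  assumes "f \<in> module_hom K H F" "h \<in> carrier H"
  shows "f h = (\<Sum>i\<in>UNIV. \<xi> i h * f (b i))"
  using hom_expand[OF F_module assms] by (simp add: finsum_F)

lemma functional_prod:
  assumes "f \<in> module_hom K A F" "g \<in> module_hom K B F"
  shows "bilinear_map K A B F (\<lambda>a b. f a * g b)"
  by (intro bilinear_mapI module_homI)
     (simp_all add: module_homD[OF assms(1)] module_homD[OF assms(2)] algebra_simps)

definition \<tau> where "\<tau> i j = tensor_lift K F (\<lambda>a b. \<xi> i a * \<xi> j b)"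

lemma \<tau>_hom: "\<tau> i j \<in> module_hom K T F"
  unfolding \<tau>_def by (rule HH.tensor_lift_hom[OF F_module functional_prod[OF \<xi>_hom \<xi>_hom]])

lemma \<tau>_pure: "x \<in> carrier H \<Longrightarrow> y \<in> carrier H \<Longrightarrow> \<tau> i j (pure_tensor K H H x y) = \<xi> i x * \<xi> j y"
  unfolding \<tau>_def by (rule HH.tensor_lift_pure[OF F_module functional_prod[OF \<xi>_hom \<xi>_hom]])

lemma scaled_functional: 
  assumes "is_module K M" "f \<in> module_hom K A F" "p \<in> carrier M"
  shows "(\<lambda>t. \<psi> (f t) \<odot>\<^bsub>M\<^esub> p) \<in> module_hom K A M"
proof -
  interpret M: Module.module K M by fact
  show ?thesis
    using assms(3) by (intro module_homI)
      (simp_all add: module_homD[OF assms(2)] \<psi>_add \<psi>_mult M.smult_l_distr M.smult_assoc1)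
qed

text \<open>Expanding each factor of a pure tensor in the basis proves the formula on pure tensors,
  which suffices for homomorphisms.\<close>

lemma tensor_hom_expand:
  assumes M: "is_module K M" and f: "f \<in> module_hom K T M" and t: "t \<in> carrier T"
  shows "f t = (\<Oplus>\<^bsub>M\<^esub>i\<in>UNIV. \<Oplus>\<^bsub>M\<^esub>j\<in>UNIV. \<psi> (\<tau> i j t) \<odot>\<^bsub>M\<^esub> f (pure_tensor K H H (b i) (b j)))"
proof (rule HH.tensor_hom_eqI[OF M f _ _ t])
  interpret M: Module.module K M by fact
  have p: "f (pure_tensor K H H x y) \<in> carrier M" if "x \<in> carrier H" "y \<in> carrier H" for x y
    by (rule module_homD(1)[OF f HH.pure_closed[OF that]])
  show "(\<lambda>t. \<Oplus>\<^bsub>M\<^esub>i\<in>UNIV. \<Oplus>\<^bsub>M\<^esub>j\<in>UNIV. \<psi> (\<tau> i j t) \<odot>\<^bsub>M\<^esub> f (pure_tensor K H H (b i) (b j))) \<in> module_hom K T M"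
    by (intro module_hom_finsum_pointwise[OF M] scaled_functional[OF M \<tau>_hom] p) simp_all
  note bil = bilinear_map_comp[OF HH.pure_bilinear f]
  fix x y assume x: "x \<in> carrier H" and y: "y \<in> carrier H"
  have "f (pure_tensor K H H x y) = (\<Oplus>\<^bsub>M\<^esub>i\<in>UNIV. \<psi> (\<xi> i x) \<odot>\<^bsub>M\<^esub> f (pure_tensor K H H (b i) y))"
    by (rule hom_expand[OF M bilinear_mapD(1)[OF bil y] x])
  also have "\<dots> = (\<Oplus>\<^bsub>M\<^esub>i\<in>UNIV. \<Oplus>\<^bsub>M\<^esub>j\<in>UNIV. \<psi> (\<tau> i j (pure_tensor K H H x y)) \<odot>\<^bsub>M\<^esub> f (pure_tensor K H H (b i) (b j)))"
  proof (intro M.finsum_cong')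
    fix i
    have "\<psi> (\<xi> i x) \<odot>\<^bsub>M\<^esub> f (pure_tensor K H H (b i) y)
      = \<psi> (\<xi> i x) \<odot>\<^bsub>M\<^esub> (\<Oplus>\<^bsub>M\<^esub>j\<in>UNIV. \<psi> (\<xi> j y) \<odot>\<^bsub>M\<^esub> f (pure_tensor K H H (b i) (b j)))"
      by (subst hom_expand[OF M bilinear_mapD(2)[OF bil b_closed] y]) simp
    also have "\<dots> = (\<Oplus>\<^bsub>M\<^esub>j\<in>UNIV. \<psi> (\<xi> i x) \<odot>\<^bsub>M\<^esub> (\<psi> (\<xi> j y) \<odot>\<^bsub>M\<^esub> f (pure_tensor K H H (b i) (b j))))"
      by (rule M.finsum_smult_ldistr) (auto intro!: p)
    also have "\<dots> = (\<Oplus>\<^bsub>M\<^esub>j\<in>UNIV. \<psi> (\<tau> i j (pure_tensor K H H x y)) \<odot>\<^bsub>M\<^esub> f (pure_tensor K H H (b i) (b j)))"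
      using x y by (intro M.finsum_cong') (auto simp: \<tau>_pure \<psi>_mult M.smult_assoc1 p intro!: M.smult_closed)
    finally show "\<psi> (\<xi> i x) \<odot>\<^bsub>M\<^esub> f (pure_tensor K H H (b i) y)
      = (\<Oplus>\<^bsub>M\<^esub>j\<in>UNIV. \<psi> (\<tau> i j (pure_tensor K H H x y)) \<odot>\<^bsub>M\<^esub> f (pure_tensor K H H (b i) (b j)))" .
  qed (auto intro!: M.finsum_closed M.smult_closed p)
  finally show "f (pure_tensor K H H x y) = (\<Oplus>\<^bsub>M\<^esub>i\<in>UNIV. \<Oplus>\<^bsub>M\<^esub>j\<in>UNIV.
      \<psi> (\<tau> i j (pure_tensor K H H x y)) \<odot>\<^bsub>M\<^esub> f (pure_tensor K H H (b i) (b j)))" .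
qed

lemma tensor_functional_expand:
  assumes "f \<in> module_hom K T F" "t \<in> carrier T"
  shows "f t = (\<Sum>i\<in>UNIV. \<Sum>j\<in>UNIV. \<tau> i j t * f (pure_tensor K H H (b i) (b j)))"
  using tensor_hom_expand[OF F_module assms] by (simp add: finsum_F)

text \<open>The expansion of the identity map shows that the functionals \<tau> separate
  tensors.\<close>

lemma tensor_eqI:
  assumes "t \<in> carrier T" "t' \<in> carrier T" "\<And>i j. \<tau> i j t = \<tau> i j t'"
  shows "t = t'"
  using tensor_hom_expand[OF T_module module_hom_id assms(1)] tensor_hom_expand[OF T_module module_hom_id assms(2)]
  by (simp add: assms(3))

lemma mult_bilinear: "bilinear_map K H H H (\<otimes>)"
  by (intro bilinear_mapI module_homI) (auto simp: smult_mult_left smult_mult_right A.l_distr A.r_distr)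

lemma comult_hom: "comult H \<in> module_hom K H T"
  using comult_linear by (simp add: module_hom_tensor_algebra)

lemma comult_closed: "h \<in> carrier H \<Longrightarrow> comult H h \<in> carrier T"
  by (rule module_homD(1)[OF comult_hom])

lemma counit_closed: "h \<in> carrier H \<Longrightarrow> counit H h \<in> carrier K"
  using counit_ring_hom by (auto simp: ring_hom_def)

lemma counit_functional: "(\<lambda>h. \<phi> (counit H h)) \<in> module_hom K H F"
  using counit_ring_hom counit_linear
  by (intro module_homI) (auto simp: ring_hom_def \<phi>_add \<phi>_mult counit_closed)

lemma counit_hom_smult:
  "bilinear_map K H H H (\<lambda>a b. counit H a \<odot> b)"
  "bilinear_map K H H H (\<lambda>a b. counit H b \<odot> a)"
  using counit_ring_hom counit_linear
  by (intro bilinear_mapI module_homI;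
      auto simp: ring_hom_def counit_closed smult_l_distr smult_r_distr smult_assoc1[symmetric] m_comm)+

section \<open>Extraction of the structure constants\<close>

definition "mc i j k = \<xi> k (b i \<otimes> b j)"
definition "dc k i j = \<tau> i j (comult H (b k))"
definition "uc = (\<chi> i. \<xi> i \<one>)"
definition "ec = (\<chi> i. \<phi> (counit H (b i)))"
definition "sc i j = \<xi> j (antipode H (b i))"

lemma antipode_closed: "h \<in> carrier H \<Longrightarrow> antipode H h \<in> carrier H"
  by (rule module_homD(1)[OF antipode_linear])

lemma \<xi>_mult: 
  assumes "x \<in> carrier H" "y \<in> carrier H"
  shows "\<xi> k (x \<otimes> y) = (\<Sum>i\<in>UNIV. \<xi> i x * \<xi> k (b i \<otimes> y))" "\<xi> k (x \<otimes> y) = (\<Sum>j\<in>UNIV. \<xi> j y * \<xi> k (x \<otimes> b j))"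
  using functional_expand[OF module_hom_comp[OF bilinear_mapD(1)[OF mult_bilinear assms(2)] \<xi>_hom] assms(1)]
    functional_expand[OF module_hom_comp[OF bilinear_mapD(2)[OF mult_bilinear assms(1)] \<xi>_hom] assms(2)]
  by auto

text \<open>The functional G, which is \<xi>_a \<otimes> (\<xi>_b' \<otimes> \<xi>_c), is applied to
  both sides of \<open>coassoc\<close>; \<open>tensor_assoc\<close> is evaluated on pure tensors
  only.\<close>

lemma coassoc_coords: "(\<Sum>x\<in>UNIV. dc k x c * dc x a b') = (\<Sum>x\<in>UNIV. dc k a x * dc x b' c)"
proof -
  interpret HT: module_pair K H T by (rule module_pairI[OF H_module T_module])
  interpret TH: module_pair K T H by (rule module_pairI[OF T_module H_module])
  let ?M = "tensor_module K H T"
  define G where "G = tensor_lift K F (\<lambda>x t. \<xi> a x * \<tau> b' c t)"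
  have Gh: "G \<in> module_hom K ?M F"
    unfolding G_def by (rule HT.tensor_lift_hom[OF F_module functional_prod[OF \<xi>_hom \<tau>_hom]])
  have Gp: "G (pure_tensor K H T x t) = \<xi> a x * \<tau> b' c t" if "x \<in> carrier H" "t \<in> carrier T" for x t
    unfolding G_def by (rule HT.tensor_lift_pure[OF F_module functional_prod[OF \<xi>_hom \<tau>_hom] that])
  note tm1 = tensor_map_hom[OF T_module H_module H_module H_module comult_hom module_hom_id]
    and tp1 = tensor_map_pure[OF T_module H_module H_module H_module comult_hom module_hom_id]
  note tm2 = tensor_map_hom[OF H_module T_module H_module H_module module_hom_id comult_hom]
    and tp2 = tensor_map_pure[OF H_module T_module H_module H_module module_hom_id comult_hom]
  note as = tensor_assoc_hom[OF H_module H_module H_module]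
    and ap = tensor_assoc_pure[OF H_module H_module H_module]
  have "(\<Sum>x\<in>UNIV. \<Sum>y\<in>UNIV. dc k x y * G (tensor_assoc K H H H (pure_tensor K T H (comult H (b x)) (b y))))
     = G (tensor_assoc K H H H (tensor_map K T H (comult H) (\<lambda>x. x) (comult H (b k))))"
    using tensor_functional_expand[OF module_hom_comp[OF module_hom_comp[OF tm1 as] Gh] comult_closed[OF b_closed], of k]
    by (simp add: tp1 dc_def)
  also have "\<dots> = G (tensor_map K H T (\<lambda>x. x) (comult H) (comult H (b k)))"
    by (simp add: coassoc)
  also have "\<dots> = (\<Sum>x\<in>UNIV. \<Sum>y\<in>UNIV. dc k x y * G (pure_tensor K H T (b x) (comult H (b y))))"
    using tensor_functional_expand[OF module_hom_comp[OF tm2 Gh] comult_closed[OF b_closed], of k]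
    by (simp add: tp2 dc_def)
  also have "\<dots> = (\<Sum>x\<in>UNIV. \<Sum>y\<in>UNIV. if x = a then dc k a y * dc y b' c else 0)"
    by (intro sum.cong refl) (auto simp: Gp comult_closed \<xi>_b dc_def)
  also have "\<dots> = (\<Sum>y\<in>UNIV. dc k a y * dc y b' c)"
    by (subst sum.swap) simp
  finally have 1: "(\<Sum>x\<in>UNIV. \<Sum>y\<in>UNIV. dc k x y * G (tensor_assoc K H H H (pure_tensor K T H (comult H (b x)) (b y))))
    = (\<Sum>y\<in>UNIV. dc k a y * dc y b' c)" .
  have 2: "G (tensor_assoc K H H H (pure_tensor K T H (comult H (b x)) (b y))) = (if y = c then dc x a b' else 0)" for x y
  proof -
    have "G (tensor_assoc K H H H (pure_tensor K T H (comult H (b x)) (b y)))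
      = (\<Sum>p\<in>UNIV. \<Sum>q\<in>UNIV. dc x p q * (\<xi> a (b p) * (\<xi> b' (b q) * \<xi> c (b y))))"
      using tensor_functional_expand[OF module_hom_comp[OF module_hom_comp[OF bilinear_mapD(1)[OF TH.pure_bilinear b_closed] as] Gh] comult_closed[OF b_closed], of x y]
      by (simp add: ap Gp HH.pure_closed \<tau>_pure dc_def)
    also have "\<dots> = (\<Sum>p\<in>UNIV. \<Sum>q\<in>UNIV. if p = a then (if q = b' then (if y = c then dc x a b' else 0) else 0) else 0)"
      by (intro sum.cong refl) (auto simp: \<xi>_b)
    also have "\<dots> = (\<Sum>q\<in>UNIV. if q = b' then (if y = c then dc x a b' else 0) else 0)"
      by (subst sum.swap) simp
    finally show ?thesis by simp
  qed
  show ?thesis using 1 by (simp add: 2 if_distrib[of "\<lambda>z. _ * z"] cong: if_cong)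
qed

lemma tensor_lift_coords:
  assumes f: "bilinear_map K H H H f"
  shows "\<xi> l (tensor_lift K H f (comult H (b k))) = (\<Sum>x\<in>UNIV. \<Sum>y\<in>UNIV. dc k x y * \<xi> l (f (b x) (b y)))"
  using tensor_functional_expand[OF module_hom_comp[OF HH.tensor_lift_hom[OF H_module f] \<xi>_hom] comult_closed[OF b_closed], of l k]
  by (simp add: HH.tensor_lift_pure[OF H_module f] dc_def)

lemma \<tau>_comult: "x \<in> carrier H \<Longrightarrow> \<tau> i j (comult H x) = (\<Sum>k\<in>UNIV. \<xi> k x * dc k i j)"
  using functional_expand[OF module_hom_comp[OF comult_hom \<tau>_hom]] by (simp add: dc_def)

lemma comult_one: "comult H \<one> = pure_tensor K H H \<one> \<one>"
  and comult_mult: "x \<in> carrier H \<Longrightarrow> y \<in> carrier H \<Longrightarrow>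
    comult H (x \<otimes> y) = comult H x \<otimes>\<^bsub>tensor_algebra K H H\<^esub> comult H y"
  using comult_ring_hom by (auto simp: ring_hom_def)

lemma counit_one: "counit H \<one> = \<one>\<^bsub>K\<^esub>"
  and counit_mult: "x \<in> carrier H \<Longrightarrow> y \<in> carrier H \<Longrightarrow> counit H (x \<otimes> y) = counit H x \<otimes>\<^bsub>K\<^esub> counit H y"
  using counit_ring_hom by (auto simp: ring_hom_def)

lemma bialg_coords: "(\<Sum>k\<in>UNIV. mc i j k * dc k a c) =
      (\<Sum>i1\<in>UNIV. \<Sum>i2\<in>UNIV. \<Sum>j1\<in>UNIV. \<Sum>j2\<in>UNIV. dc i i1 i2 * dc j j1 j2 * mc i1 j1 a * mc i2 j2 c)"
proof -
  note tb = tensor_mult_bilinear[OF H_module mult_bilinear H_module mult_bilinear]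
    and tp = tensor_mult_pure[OF H_module mult_bilinear H_module mult_bilinear]
  have "(\<Sum>k\<in>UNIV. mc i j k * dc k a c) = \<tau> a c (comult H (b i) \<otimes>\<^bsub>tensor_algebra K H H\<^esub> comult H (b j))"
    by (simp add: comult_mult[symmetric] \<tau>_comult mc_def)
  also have "\<dots> = (\<Sum>i1\<in>UNIV. \<Sum>i2\<in>UNIV. dc i i1 i2 *
      \<tau> a c (pure_tensor K H H (b i1) (b i2) \<otimes>\<^bsub>tensor_algebra K H H\<^esub> comult H (b j)))"
    using tensor_functional_expand[OF module_hom_comp[OF bilinear_mapD(1)[OF tb comult_closed[OF b_closed]] \<tau>_hom] comult_closed[OF b_closed], of a c i j]
    by (simp add: dc_def)
  also have "\<dots> = (\<Sum>i1\<in>UNIV. \<Sum>i2\<in>UNIV. dc i i1 i2 * (\<Sum>j1\<in>UNIV. \<Sum>j2\<in>UNIV. dc j j1 j2 * (mc i1 j1 a * mc i2 j2 c)))"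
  proof -
    have "\<tau> a c (pure_tensor K H H (b i1) (b i2) \<otimes>\<^bsub>tensor_algebra K H H\<^esub> comult H (b j))
      = (\<Sum>j1\<in>UNIV. \<Sum>j2\<in>UNIV. dc j j1 j2 * (mc i1 j1 a * mc i2 j2 c))" for i1 i2
      using tensor_functional_expand[OF module_hom_comp[OF bilinear_mapD(2)[OF tb HH.pure_closed[OF b_closed b_closed]] \<tau>_hom] comult_closed[OF b_closed], of a c i1 i2 j]
      by (simp add: dc_def tp \<tau>_pure mc_def)
    then show ?thesis by simp
  qed
  finally show ?thesis by (simp add: sum_distrib_left mult.assoc)
qed

lemma hopf_constants_coords: "hopf_constants mc dc uc ec sc"
proof (unfold_locales, goal_cases)
  case (1 i j k l)
  show ?case
    using \<xi>_mult(1)[of "b i \<otimes> b j" "b k" l] \<xi>_mult(2)[of "b i" "b j \<otimes> b k" l]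
    by (simp add: mc_def A.m_assoc)
next
  case (2 i j)
  show ?case using \<xi>_mult(1)[of \<one> "b i" j] by (auto simp: mc_def uc_def \<xi>_b)
next
  case (3 i j)
  show ?case using \<xi>_mult(2)[of "b i" \<one> j] by (auto simp: mc_def uc_def \<xi>_b)
next
  case (4 k a c d) show ?case by (rule coassoc_coords)
next
  case (5 k j)
  have "(\<Sum>x\<in>UNIV. \<Sum>y\<in>UNIV. dc k x y * \<xi> j (counit H (b x) \<odot> b y)) = \<xi> j (b k)"
    using tensor_lift_coords[OF counit_hom_smult(1), of j k] by (simp add: counit_left)
  then show ?case
    by (simp add: module_homD(3)[OF \<xi>_hom] counit_closed \<xi>_b ec_def if_distrib[of "\<lambda>z. _ * z"] mult.commute eq_commute cong: if_cong)
next
  case (6 k j)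
  have "(\<Sum>x\<in>UNIV. \<Sum>y\<in>UNIV. dc k x y * \<xi> j (counit H (b y) \<odot> b x)) = \<xi> j (b k)"
    using tensor_lift_coords[OF counit_hom_smult(2), of j k] by (simp add: counit_right)
  then have "(\<Sum>y\<in>UNIV. \<Sum>x\<in>UNIV. dc k x y * \<xi> j (counit H (b y) \<odot> b x)) = \<xi> j (b k)"
    by (subst sum.swap)
  then show ?case
    by (simp add: module_homD(3)[OF \<xi>_hom] counit_closed \<xi>_b ec_def if_distrib[of "\<lambda>z. _ * z"] mult.commute eq_commute cong: if_cong)
next
  case (7 i j a c) show ?case by (rule bialg_coords)
next
  case (8 a c)
  show ?case using \<tau>_comult[of \<one> a c] by (simp add: comult_one \<tau>_pure uc_def)
next
  case (9 i j)
  have "(\<Sum>k\<in>UNIV. ec $ k * mc i j k) = \<phi> (counit H (b i \<otimes> b j))"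
    by (subst functional_expand[OF counit_functional]) (simp_all add: ec_def mc_def mult.commute)
  then show ?case by (simp add: counit_mult counit_closed \<phi>_mult ec_def)
next
  case 10
  have "(\<Sum>k\<in>UNIV. ec $ k * uc $ k) = \<phi> (counit H \<one>)"
    by (subst functional_expand[OF counit_functional]) (simp_all add: ec_def uc_def mult.commute)
  then show ?case by (simp add: counit_one)
next
  case (11 k l)
  have "bilinear_map K H H H (\<lambda>a b. antipode H a \<otimes> b)"
    by (rule bilinear_map_precomp[OF mult_bilinear antipode_linear module_hom_id])
  from tensor_lift_coords[OF this, of l k]
  have "(\<Sum>x\<in>UNIV. \<Sum>y\<in>UNIV. dc k x y * \<xi> l (antipode H (b x) \<otimes> b y)) = \<xi> l (counit H (b k) \<odot> \<one>)"
    by (simp add: antipode_left)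
  then show ?case
    by (simp add: module_homD(3)[OF \<xi>_hom] counit_closed \<xi>_mult(1)[of "antipode H _"] antipode_closed
        sc_def mc_def ec_def uc_def sum_distrib_left mult.assoc)
next
  case (12 k l)
  have "bilinear_map K H H H (\<lambda>a b. a \<otimes> antipode H b)"
    by (rule bilinear_map_precomp[OF mult_bilinear module_hom_id antipode_linear])
  from tensor_lift_coords[OF this, of l k]
  have "(\<Sum>x\<in>UNIV. \<Sum>y\<in>UNIV. dc k x y * \<xi> l (b x \<otimes> antipode H (b y))) = \<xi> l (counit H (b k) \<odot> \<one>)"
    by (simp add: antipode_right)
  then show ?case
    by (simp add: module_homD(3)[OF \<xi>_hom] counit_closed \<xi>_mult(2)[of _ "antipode H _"] antipode_closed
        sc_def mc_def ec_def uc_def sum_distrib_left mult.assoc)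
qed

definition co where "co h = (\<chi> i. \<xi> i h)"

lemma co_add: "x \<in> carrier H \<Longrightarrow> y \<in> carrier H \<Longrightarrow> co (x \<oplus> y) = co x + co y"
  and co_smult: "c \<in> carrier K \<Longrightarrow> x \<in> carrier H \<Longrightarrow> co (c \<odot> x) = \<phi> c *s co x"
  by (simp_all add: co_def vec_eq_iff module_homD[OF \<xi>_hom])

lemma co_inj: "x \<in> carrier H \<Longrightarrow> y \<in> carrier H \<Longrightarrow> co x = co y \<Longrightarrow> x = y"
  using decomp[of x] decomp[of y] by (simp add: co_def vec_eq_iff)

lemma co_surj: "\<exists>x\<in>carrier H. co x = v"
proof -
  let ?x = "\<Oplus>i\<in>UNIV. \<psi> (v $ i) \<odot> b i"
  have x: "?x \<in> carrier H" by (intro M.finsum_closed) auto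
  have "\<xi> k ?x = v $ k" for k
  proof -
    have "\<xi> k ?x = (\<Oplus>\<^bsub>F\<^esub>i\<in>UNIV. \<xi> k (\<psi> (v $ i) \<odot> b i))"
      by (rule module_hom_finsum[OF H_module F_module \<xi>_hom]) auto
    then show ?thesis
      by (simp add: finsum_F module_homD(3)[OF \<xi>_hom] \<xi>_b if_distrib[of "\<lambda>z. _ * z"] cong: if_cong)
  qed
  then show ?thesis using x by (intro bexI[of _ ?x]) (auto simp: co_def vec_eq_iff)
qed

lemma co_one: "co \<one> = uc" by (simp add: co_def uc_def)

lemma co_mult: "x \<in> carrier H \<Longrightarrow> y \<in> carrier H \<Longrightarrow> co (x \<otimes> y) = mulv mc (co x) (co y)"
  by (simp add: co_def mulv_def vec_eq_iff \<xi>_mult(1)[of x y] \<xi>_mult(2)[of "b _" y] mc_def sum_distrib_left mult.assoc)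

lemma co_antipode: "x \<in> carrier H \<Longrightarrow> co (antipode H x) = applyv sc (co x)"
  using functional_expand[OF module_hom_comp[OF antipode_linear \<xi>_hom]]
  by (simp add: co_def applyv_def vec_eq_iff sc_def)

lemma co_counit: "x \<in> carrier H \<Longrightarrow> \<phi> (counit H x) = pr ec (co x)"
  by (subst functional_expand[OF counit_functional]) (simp_all add: co_def pr_def ec_def mult.commute)

lemma co_comult: "x \<in> carrier H \<Longrightarrow>
    \<tau> i j (comult H x) = pr (mulv (\<lambda>i j k. dc k i j) (axis i 1) (axis j 1)) (co x)"
  by (simp add: \<tau>_comult mulv_axis pr_def co_def mult.commute)

end

section \<open>Isomorphisms with the model Hopf algebras\<close>

lemma fam_dual:
  fixes b :: "nat \<Rightarrow> 'a::field^'n::finite"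
  assumes "fam_indep b CARD('n)"
  shows "\<exists>f. (\<forall>i<CARD('n). \<forall>j<CARD('n). pr (f i) (b j) = (if i = j then 1 else 0))
    \<and> (\<forall>a. a = (\<Sum>i<CARD('n). pr (f i) a *s b i))"
proof -
  have "\<exists>f. \<forall>j<CARD('n). pr f (b j) = (if i = j then 1 else 0)" for i by (rule fam_functional[OF assms])
  then obtain f where f: "\<And>i j. j < CARD('n) \<Longrightarrow> pr (f i) (b j) = (if i = j then 1 else 0)" by metis
  have "a = (\<Sum>i<CARD('n). pr (f i) a *s b i)" for a
  proof -
    obtain c where c: "a = (\<Sum>i<CARD('n). c i *s b i)" using fam_span[OF assms] by blast
    have "pr (f i) a = c i" if "i < CARD('n)" for i
      using that by (simp add: c pr_sum_r pr_scale_r f if_distrib[of "\<lambda>z. _ * z"] cong: if_cong)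
    then show ?thesis by (subst c) simp
  qed
  then show ?thesis using f by blast
qed

lemma is_module_cong:
  assumes "is_module K M" "carrier M' = carrier M" "\<zero>\<^bsub>M'\<^esub> = \<zero>\<^bsub>M\<^esub>"
    "\<And>x y. x \<oplus>\<^bsub>M'\<^esub> y = x \<oplus>\<^bsub>M\<^esub> y" "\<And>c x. c \<odot>\<^bsub>M'\<^esub> x = c \<odot>\<^bsub>M\<^esub> x"
  shows "is_module K M'"
proof -
  interpret M: Module.module K M by fact
  show ?thesis
    by (rule LinearCombinations.module_criteria)
       (auto simp: assms(2-5) M.R.is_cring M.M.a_ac M.smult_assoc1 M.smult_l_distr M.smult_r_distr
         intro: bexI[of _ "\<ominus>\<^bsub>M\<^esub> _"] M.M.r_neg)
qed

text \<open>Tensor products see only the module operations. This reconciles the two records of a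
  model: its comultiplication is built over the plain algebra, whereas \<open>hopf_iso\<close>
  refers to the Hopf algebra.\<close>

lemma tensor_module_cong:
  assumes "carrier A' = carrier A" "\<And>x y. x \<oplus>\<^bsub>A'\<^esub> y = x \<oplus>\<^bsub>A\<^esub> y" "\<And>c x. c \<odot>\<^bsub>A'\<^esub> x = c \<odot>\<^bsub>A\<^esub> x"
    "carrier B' = carrier B" "\<And>x y. x \<oplus>\<^bsub>B'\<^esub> y = x \<oplus>\<^bsub>B\<^esub> y" "\<And>c x. c \<odot>\<^bsub>B'\<^esub> x = c \<odot>\<^bsub>B\<^esub> x"
  shows "tensor_module K A' B' = tensor_module K A B" "pure_tensor K A' B' = pure_tensor K A B"
proof -
  have "tensor_null K A' B' = tensor_null K A B"
    unfolding tensor_null_def tensor_relations_def Let_def by (simp only: assms)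
  then show "tensor_module K A' B' = tensor_module K A B" "pure_tensor K A' B' = pure_tensor K A B"
    by (simp_all add: tensor_module_def pure_tensor_def assms fun_eq_iff)
qed

section \<open>From coordinate vectors back to elements of H\<close>

context hopf_coords begin

interpretation HC: hopf_constants mc dc uc ec sc by (rule hopf_constants_coords)

lemma co_pow: "x \<in> carrier H \<Longrightarrow> co (x [^] (i::nat)) = HC.pw (co x) i"
  by (induction i) (simp_all add: co_one co_mult HC.pw_Suc)

lemma co_uminus: "x \<in> carrier H \<Longrightarrow> co (\<ominus> x) = - co x"
proof -
  assume x: "x \<in> carrier H"
  have "co \<zero> = 0" using co_add[of \<zero> \<zero>] by simp
  then have "co x + co (\<ominus> x) = 0" using x by (simp add: co_add[symmetric] M.r_neg)
  then show ?thesis by (simp add: eq_neg_iff_add_eq_0 add.commute)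
qed

lemma co_zero: "co \<zero> = 0"
  using co_add[of \<zero> \<zero>] by simp

lemma co_finsum: "finite A \<Longrightarrow> g \<in> A \<rightarrow> carrier H \<Longrightarrow> co (\<Oplus>a\<in>A. g a) = (\<Sum>a\<in>A. co (g a))"
proof (induction A rule: finite_induct)
  case empty show ?case by (simp add: co_zero M.finsum_empty)
next
  case (insert a A)
  then show ?case by (subst M.finsum_insert) (auto simp: co_add)
qed

text \<open>The dual family of the powers, composed with \<open>co\<close>; as dim H powers are
  independent, they form a basis.\<close>

lemma power_coords:
  assumes x: "x \<in> carrier H" and ind: "fam_indep (HC.pw (co x)) CARD('n)"
  shows "\<exists>\<gamma>. (\<forall>i. \<gamma> i \<in> module_hom K H F)
    \<and> (\<forall>i<CARD('n). \<forall>j<CARD('n). \<gamma> i (x [^] j) = (if i = j then 1 else 0))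
    \<and> (\<forall>h\<in>carrier H. h = (\<Oplus>i\<in>{..<CARD('n)}. \<psi> (\<gamma> i h) \<odot> x [^] i))"
proof -
  obtain f where f: "\<forall>i<CARD('n). \<forall>j<CARD('n). pr (f i) (HC.pw (co x) j) = (if i = j then 1 else 0)"
    "\<And>a. a = (\<Sum>i<CARD('n). pr (f i) a *s HC.pw (co x) i)"
    using fam_dual[OF ind] by blast
  define \<gamma> where "\<gamma> i h = pr (f i) (co h)" for i h
  have hom: "\<gamma> i \<in> module_hom K H F" for i
    by (rule module_homI) (simp_all add: \<gamma>_def co_add co_smult pr_add_r pr_scale_r)
  have "h = (\<Oplus>i\<in>{..<CARD('n)}. \<psi> (\<gamma> i h) \<odot> x [^] i)" if h: "h \<in> carrier H" for h
  proof (rule co_inj[OF h])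
    show "(\<Oplus>i\<in>{..<CARD('n)}. \<psi> (\<gamma> i h) \<odot> x [^] i) \<in> carrier H" using x by (intro M.finsum_closed) auto
    have "co (\<Oplus>i\<in>{..<CARD('n)}. \<psi> (\<gamma> i h) \<odot> x [^] i) = (\<Sum>i<CARD('n). \<gamma> i h *s HC.pw (co x) i)"
      using x by (subst co_finsum) (auto simp: co_smult co_pow)
    then show "co h = co (\<Oplus>i\<in>{..<CARD('n)}. \<psi> (\<gamma> i h) \<odot> x [^] i)"
      using f(2)[of "co h"] by (simp add: \<gamma>_def)
  qed
  then show ?thesis using hom f(1) x by (intro exI[of _ \<gamma>]) (auto simp: \<gamma>_def co_pow)
qed

lemma glike_record:
  assumes x: "x \<in> carrier H" and g: "HC.glike (co x)"
  shows "comult H x = pure_tensor K H H x x" "counit H x = \<one>\<^bsub>K\<^esub>"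
proof -
  interpret HH: module_pair K H H by (rule module_pairI[OF H_module H_module])
  show "comult H x = pure_tensor K H H x x"
  proof (rule tensor_eqI)
    fix i j
    have "\<tau> i j (comult H x) = co x $ i * co x $ j"
      using g x by (simp add: co_comult HC.glike_def)
    then show "\<tau> i j (comult H x) = \<tau> i j (pure_tensor K H H x x)" using x by (simp add: \<tau>_pure co_def)
  qed (auto simp: x comult_closed HH.pure_closed)
  have "\<phi> (counit H x) = \<phi> \<one>\<^bsub>K\<^esub>" using g x by (simp add: co_counit HC.glike_def)
  then show "counit H x = \<one>\<^bsub>K\<^esub>" using x by (subst (asm) \<phi>_eq_iff) (auto simp: counit_closed)
qed

lemma primitive_record:
  assumes x: "x \<in> carrier H" and g: "HC.primitive (co x)"
  shows "comult H x = pure_tensor K H H x \<one> \<oplus>\<^bsub>T\<^esub> pure_tensor K H H \<one> x" "counit H x = \<zero>\<^bsub>K\<^esub>"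
proof -
  interpret HH: module_pair K H H by (rule module_pairI[OF H_module H_module])
  interpret T: Module.module K T by (rule T_module)
  show "comult H x = pure_tensor K H H x \<one> \<oplus>\<^bsub>T\<^esub> pure_tensor K H H \<one> x"
  proof (rule tensor_eqI)
    fix i j
    have "\<tau> i j (comult H x) = co x $ i * uc $ j + uc $ i * co x $ j"
      using g x by (simp add: co_comult HC.primitive_def)
    then show "\<tau> i j (comult H x) = \<tau> i j (pure_tensor K H H x \<one> \<oplus>\<^bsub>T\<^esub> pure_tensor K H H \<one> x)"
      using x by (simp add: module_homD(2)[OF \<tau>_hom] HH.pure_closed \<tau>_pure co_def uc_def)
  qed (auto simp: x comult_closed HH.pure_closed)
  have "\<phi> (counit H x) = \<phi> \<zero>\<^bsub>K\<^esub>" using HC.primitive_eps[OF g] x by (simp add: co_counit)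
  then show "counit H x = \<zero>\<^bsub>K\<^esub>" using x by (subst (asm) \<phi>_eq_iff) (auto simp: counit_closed)
qed

lemma group_gen_record:
  assumes x: "x \<in> carrier H" and g: "HC.group_gen (co x)"
  shows "x [^] CARD('n) = \<one>" and "i \<le> CARD('n) \<Longrightarrow> antipode H (x [^] i) = x [^] (CARD('n) - i)"
proof -
  have gl: "HC.glike (co x)" and gn: "HC.pw (co x) CARD('n) = uc" using g by (simp_all add: HC.group_gen_def)
  show "x [^] CARD('n) = \<one>" using x by (intro co_inj) (simp_all add: co_pow gn co_one)
  assume i: "i \<le> CARD('n)"
  \<comment> \<open>S(g^i) is multiplied by g^i g^(p-i) = 1, after which S(g^i) g^i cancels.\<close>
  have "applyv sc (HC.pw (co x) i) = mulv mc (applyv sc (HC.pw (co x) i)) (mulv mc (HC.pw (co x) i) (HC.pw (co x) (CARD('n) - i)))"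
    using i by (simp add: HC.pw_add[symmetric] gn)
  also have "\<dots> = HC.pw (co x) (CARD('n) - i)"
    by (simp add: HC.mul_assoc[symmetric] HC.glike_antipode[OF HC.glike_pw[OF gl]])
  finally show "antipode H (x [^] i) = x [^] (CARD('n) - i)"
    using x by (intro co_inj) (simp_all add: co_pow co_antipode antipode_closed)
qed

lemma prim_gen_record:
  assumes x: "x \<in> carrier H" and g: "HC.prim_gen (co x)"
  shows "x [^] CARD('n) = \<zero> \<or> x [^] CARD('n) = x" and "antipode H (x [^] i) = (\<ominus> x) [^] (i::nat)"
proof -
  have "HC.pw (co x) CARD('n) = 0 \<or> HC.pw (co x) CARD('n) = co x" and p: "HC.primitive (co x)"
    using g by (simp_all add: HC.prim_gen_def)
  then show "x [^] CARD('n) = \<zero> \<or> x [^] CARD('n) = x"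
    using x co_inj[of "x [^] CARD('n)" \<zero>] co_inj[of "x [^] CARD('n)" x] by (auto simp: co_pow co_zero)
  show "antipode H (x [^] i) = (\<ominus> x) [^] i"
    using x by (intro co_inj)
      (simp_all add: co_pow co_antipode antipode_closed HC.antipode_pw HC.primitive_antipode[OF p] co_uminus)
qed

end

text \<open>The powers 1, x, ..., x^(N-1) form a basis with dual functionals \<gamma>, so linear
  identities need checking on these powers only.\<close>

locale power_basis = hopf_coords K H \<phi> b \<xi>
  for K :: "('k, 'm) ring_scheme" and H :: "('k, 'h, 'q) hopf_algebra_scheme" (structure)
    and \<phi> :: "'k \<Rightarrow> 'f::field" and b :: "'n::finite \<Rightarrow> 'h" and \<xi> :: "'n \<Rightarrow> 'h \<Rightarrow> 'f" +
  fixes x :: 'h and \<gamma> :: "nat \<Rightarrow> 'h \<Rightarrow> 'f" and N :: nat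
  assumes x_closed [simp]: "x \<in> carrier H" and \<gamma>_hom: "\<gamma> i \<in> module_hom K H (scalar_module \<phi>)"
    and \<gamma>_pow: "i < N \<Longrightarrow> j < N \<Longrightarrow> \<gamma> i (x [^] j) = (if i = j then 1 else 0)"
    and pow_decomp: "h \<in> carrier H \<Longrightarrow> h = (\<Oplus>i\<in>{..<N}. inv_into (carrier K) \<phi> (\<gamma> i h) \<odot> x [^] i)"
    and N_gt1: "1 < N"
begin

lemma hom_pow_expand:
  assumes M: "is_module K M" and f: "f \<in> module_hom K H M" and h: "h \<in> carrier H"
  shows "f h = (\<Oplus>\<^bsub>M\<^esub>i\<in>{..<N}. \<psi> (\<gamma> i h) \<odot>\<^bsub>M\<^esub> f (x [^] i))"
proof -
  interpret M': Module.module K M by fact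
  have "f h = f (\<Oplus>i\<in>{..<N}. \<psi> (\<gamma> i h) \<odot> x [^] i)" using pow_decomp[OF h] by simp
  also have "\<dots> = (\<Oplus>\<^bsub>M\<^esub>i\<in>{..<N}. f (\<psi> (\<gamma> i h) \<odot> x [^] i))"
    by (rule module_hom_finsum[OF H_module M f]) auto
  finally show ?thesis by (simp add: module_homD(3)[OF f])
qed

lemma hom_pow_eqI:
  assumes M: "is_module K M" and f: "f \<in> module_hom K H M" and g: "g \<in> module_hom K H M"
    and eq: "\<And>i. i < N \<Longrightarrow> f (x [^] i) = g (x [^] i)" and h: "h \<in> carrier H"
  shows "f h = g h"
proof -
  interpret M': Module.module K M by fact
  have "(\<Oplus>\<^bsub>M\<^esub>i\<in>{..<N}. \<psi> (\<gamma> i h) \<odot>\<^bsub>M\<^esub> f (x [^] i)) = (\<Oplus>\<^bsub>M\<^esub>i\<in>{..<N}. \<psi> (\<gamma> i h) \<odot>\<^bsub>M\<^esub> g (x [^] i))"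
    by (rule M'.finsum_cong') (auto simp: eq intro!: M'.smult_closed module_homD(1)[OF g])
  then show ?thesis using hom_pow_expand[OF M f h] hom_pow_expand[OF M g h] by simp
qed

lemma pow_eqI: "h \<in> carrier H \<Longrightarrow> h' \<in> carrier H \<Longrightarrow> (\<And>i. i < N \<Longrightarrow> \<gamma> i h = \<gamma> i h') \<Longrightarrow> h = h'"
proof -
  assume h: "h \<in> carrier H" "h' \<in> carrier H" and eq: "\<And>i. i < N \<Longrightarrow> \<gamma> i h = \<gamma> i h'"
  have "(\<Oplus>i\<in>{..<N}. \<psi> (\<gamma> i h) \<odot> x [^] i) = (\<Oplus>i\<in>{..<N}. \<psi> (\<gamma> i h') \<odot> x [^] i)"
    by (rule M.finsum_cong') (auto simp: eq)
  then show "h = h'" using pow_decomp[OF h(1)] pow_decomp[OF h(2)] by simp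
qed

lemma \<gamma>_finsum:
  assumes "c \<in> {..<N} \<rightarrow> carrier K" "i < N"
  shows "\<gamma> i (\<Oplus>j\<in>{..<N}. c j \<odot> x [^] j) = \<phi> (c i)"
proof -
  have "\<gamma> i (\<Oplus>j\<in>{..<N}. c j \<odot> x [^] j) = (\<Oplus>\<^bsub>F\<^esub>j\<in>{..<N}. \<gamma> i (c j \<odot> x [^] j))"
    using assms by (intro module_hom_finsum[OF H_module F_module \<gamma>_hom]) auto
  also have "\<dots> = (\<Sum>j<N. \<gamma> i (c j \<odot> x [^] j))"
    by (rule finsum_F) simp
  also have "\<dots> = (\<Sum>j<N. if j = i then \<phi> (c i) else 0)"
    using assms by (intro sum.cong) (auto simp: module_homD(3)[OF \<gamma>_hom] \<gamma>_pow Pi_iff)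
  finally show ?thesis using assms(2) by simp
qed

theorem group_algebra_iso:
  assumes comult_x: "comult H x = pure_tensor K H H x x" and counit_x: "counit H x = \<one>\<^bsub>K\<^esub>"
    and order: "x [^] N = \<one>" and anti: "\<And>i. i \<le> N \<Longrightarrow> antipode H (x [^] i) = x [^] (N - i)"
  shows "is_hopf_iso K H (group_hopf_algebra K (integer_mod_group N))"
proof -
  let ?Z = "integer_mod_group N"
  define L where "L = group_hopf_algebra K ?Z"
  define A where "A = group_algebra K ?Z"
  define V where "V = {0..<int N}"
  have V: "carrier ?Z = V" using N_gt1 by (simp add: carrier_integer_mod_group V_def)
  have finV: "finite V" by (simp add: V_def)
  let ?FV = "free_module K V"
  have A_sel: "carrier A = carrier ?FV" "\<And>u v. u \<oplus>\<^bsub>A\<^esub> v = u \<oplus>\<^bsub>?FV\<^esub> v" "\<zero>\<^bsub>A\<^esub> = \<zero>\<^bsub>?FV\<^esub>"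
    "\<And>c u. c \<odot>\<^bsub>A\<^esub> u = c \<odot>\<^bsub>?FV\<^esub> u"
    by (simp_all add: A_def group_algebra_def Let_def V)
  have L_sel: "carrier L = carrier ?FV" "\<And>u v. u \<oplus>\<^bsub>L\<^esub> v = u \<oplus>\<^bsub>?FV\<^esub> v" "\<zero>\<^bsub>L\<^esub> = \<zero>\<^bsub>?FV\<^esub>"
    "\<And>c u. c \<odot>\<^bsub>L\<^esub> u = c \<odot>\<^bsub>?FV\<^esub> u" "\<one>\<^bsub>L\<^esub> = free_gen K 0"
    "\<And>u v. u \<otimes>\<^bsub>L\<^esub> v = lin_ext K ?FV (\<lambda>i. lin_ext K ?FV (\<lambda>j. free_gen K ((i + j) mod int N)) v) u"
    "comult L = lin_ext K (tensor_module K A A) (\<lambda>g. pure_tensor K A A (free_gen K g) (free_gen K g))"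
    "counit L = (\<lambda>u. \<Oplus>\<^bsub>K\<^esub>g\<in>{g. u g \<noteq> \<zero>\<^bsub>K\<^esub>}. u g)"
    "antipode L = lin_ext K A (\<lambda>g. free_gen K (inv\<^bsub>?Z\<^esub> g))"
    by (simp_all add: L_def A_def group_hopf_algebra_def group_algebra_def Let_def V
        module.defs hopf_algebra.defs)
  have FV: "is_module K ?FV" by (rule free_module_module) (rule R.is_cring)
  have LM: "is_module K L" and AM: "is_module K A"
    by (rule is_module_cong[OF FV]; simp add: L_sel A_sel)+
  have hom_L: "module_hom K M L = module_hom K M ?FV" "module_hom K M A = module_hom K M ?FV" for M :: "('k, 'x, 'y) module_scheme"
    by (simp_all add: module_hom_def L_sel A_sel)
  have tens: "tensor_module K A A = tensor_module K L L" "pure_tensor K A A = pure_tensor K L L"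
    by (rule tensor_module_cong; simp add: L_sel A_sel)+
  interpret LL: module_pair K L L by (rule module_pairI[OF LM LM])
  have gen: "free_gen K g \<in> carrier ?FV" if "g \<in> V" for g
    by (rule free_gen_closed[OF R.is_cring that])
  have modV: "i mod int N \<in> V" for i using N_gt1 by (simp add: V_def)
  \<comment> \<open>Power coordinates of h become the coefficients of the residues mod N, so that
    x^i goes to the generator i.\<close>
  define \<Theta> where "\<Theta> h = (\<lambda>y. if y \<in> V then \<psi> (\<gamma> (nat y) h) else \<zero>\<^bsub>K\<^esub>)" for h
  have \<Theta>_hom: "\<Theta> \<in> module_hom K H ?FV"
    by (rule module_homI)
       (auto simp: \<Theta>_def mem_free_module add_free_module smult_free_module module_homD[OF \<gamma>_hom]
          \<psi>_add \<psi>_mult finV intro: finite_subset[OF _ finV] split: if_splits)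
  have \<Theta>_hom_L: "\<Theta> \<in> module_hom K H L" using \<Theta>_hom by (simp add: hom_L)
  have \<psi>01: "\<psi> 1 = \<one>\<^bsub>K\<^esub>" "\<psi> 0 = \<zero>\<^bsub>K\<^esub>"
    by (metis \<phi>_one \<psi>_\<phi> R.one_closed, metis \<phi>_zero \<psi>_\<phi> R.zero_closed)
  have \<Theta>_pow: "\<Theta> (x [^] i) = free_gen K (int i)" if "i < N" for i
    using that by (auto simp: \<Theta>_def free_gen_def fun_eq_iff V_def \<gamma>_pow \<psi>01 nat_less_iff)
  have pow_mod: "x [^] (i mod N) = x [^] (i::nat)" for i
  proof -
    have "x [^] i = x [^] (N * (i div N) + i mod N)" by simp
    also have "\<dots> = (x [^] N) [^] (i div N) \<otimes> x [^] (i mod N)"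
      by (simp only: A.nat_pow_mult[symmetric] A.nat_pow_pow x_closed)
    finally show ?thesis by (simp add: order)
  qed
  have "inj_on \<Theta> (carrier H)"
  proof (rule inj_onI)
    fix h h' assume h: "h \<in> carrier H" "h' \<in> carrier H" "\<Theta> h = \<Theta> h'"
    show "h = h'"
    proof (rule pow_eqI[OF h(1,2)])
      fix i assume "i < N"
      then have "\<psi> (\<gamma> i h) = \<psi> (\<gamma> i h')" using fun_cong[OF h(3), of "int i"] by (simp add: \<Theta>_def V_def)
      then show "\<gamma> i h = \<gamma> i h'" by (metis \<phi>_\<psi>)
    qed
  qed
  moreover have "\<Theta> ` carrier H = carrier L"
  proof
    show "\<Theta> ` carrier H \<subseteq> carrier L" using module_homD(1)[OF \<Theta>_hom] by (auto simp: L_sel)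
    show "carrier L \<subseteq> \<Theta> ` carrier H"
    proof
      fix u assume "u \<in> carrier L"
      then have u: "\<And>y. u y \<in> carrier K" "\<And>y. y \<notin> V \<Longrightarrow> u y = \<zero>\<^bsub>K\<^esub>"
        by (auto simp: L_sel mem_free_module)
      let ?h = "\<Oplus>j\<in>{..<N}. u (int j) \<odot> x [^] j"
      have h: "?h \<in> carrier H" using u by (intro M.finsum_closed) auto
      have "\<Theta> ?h y = u y" for y
      proof (cases "y \<in> V")
        case True
        then have "nat y < N" "int (nat y) = y" by (auto simp: V_def)
        then show ?thesis using True u by (simp add: \<Theta>_def \<gamma>_finsum[of "\<lambda>j. u (int j)"])
      qed (simp add: \<Theta>_def u)
      then have "u = \<Theta> ?h" by (simp add: fun_eq_iff)
      then show "u \<in> \<Theta> ` carrier H" using h by (rule image_eqI)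
    qed
  qed
  ultimately have bij: "bij_betw \<Theta> (carrier H) (carrier L)" by (simp add: bij_betw_def)
  have mult: "\<Theta> (h \<otimes> k) = \<Theta> h \<otimes>\<^bsub>L\<^esub> \<Theta> k" if h: "h \<in> carrier H" and k: "k \<in> carrier H" for h k
  proof -
    have in1: "(\<lambda>j. free_gen K ((i + j) mod int N)) \<in> V \<rightarrow> carrier ?FV" for i
      using gen modV by auto
    have l1: "lin_ext K ?FV (\<lambda>j. free_gen K ((i + j) mod int N)) \<in> module_hom K ?FV ?FV" for i
      by (rule lin_ext_hom[OF FV in1])
    have in2: "(\<lambda>i. lin_ext K ?FV (\<lambda>j. free_gen K ((i + j) mod int N)) (\<Theta> k)) \<in> V \<rightarrow> carrier ?FV" if "k \<in> carrier H" for k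
      using module_homD(1)[OF l1 module_homD(1)[OF \<Theta>_hom that]] by auto
    have h1: "(\<lambda>h. \<Theta> h \<otimes>\<^bsub>L\<^esub> \<Theta> k) \<in> module_hom K H ?FV" if "k \<in> carrier H" for k
      unfolding L_sel by (rule module_hom_comp[OF \<Theta>_hom lin_ext_hom[OF FV in2[OF that]]])
    have gm: "\<Theta> (x [^] i) \<otimes>\<^bsub>L\<^esub> \<Theta> k = lin_ext K ?FV (\<lambda>j. free_gen K ((int i + j) mod int N)) (\<Theta> k)"
      if "i < N" "k \<in> carrier H" for i k
      unfolding L_sel \<Theta>_pow[OF that(1)] using that
      by (intro lin_ext_gen[OF FV in2]) (auto simp: V_def)
    show ?thesis
    proof (rule hom_pow_eqI[OF FV module_hom_comp[OF bilinear_mapD(1)[OF mult_bilinear k] \<Theta>_hom] h1[OF k] _ h])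
      fix i assume i: "i < N"
      show "\<Theta> (x [^] i \<otimes> k) = \<Theta> (x [^] i) \<otimes>\<^bsub>L\<^esub> \<Theta> k"
        unfolding gm[OF i k]
      proof (rule hom_pow_eqI[OF FV module_hom_comp[OF bilinear_mapD(2)[OF mult_bilinear] \<Theta>_hom] module_hom_comp[OF \<Theta>_hom l1] _ k])
        fix j assume j: "j < N"
        have "\<Theta> (x [^] i \<otimes> x [^] j) = \<Theta> (x [^] ((i + j) mod N))"
          by (simp add: pow_mod A.nat_pow_mult)
        also have "\<dots> = free_gen K ((int i + int j) mod int N)"
          using N_gt1 by (subst \<Theta>_pow) (simp_all add: zmod_int)
        also have "\<dots> = lin_ext K ?FV (\<lambda>j. free_gen K ((int i + j) mod int N)) (\<Theta> (x [^] j))"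
          unfolding \<Theta>_pow[OF j] using j by (intro lin_ext_gen[OF FV in1, symmetric]) (simp add: V_def)
        finally show "\<Theta> (x [^] i \<otimes> x [^] j) = lin_ext K ?FV (\<lambda>j. free_gen K ((int i + j) mod int N)) (\<Theta> (x [^] j))" .
      qed simp
    qed
  qed
  have one: "\<Theta> \<one> = \<one>\<^bsub>L\<^esub>" using \<Theta>_pow[of 0] N_gt1 by (simp add: L_sel)
  have iso: "\<Theta> \<in> ring_iso H L"
    using bij mult one module_homD[OF \<Theta>_hom_L] by (auto simp: ring_iso_def ring_hom_def)
  have comult_pow: "comult H (x [^] i) = pure_tensor K H H (x [^] i) (x [^] i)" for i :: nat
    by (induction i)
       (simp_all add: comult_one comult_mult comult_x tensor_mult_pure[OF H_module mult_bilinear H_module mult_bilinear])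
  have counit_pow: "counit H (x [^] i) = \<one>\<^bsub>K\<^esub>" for i :: nat
    by (induction i) (simp_all add: counit_one counit_mult counit_x)
  note tm = tensor_map_hom[OF LM LM H_module H_module \<Theta>_hom_L \<Theta>_hom_L]
    and tp = tensor_map_pure[OF LM LM H_module H_module \<Theta>_hom_L \<Theta>_hom_L]
  have in3: "(\<lambda>g. pure_tensor K L L (free_gen K g) (free_gen K g)) \<in> V \<rightarrow> carrier (tensor_module K L L)"
    using gen by (auto intro!: LL.pure_closed simp: L_sel)
  have com: "comult L (\<Theta> h) = tensor_map K L L \<Theta> \<Theta> (comult H h)" if h: "h \<in> carrier H" for h
  proof (rule hom_pow_eqI[OF LL.tensor_module_module _ module_hom_comp[OF comult_hom tm] _ h])
    show "(\<lambda>h. comult L (\<Theta> h)) \<in> module_hom K H (tensor_module K L L)"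
      unfolding L_sel tens by (rule module_hom_comp[OF \<Theta>_hom lin_ext_hom[OF LL.tensor_module_module in3]])
    fix i assume i: "i < N"
    show "comult L (\<Theta> (x [^] i)) = tensor_map K L L \<Theta> \<Theta> (comult H (x [^] i))"
      unfolding comult_pow using i
      by (simp add: tp \<Theta>_pow) (simp add: L_sel tens, rule lin_ext_gen[OF LL.tensor_module_module in3], simp add: V_def)
  qed
  have cou: "counit L (\<Theta> h) = counit H h" if h: "h \<in> carrier H" for h
  proof -
    have lf: "(\<lambda>_. 1) \<in> V \<rightarrow> carrier F" by simp
    \<comment> \<open>The counit of the model is a bare sum over the support; writing it as a linear
      extension makes it a homomorphism that can be compared on powers.\<close>
    have "\<phi> (counit H h) = lin_ext K F (\<lambda>_. 1) (\<Theta> h)"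
    proof (rule hom_pow_eqI[OF F_module counit_functional module_hom_comp[OF \<Theta>_hom lin_ext_hom[OF F_module lf]] _ h])
      fix i assume i: "i < N"
      show "\<phi> (counit H (x [^] i)) = lin_ext K F (\<lambda>_. 1) (\<Theta> (x [^] i))"
        unfolding \<Theta>_pow[OF i] using i by (subst lin_ext_gen[OF F_module lf]) (simp_all add: V_def counit_pow)
    qed
    also have "\<dots> = \<phi> (counit L (\<Theta> h))"
    proof -
      have sup: "finite {g. \<Theta> h g \<noteq> \<zero>\<^bsub>K\<^esub>}" "\<And>g. \<Theta> h g \<in> carrier K"
        using module_homD(1)[OF \<Theta>_hom h] by (auto simp: mem_free_module)
      have "\<phi> (\<Oplus>\<^bsub>K\<^esub>g\<in>B. \<Theta> h g) = (\<Sum>g\<in>B. \<phi> (\<Theta> h g))" if "finite B" for B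
        using that sup(2) by (induction B rule: finite_induct) (simp_all add: \<phi>_add Pi_iff)
      then show ?thesis using sup by (simp add: L_sel lin_ext_def finsum_F)
    qed
    finally show ?thesis
      by (metis \<psi>_\<phi> counit_closed[OF h] L_sel(8) R.finsum_closed[of "\<Theta> h"] module_homD(1)[OF \<Theta>_hom h] mem_free_module Pi_I)
  qed
  have in4: "(\<lambda>g. free_gen K (inv\<^bsub>?Z\<^esub> g)) \<in> V \<rightarrow> carrier ?FV"
    using group.inv_closed[OF group_integer_mod_group[of N]] gen by (auto simp: V[symmetric])
  have ant: "antipode L (\<Theta> h) = \<Theta> (antipode H h)" if h: "h \<in> carrier H" for h
  proof (rule hom_pow_eqI[OF AM _ module_hom_comp[OF antipode_linear \<Theta>_hom[folded hom_L(2)]] _ h])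
    have in5: "(\<lambda>g. free_gen K (inv\<^bsub>?Z\<^esub> g)) \<in> V \<rightarrow> carrier A" using in4 by (simp add: A_sel)
    show "(\<lambda>h. antipode L (\<Theta> h)) \<in> module_hom K H A"
      unfolding L_sel by (rule module_hom_comp[OF \<Theta>_hom lin_ext_hom[OF AM in5]])
    fix i assume i: "i < N"
    have "antipode L (\<Theta> (x [^] i)) = free_gen K (inv\<^bsub>?Z\<^esub> (int i))"
      unfolding L_sel \<Theta>_pow[OF i] using i by (intro lin_ext_gen[OF AM in5]) (simp add: V_def)
    \<comment> \<open>The outer mod matters for i = 0, where N - i = N is not a residue.\<close>
    also have "inv\<^bsub>?Z\<^esub> (int i) = int ((N - i) mod N)"
    proof -
      have "inv\<^bsub>?Z\<^esub> (int i) = (- int i) mod int N"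
        using i N_gt1 by (intro inv_integer_mod_group) (simp add: carrier_integer_mod_group)
      also have "\<dots> = (int N - int i) mod int N" by (simp add: mod_diff_left_eq[symmetric] minus_mod_self1)
      finally show ?thesis using i by (simp add: zmod_int of_nat_diff)
    qed
    also have "free_gen K (int ((N - i) mod N)) = \<Theta> (x [^] (N - i))"
      using N_gt1 by (subst \<Theta>_pow[symmetric]) (simp_all add: pow_mod)
    finally show "antipode L (\<Theta> (x [^] i)) = \<Theta> (antipode H (x [^] i))" using i by (simp add: anti)
  qed
  have "\<Theta> \<in> hopf_iso K H L" using iso \<Theta>_hom_L com cou ant by (simp add: hopf_iso_def)
  then show ?thesis unfolding is_hopf_iso_def L_def by blast
qed

end

section \<open>The quotients of the polynomial algebra\<close>

context power_basis begin

text \<open>Powers of x commute and span H. Commutativity makes H a legitimate target for evaluating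
  polynomials.\<close>

lemma H_cring: "cring H"
proof (intro cring.intro comm_monoid.intro comm_monoid_axioms.intro A.ring_axioms A.monoid_axioms)
  fix h k assume h: "h \<in> carrier H" and k: "k \<in> carrier H"
  show "h \<otimes> k = k \<otimes> h"
  proof (rule hom_pow_eqI[OF H_module bilinear_mapD(1)[OF mult_bilinear k] bilinear_mapD(2)[OF mult_bilinear k] _ h])
    fix i :: nat
    show "x [^] i \<otimes> k = k \<otimes> x [^] i"
      by (rule hom_pow_eqI[OF H_module bilinear_mapD(2)[OF mult_bilinear] bilinear_mapD(1)[OF mult_bilinear] _ k])
         (simp_all add: A.nat_pow_mult add.commute)
  qed
qed

text \<open>Evaluation at x maps the polynomials onto H, and its kernel is generated by f, since f
  is monic of degree N and the first N powers are independent. \<Theta> inverts the induced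
  map.\<close>

theorem primitive_hopf_algebra_iso:
  assumes comult_x: "comult H x = pure_tensor K H H x \<one> \<oplus>\<^bsub>T\<^esub> pure_tensor K H H \<one> x"
    and counit_x: "counit H x = \<zero>\<^bsub>K\<^esub>"
    and anti: "\<And>i::nat. antipode H (x [^] i) = (\<ominus> x) [^] i"
    and f: "f \<in> carrier (UP K)" and f_lead: "up_ring.coeff (UP K) f N = \<one>\<^bsub>K\<^esub>"
    and f_above: "\<And>i. N < i \<Longrightarrow> up_ring.coeff (UP K) f i = \<zero>\<^bsub>K\<^esub>"
    and f_root: "UnivPoly.eval K H (\<lambda>c. c \<odot> \<one>) x f = \<zero>"
  shows "is_hopf_iso K H (primitive_hopf_algebra K f)"
proof -
  interpret dom: Ring.domain K by unfold_locales
  interpret U: UP_domain K "UP K" by unfold_locales simp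
  interpret Hc: cring H by (rule H_cring)
  have c1: "(\<lambda>c. c \<odot> \<one>) \<in> ring_hom K H"
    by (rule ring_hom_memI) (auto simp: smult_l_distr smult_mult_left smult_assoc1)
  interpret E: UP_pre_univ_prop K H "\<lambda>c. c \<odot> \<one>" "UP K"
    by (intro UP_pre_univ_prop.intro ring_hom_cring.intro ring_hom_cring_axioms.intro c1)
       (unfold_locales)
  define P where "P = UP K"
  define ev where "ev = UnivPoly.eval K H (\<lambda>c. c \<odot> \<one>) x"
  have ev_hom: "ev \<in> ring_hom P H" unfolding ev_def P_def by (rule E.eval_ring_hom) simp
  have ev_closed: "ev q \<in> carrier H" if "q \<in> carrier P" for q using ev_hom that by (auto simp: ring_hom_def)
  have ev_add: "ev (q \<oplus>\<^bsub>P\<^esub> r) = ev q \<oplus> ev r" and ev_mult: "ev (q \<otimes>\<^bsub>P\<^esub> r) = ev q \<otimes> ev r"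
    if "q \<in> carrier P" "r \<in> carrier P" for q r using ev_hom that by (auto simp: ring_hom_def)
  have ev_one: "ev \<one>\<^bsub>P\<^esub> = \<one>" using ev_hom by (auto simp: ring_hom_def)
  have PM: "is_module K P" unfolding P_def by (rule U.module_axioms)
  interpret PM: Module.module K P by (rule PM)
  interpret Pr: cring P unfolding P_def by (rule U.P.is_cring)
  have ev_sum: "ev q = (\<Oplus>i\<in>{..deg K q}. up_ring.coeff P q i \<odot> x [^] i)" if q: "q \<in> carrier P" for q
  proof -
    have "ev q = (\<Oplus>i\<in>{..deg K q}. (up_ring.coeff P q i \<odot> \<one>) \<otimes> x [^] i)"
      using U.eval_on_carrier[of q H] q unfolding ev_def P_def by simp
    also have "\<dots> = (\<Oplus>i\<in>{..deg K q}. up_ring.coeff P q i \<odot> x [^] i)"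
      using q U.coeff_closed[of q] by (intro M.finsum_cong') (auto simp: P_def smult_mult_left)
    finally show ?thesis .
  qed
  have ev_monom: "ev (up_ring.monom P c i) = c \<odot> x [^] i" if "c \<in> carrier K" for c i
    unfolding ev_def P_def using that by (subst E.eval_monom) (auto simp: smult_mult_left)
  have ev_smult: "ev (c \<odot>\<^bsub>P\<^esub> q) = c \<odot> ev q" if c: "c \<in> carrier K" and q: "q \<in> carrier P" for c q
  proof -
    have "c \<odot>\<^bsub>P\<^esub> q = up_ring.monom P c 0 \<otimes>\<^bsub>P\<^esub> q" unfolding P_def using c q by (simp add: U.monom_mult_is_smult P_def)
    then show ?thesis
      using c q by (simp add: ev_mult ev_monom U.monom_closed[folded P_def] smult_mult_left ev_closed)
  qed
  have ev_phom: "ev \<in> module_hom K P H"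
    by (rule module_homI) (simp_all add: ev_closed ev_add ev_smult)
  have ev_surj: "\<exists>q\<in>carrier P. ev q = h" if h: "h \<in> carrier H" for h
  proof
    let ?q = "\<Oplus>\<^bsub>P\<^esub>i\<in>{..<N}. up_ring.monom P (\<psi> (\<gamma> i h)) i"
    have mc: "(\<lambda>i. up_ring.monom P (\<psi> (\<gamma> i h)) i) \<in> {..<N} \<rightarrow> carrier P"
      using U.monom_closed by (auto simp: P_def)
    show "?q \<in> carrier P" using mc by (rule PM.M.finsum_closed)
    have "ev ?q = (\<Oplus>i\<in>{..<N}. ev (up_ring.monom P (\<psi> (\<gamma> i h)) i))"
      by (rule module_hom_finsum[OF PM H_module ev_phom mc])
    then show "ev ?q = h" using pow_decomp[OF h] by (simp add: ev_monom)
  qed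
  define I where "I = PIdl\<^bsub>P\<^esub> f"
  have fP: "f \<in> carrier P" using f by (simp add: P_def)
  have ev_f: "ev f = \<zero>" using f_root by (simp add: ev_def)
  have degf: "deg K f = N"
    using f f_lead f_above by (intro le_antisym U.deg_aboveI U.deg_belowI) auto
  have ideal: "ideal I P" unfolding I_def by (rule Pr.cgenideal_ideal[OF fP])
  interpret I: ideal I P by (rule ideal)
  have ker: "q \<in> I \<longleftrightarrow> ev q = \<zero>" if q: "q \<in> carrier P" for q
  proof
    assume "q \<in> I"
    then obtain r where "r \<in> carrier P" "q = r \<otimes>\<^bsub>P\<^esub> f" unfolding I_def cgenideal_def by blast
    then show "ev q = \<zero>" by (simp add: ev_mult fP ev_f ev_closed)
  next
    assume 0: "ev q = \<zero>"
    have "f \<noteq> \<zero>\<^bsub>UP K\<^esub>" using f_lead by auto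
    then obtain g r and k :: nat where gr: "g \<in> carrier P" "r \<in> carrier P"
        "up_ring.coeff P f (deg K f) [^]\<^bsub>K\<^esub> k \<odot>\<^bsub>P\<^esub> q = f \<otimes>\<^bsub>P\<^esub> g \<oplus>\<^bsub>P\<^esub> r" "r = \<zero>\<^bsub>P\<^esub> \<or> deg K r < deg K f"
      using U.long_div_theorem[OF f, of q] q unfolding P_def by blast
    \<comment> \<open>The division theorem scales q by a power of the leading coefficient of f,
      which is 1 here.\<close>
    have qd: "q = f \<otimes>\<^bsub>P\<^esub> g \<oplus>\<^bsub>P\<^esub> r" using gr(3) q by (simp add: degf f_lead P_def[symmetric] f_lead[folded P_def])
    have r0: "ev r = \<zero>"
    proof -
      have "ev q = ev f \<otimes> ev g \<oplus> ev r" using qd gr fP by (simp add: ev_add ev_mult)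
      then show ?thesis using 0 gr by (simp add: ev_f ev_closed)
    qed
    have "r = \<zero>\<^bsub>P\<^esub>"
    proof (rule disjE[OF gr(4)])
      assume dr: "deg K r < deg K f"
      have cr: "up_ring.coeff P r i \<in> carrier K" for i using gr(2) U.coeff_closed by (simp add: P_def)
      have above: "up_ring.coeff P r i = \<zero>\<^bsub>K\<^esub>" if "deg K r < i" for i using gr(2) that U.deg_aboveD by (simp add: P_def)
      have "(\<Oplus>i\<in>{..deg K r}. up_ring.coeff P r i \<odot> x [^] i) = (\<Oplus>i\<in>{..<N}. up_ring.coeff P r i \<odot> x [^] i)"
        by (rule M.add.finprod_mono_neutral_cong_left) (use dr degf cr above in auto)
      then have z: "(\<Oplus>i\<in>{..<N}. up_ring.coeff P r i \<odot> x [^] i) = \<zero>" using r0 ev_sum[OF gr(2)] by simp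
      have "up_ring.coeff P r i = \<zero>\<^bsub>K\<^esub>" for i
      proof (cases "i < N")
        case True
        have "\<phi> (up_ring.coeff P r i) = \<gamma> i \<zero>" using \<gamma>_finsum[of "\<lambda>i. up_ring.coeff P r i" i] cr True z by simp
        also have "\<dots> = 0" using module_hom_zero[OF H_module F_module \<gamma>_hom] by simp
        finally show ?thesis using cr by (metis \<phi>_eq_iff \<phi>_zero R.zero_closed)
      next
        case False then show ?thesis using dr degf by (intro above) simp
      qed
      then show "r = \<zero>\<^bsub>P\<^esub>" using gr(2) unfolding P_def by (intro U.up_eqI) (simp_all add: U.coeff_zero)
    qed
    then have "q = g \<otimes>\<^bsub>P\<^esub> f" using qd gr fP by (simp add: Pr.m_comm)
    then show "q \<in> I" using gr(1) unfolding I_def cgenideal_def by blast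
  qed
  have sub: "submodule K I P"
  proof
    fix c v assume c: "c \<in> carrier K" and v: "v \<in> I"
    have vP: "v \<in> carrier P" using v I.a_subset by blast
    show "c \<odot>\<^bsub>P\<^esub> v \<in> I" using ker[OF vP] ker[of "c \<odot>\<^bsub>P\<^esub> v"] v c vP by (simp add: ev_smult smult_r_null)
  qed (use I.a_subset PM in auto)
  interpret Q: quotient_by_submodule K P I
    by (simp add: quotient_by_submodule_def PM sub)
  define A where "A = poly_quot K f"
  have A_eq: "A = quot_module P I" by (simp add: A_def poly_quot_def P_def I_def)
  define L where "L = primitive_hopf_algebra K f"
  define xb where "xb = poly_quot_var K f"
  define TA where "TA = tensor_algebra K A A"
  have L_sel: "carrier L = carrier A" "\<And>u v. u \<oplus>\<^bsub>L\<^esub> v = u \<oplus>\<^bsub>A\<^esub> v" "\<zero>\<^bsub>L\<^esub> = \<zero>\<^bsub>A\<^esub>"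
    "\<And>c u. c \<odot>\<^bsub>L\<^esub> u = c \<odot>\<^bsub>A\<^esub> u" "\<one>\<^bsub>L\<^esub> = \<one>\<^bsub>A\<^esub>" "\<And>u v. u \<otimes>\<^bsub>L\<^esub> v = u \<otimes>\<^bsub>A\<^esub> v"
    "comult L = poly_quot_eval K TA (pure_tensor K A A xb \<one>\<^bsub>A\<^esub> \<oplus>\<^bsub>TA\<^esub> pure_tensor K A A \<one>\<^bsub>A\<^esub> xb)"
    "counit L = (\<lambda>S. UnivPoly.eval K K (\<lambda>c. c) \<zero>\<^bsub>K\<^esub> (SOME q. q \<in> S))"
    "antipode L = poly_quot_eval K A (\<ominus>\<^bsub>A\<^esub> xb)"
    by (simp_all add: L_def A_def xb_def TA_def primitive_hopf_algebra_def Let_def module.defs hopf_algebra.defs)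
  have AM: "is_module K A" unfolding A_eq by (rule Q.quot_module_module)
  interpret AM: Module.module K A by (rule AM)
  have LM: "is_module K L" by (rule is_module_cong[OF AM]) (simp_all add: L_sel)
  \<comment> \<open>The fibre over h is a coset of the ideal, so whatever representative
    \<open>poly_quot_eval\<close> picks from it evaluates to h. This reduces the model's maps to
    sums over coefficients.\<close>
  define \<Theta> where "\<Theta> h = {q \<in> carrier P. ev q = h}" for h
  have \<Theta>_ev: "\<Theta> (ev q) = I +>\<^bsub>P\<^esub> q" if q: "q \<in> carrier P" for q
  proof -
    have iff: "r \<in> I +>\<^bsub>P\<^esub> q \<longleftrightarrow> ev r = ev q" if r: "r \<in> carrier P" for r
    proof -
      have "r \<in> I +>\<^bsub>P\<^esub> q \<longleftrightarrow> I +>\<^bsub>P\<^esub> r = I +>\<^bsub>P\<^esub> q"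
        using Q.mem_coset[OF q] Q.coset_nonempty[OF r] by auto
      also have "\<dots> \<longleftrightarrow> r \<ominus>\<^bsub>P\<^esub> q \<in> I" by (rule Q.coset_eq_iff[OF r q])
      also have "\<dots> \<longleftrightarrow> ev (r \<ominus>\<^bsub>P\<^esub> q) = \<zero>" using q r by (intro ker) simp
      also have "\<dots> \<longleftrightarrow> ev r = ev q"
      proof -
        have "ev (r \<ominus>\<^bsub>P\<^esub> q) \<oplus> ev q = ev r"
          using q r by (subst ev_add[symmetric]) (simp_all add: a_minus_def PM.M.a_assoc PM.M.l_neg)
        then show ?thesis
          using M.add.right_cancel[of "ev q" "ev (r \<ominus>\<^bsub>P\<^esub> q)" \<zero>] ev_closed[of "r \<ominus>\<^bsub>P\<^esub> q"] ev_closed[OF q] q r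
          by auto
      qed
      finally show ?thesis .
    qed
    show ?thesis
    proof (rule Set.set_eqI)
      fix r show "r \<in> \<Theta> (ev q) \<longleftrightarrow> r \<in> I +>\<^bsub>P\<^esub> q"
        using iff[of r] Q.mem_coset[OF q, of r] unfolding \<Theta>_def by blast
    qed
  qed
  have \<Theta>_closed: "\<Theta> h \<in> carrier A" if h: "h \<in> carrier H" for h
  proof -
    obtain q where "q \<in> carrier P" "ev q = h" using ev_surj[OF h] by blast
    then show ?thesis using \<Theta>_ev[of q] unfolding A_eq Q.carrier_quot by blast
  qed
  have \<Theta>_hom: "\<Theta> \<in> module_hom K H A"
  proof (rule module_homI[OF \<Theta>_closed])
    fix h k assume h: "h \<in> carrier H" and k: "k \<in> carrier H"
    obtain q r where qr: "q \<in> carrier P" "h = ev q" "r \<in> carrier P" "k = ev r" using ev_surj[OF h] ev_surj[OF k] by blast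
    have "\<Theta> (h \<oplus> k) = I +>\<^bsub>P\<^esub> (q \<oplus>\<^bsub>P\<^esub> r)" using qr by (subst \<Theta>_ev[symmetric]) (simp_all add: ev_add)
    then show "\<Theta> (h \<oplus> k) = \<Theta> h \<oplus>\<^bsub>A\<^esub> \<Theta> k" using qr by (simp add: \<Theta>_ev A_eq Q.add_coset)
  next
    fix c h assume c: "c \<in> carrier K" and "h \<in> carrier H"
    then obtain q where qr: "q \<in> carrier P" "h = ev q" using ev_surj by blast
    have "\<Theta> (c \<odot> h) = I +>\<^bsub>P\<^esub> (c \<odot>\<^bsub>P\<^esub> q)" using qr c by (subst \<Theta>_ev[symmetric]) (simp_all add: ev_smult)
    then show "\<Theta> (c \<odot> h) = c \<odot>\<^bsub>A\<^esub> \<Theta> h" using qr c by (simp add: \<Theta>_ev A_eq Q.smult_coset)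
  qed
  have \<Theta>_hom_L: "\<Theta> \<in> module_hom K H L" using \<Theta>_hom by (simp add: module_hom_def L_sel)
  have \<Theta>_mult: "\<Theta> (h \<otimes> k) = \<Theta> h \<otimes>\<^bsub>A\<^esub> \<Theta> k" if h: "h \<in> carrier H" and k: "k \<in> carrier H" for h k
  proof -
    obtain q r where qr: "q \<in> carrier P" "h = ev q" "r \<in> carrier P" "k = ev r" using ev_surj[OF h] ev_surj[OF k] by blast
    have "\<Theta> (h \<otimes> k) = I +>\<^bsub>P\<^esub> (q \<otimes>\<^bsub>P\<^esub> r)" using qr by (subst \<Theta>_ev[symmetric]) (simp_all add: ev_mult)
    then show ?thesis using qr by (simp add: \<Theta>_ev A_eq quot_module_sel I.rcoset_mult_add)
  qed
  have \<Theta>_one: "\<Theta> \<one> = \<one>\<^bsub>A\<^esub>" using \<Theta>_ev[of "\<one>\<^bsub>P\<^esub>"] by (simp add: ev_one A_eq quot_module_sel)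
  have \<Theta>_surj: "\<exists>h\<in>carrier H. a = \<Theta> h" if a: "a \<in> carrier A" for a
  proof -
    obtain q where "q \<in> carrier P" "a = I +>\<^bsub>P\<^esub> q" using a unfolding A_eq Q.carrier_quot by blast
    then show ?thesis using \<Theta>_ev[of q] ev_closed[of q] by (intro bexI[of _ "ev q"]) simp_all
  qed
  have \<Theta>_inj: "h = k" if "h \<in> carrier H" "\<Theta> h = \<Theta> k" for h k
    using ev_surj[OF that(1)] that(2) unfolding \<Theta>_def by blast
  have bij: "bij_betw \<Theta> (carrier H) (carrier L)"
    unfolding bij_betw_def inj_on_def L_sel using \<Theta>_inj \<Theta>_surj \<Theta>_closed by blast
  have iso: "\<Theta> \<in> ring_iso H L"
    using bij \<Theta>_mult \<Theta>_one module_homD[OF \<Theta>_hom] by (auto simp: ring_iso_def ring_hom_def L_sel)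
  have xb: "xb = \<Theta> x"
  proof -
    have "poly_var K \<in> carrier P" "ev (poly_var K) = x"
      using ev_monom[of "\<one>\<^bsub>K\<^esub>" 1] U.monom_closed[of "\<one>\<^bsub>K\<^esub>" 1] by (simp_all add: poly_var_def P_def)
    then show ?thesis using \<Theta>_ev[of "poly_var K"] by (simp add: xb_def poly_quot_var_def P_def I_def)
  qed
  \<comment> \<open>The algebra laws of the quotient are transported from H along the surjection
    \<Theta>.\<close>
  have A_mult: "bilinear_map K A A A (\<otimes>\<^bsub>A\<^esub>)"
  proof (intro bilinear_mapI module_homI)
    have A_closed: "a \<otimes>\<^bsub>A\<^esub> a' \<in> carrier A" if "a \<in> carrier A" "a' \<in> carrier A" for a a'
      using \<Theta>_surj[OF that(1)] \<Theta>_surj[OF that(2)] by (auto simp: \<Theta>_mult[symmetric] intro!: \<Theta>_closed)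
    {
      fix a a' assume "a \<in> carrier A" "a' \<in> carrier A"
      then show "a \<otimes>\<^bsub>A\<^esub> a' \<in> carrier A" "a \<otimes>\<^bsub>A\<^esub> a' \<in> carrier A" by (rule A_closed)+
    next
      fix a1 a2 a3 assume a: "a1 \<in> carrier A" "a2 \<in> carrier A" "a3 \<in> carrier A"
      obtain h1 h2 h3 where h: "h1 \<in> carrier H" "a1 = \<Theta> h1" "h2 \<in> carrier H" "a2 = \<Theta> h2" "h3 \<in> carrier H" "a3 = \<Theta> h3"
        using \<Theta>_surj[OF a(1)] \<Theta>_surj[OF a(2)] \<Theta>_surj[OF a(3)] by blast
      show "(a2 \<oplus>\<^bsub>A\<^esub> a3) \<otimes>\<^bsub>A\<^esub> a1 = a2 \<otimes>\<^bsub>A\<^esub> a1 \<oplus>\<^bsub>A\<^esub> a3 \<otimes>\<^bsub>A\<^esub> a1"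
        "a1 \<otimes>\<^bsub>A\<^esub> (a2 \<oplus>\<^bsub>A\<^esub> a3) = a1 \<otimes>\<^bsub>A\<^esub> a2 \<oplus>\<^bsub>A\<^esub> a1 \<otimes>\<^bsub>A\<^esub> a3"
        using h by (simp_all add: module_homD(2)[OF \<Theta>_hom, symmetric] \<Theta>_mult[symmetric] A.l_distr A.r_distr)
    next
      fix a1 a2 c assume a: "a1 \<in> carrier A" "a2 \<in> carrier A" and c: "c \<in> carrier K"
      obtain h1 h2 where h: "h1 \<in> carrier H" "a1 = \<Theta> h1" "h2 \<in> carrier H" "a2 = \<Theta> h2"
        using \<Theta>_surj[OF a(1)] \<Theta>_surj[OF a(2)] by blast
      show "(c \<odot>\<^bsub>A\<^esub> a2) \<otimes>\<^bsub>A\<^esub> a1 = c \<odot>\<^bsub>A\<^esub> (a2 \<otimes>\<^bsub>A\<^esub> a1)" "a1 \<otimes>\<^bsub>A\<^esub> (c \<odot>\<^bsub>A\<^esub> a2) = c \<odot>\<^bsub>A\<^esub> (a1 \<otimes>\<^bsub>A\<^esub> a2)"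
        using h c by (simp_all add: module_homD(3)[OF \<Theta>_hom, symmetric] \<Theta>_mult[symmetric] smult_mult_left smult_mult_right)
    }
  qed
  have A_one: "\<one>\<^bsub>A\<^esub> \<otimes>\<^bsub>A\<^esub> a = a" if "a \<in> carrier A" for a
    using \<Theta>_surj[OF that] by (auto simp: \<Theta>_one[symmetric] \<Theta>_mult[symmetric])
  have A_one_closed: "\<one>\<^bsub>A\<^esub> \<in> carrier A" using \<Theta>_closed[of \<one>] by (simp add: \<Theta>_one)
  have \<Theta>_powA: "\<Theta> (h [^] i) = \<Theta> h [^]\<^bsub>A\<^esub> i" if "h \<in> carrier H" for h and i :: nat
    using that by (induction i) (simp_all add: \<Theta>_one \<Theta>_mult)
  interpret HH: module_pair K H H by (rule module_pairI[OF H_module H_module])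
  interpret AA: module_pair K A A by (rule module_pairI[OF AM AM])
  have tens: "tensor_module K L L = tensor_module K A A" "pure_tensor K L L = pure_tensor K A A"
    by (rule tensor_module_cong; simp add: L_sel)+
  then have tmL: "tensor_map K L L = tensor_map K A A" by (simp add: tensor_map_def fun_eq_iff)
  let ?tm = "tensor_map K A A \<Theta> \<Theta>"
  note tm = tensor_map_hom[OF AM AM H_module H_module \<Theta>_hom \<Theta>_hom]
    and tp = tensor_map_pure[OF AM AM H_module H_module \<Theta>_hom \<Theta>_hom]
  note tbH = tensor_mult_bilinear[OF H_module mult_bilinear H_module mult_bilinear]
    and tpH = tensor_mult_pure[OF H_module mult_bilinear H_module mult_bilinear]
    and tbA = tensor_mult_bilinear[OF AM A_mult AM A_mult]
    and tpA = tensor_mult_pure[OF AM A_mult AM A_mult]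
  have tm_mult: "?tm (S \<otimes>\<^bsub>tensor_algebra K H H\<^esub> R) = ?tm S \<otimes>\<^bsub>TA\<^esub> ?tm R" if S: "S \<in> carrier T" and R: "R \<in> carrier T" for S R
    unfolding TA_def
  proof (rule HH.tensor_hom_eqI[OF AA.tensor_module_module module_hom_comp[OF bilinear_mapD(1)[OF tbH R] tm]
        module_hom_comp[OF tm bilinear_mapD(1)[OF tbA module_homD(1)[OF tm R]]] _ S])
    fix a a' assume a: "a \<in> carrier H" "a' \<in> carrier H"
    show "?tm (pure_tensor K H H a a' \<otimes>\<^bsub>tensor_algebra K H H\<^esub> R) = ?tm (pure_tensor K H H a a') \<otimes>\<^bsub>tensor_algebra K A A\<^esub> ?tm R"
      by (rule HH.tensor_hom_eqI[OF AA.tensor_module_module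
            module_hom_comp[OF bilinear_mapD(2)[OF tbH HH.pure_closed[OF a]] tm]
            module_hom_comp[OF tm bilinear_mapD(2)[OF tbA module_homD(1)[OF tm HH.pure_closed[OF a]]]] _ R])
         (simp add: a tpH tp tpA \<Theta>_closed \<Theta>_mult)
  qed
  have TA_one: "\<one>\<^bsub>TA\<^esub> \<otimes>\<^bsub>TA\<^esub> t = t" if t: "t \<in> carrier (tensor_module K A A)" for t
    unfolding TA_def tensor_algebra_sel
    by (rule AA.tensor_hom_eqI[OF AA.tensor_module_module bilinear_mapD(2)[OF tbA AA.pure_closed[OF A_one_closed A_one_closed]] module_hom_id _ t])
       (simp add: tpA A_one_closed A_one)
  \<comment> \<open>x is primitive and the tensor square of \<Theta> is multiplicative, so powers of
    the prescribed \<Delta>(x) are images of \<Delta>(x^i); linearity then gives the whole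
    comultiplication.\<close>
  have s_pow: "(pure_tensor K A A xb \<one>\<^bsub>A\<^esub> \<oplus>\<^bsub>TA\<^esub> pure_tensor K A A \<one>\<^bsub>A\<^esub> xb) [^]\<^bsub>TA\<^esub> i = ?tm (comult H (x [^] i))" for i :: nat
  proof (induction i)
    case 0 show ?case by (simp add: TA_def comult_one tp \<Theta>_one)
  next
    case (Suc i)
    have "?tm (comult H x) = pure_tensor K A A xb \<one>\<^bsub>A\<^esub> \<oplus>\<^bsub>TA\<^esub> pure_tensor K A A \<one>\<^bsub>A\<^esub> xb"
      unfolding comult_x by (simp add: module_homD(2)[OF tm] HH.pure_closed tp xb \<Theta>_one TA_def)
    then show ?case using Suc by (simp add: comult_mult tm_mult comult_closed)
  qed
  have some: "(SOME q. q \<in> \<Theta> h) \<in> \<Theta> h" if h: "h \<in> carrier H" for h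
  proof -
    have "\<exists>q. q \<in> \<Theta> h" using ev_surj[OF h] unfolding \<Theta>_def by blast
    then show ?thesis by (rule someI_ex)
  qed
  have com: "comult L (\<Theta> h) = tensor_map K L L \<Theta> \<Theta> (comult H h)" if h: "h \<in> carrier H" for h
  proof -
    define q where "q = (SOME q. q \<in> \<Theta> h)"
    have q: "q \<in> carrier P" "ev q = h" using some[OF h] unfolding \<Theta>_def q_def by blast+
    have cq: "up_ring.coeff P q i \<in> carrier K" for i using q(1) U.coeff_closed by (simp add: P_def)
    let ?s = "pure_tensor K A A xb \<one>\<^bsub>A\<^esub> \<oplus>\<^bsub>TA\<^esub> pure_tensor K A A \<one>\<^bsub>A\<^esub> xb"
    interpret TM: Module.module K "tensor_module K A A" by (rule AA.tensor_module_module)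
    have tmc: "?tm (comult H (x [^] i)) \<in> carrier (tensor_module K A A)" for i :: nat
      by (intro module_homD(1)[OF tm] comult_closed) simp
    have "comult L (\<Theta> h) = (\<Oplus>\<^bsub>TA\<^esub>i\<in>{..deg K q}. (up_ring.coeff P q i \<odot>\<^bsub>TA\<^esub> \<one>\<^bsub>TA\<^esub>) \<otimes>\<^bsub>TA\<^esub> ?s [^]\<^bsub>TA\<^esub> i)"
      using q(1) unfolding L_sel poly_quot_eval_def q_def[symmetric] by (simp add: U.eval_on_carrier P_def)
    also have "\<dots> = (\<Oplus>\<^bsub>tensor_module K A A\<^esub>i\<in>{..deg K q}. (up_ring.coeff P q i \<odot>\<^bsub>TA\<^esub> \<one>\<^bsub>TA\<^esub>) \<otimes>\<^bsub>TA\<^esub> ?tm (comult H (x [^] i)))"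
      by (simp add: s_pow) (simp add: TA_def finsum_tensor_algebra)
    also have "\<dots> = (\<Oplus>\<^bsub>tensor_module K A A\<^esub>i\<in>{..deg K q}. ?tm (comult H (up_ring.coeff P q i \<odot> x [^] i)))"
    proof (rule TM.finsum_cong')
      show "(\<lambda>i. ?tm (comult H (up_ring.coeff P q i \<odot> x [^] i))) \<in> {..deg K q} \<rightarrow> carrier (tensor_module K A A)"
        by (intro Pi_I module_homD(1)[OF tm] comult_closed smult_closed cq) simp
      fix i
      have "(up_ring.coeff P q i \<odot>\<^bsub>TA\<^esub> \<one>\<^bsub>TA\<^esub>) \<otimes>\<^bsub>TA\<^esub> ?tm (comult H (x [^] i)) = up_ring.coeff P q i \<odot>\<^bsub>TA\<^esub> (\<one>\<^bsub>TA\<^esub> \<otimes>\<^bsub>TA\<^esub> ?tm (comult H (x [^] i)))"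
        using module_homD(3)[OF bilinear_mapD(1)[OF tbA tmc] cq AA.pure_closed[OF A_one_closed A_one_closed]]
        by (simp add: TA_def)
      also have "\<dots> = ?tm (comult H (up_ring.coeff P q i \<odot> x [^] i))"
        by (simp add: TA_one tmc) (simp add: TA_def module_homD(3)[OF comult_hom] module_homD(3)[OF tm] cq comult_closed)
      finally show "(up_ring.coeff P q i \<odot>\<^bsub>TA\<^esub> \<one>\<^bsub>TA\<^esub>) \<otimes>\<^bsub>TA\<^esub> ?tm (comult H (x [^] i)) = ?tm (comult H (up_ring.coeff P q i \<odot> x [^] i))" .
    qed simp
    also have "\<dots> = ?tm (comult H (\<Oplus>i\<in>{..deg K q}. up_ring.coeff P q i \<odot> x [^] i))"
      by (rule module_hom_finsum[OF H_module AA.tensor_module_module module_hom_comp[OF comult_hom tm], symmetric])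
         (use cq in auto)
    finally show ?thesis by (simp add: ev_sum[OF q(1), symmetric] q(2) tmL)
  qed
  have cou: "counit L (\<Theta> h) = counit H h" if h: "h \<in> carrier H" for h
  proof -
    define q where "q = (SOME q. q \<in> \<Theta> h)"
    have q: "q \<in> carrier P" "ev q = h" using some[OF h] unfolding \<Theta>_def q_def by blast+
    have cq: "up_ring.coeff P q i \<in> carrier K" for i using q(1) U.coeff_closed by (simp add: P_def)
    \<comment> \<open>The case i = 0 is covered by 0^0 = 1, so evaluation at 0 keeps the constant
      term.\<close>
    have cpow: "counit H (x [^] i) = \<zero>\<^bsub>K\<^esub> [^]\<^bsub>K\<^esub> i" for i :: nat
      by (induction i) (simp_all add: counit_one counit_mult counit_x)
    have "counit L (\<Theta> h) = (\<Oplus>\<^bsub>K\<^esub>i\<in>{..deg K q}. up_ring.coeff P q i \<otimes>\<^bsub>K\<^esub> \<zero>\<^bsub>K\<^esub> [^]\<^bsub>K\<^esub> i)"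
      using q(1) unfolding L_sel q_def[symmetric] by (simp add: U.eval_on_carrier P_def)
    then have "\<phi> (counit L (\<Theta> h)) = \<phi> (\<Oplus>\<^bsub>K\<^esub>i\<in>{..deg K q}. up_ring.coeff P q i \<otimes>\<^bsub>K\<^esub> \<zero>\<^bsub>K\<^esub> [^]\<^bsub>K\<^esub> i)" by simp
    also have "\<dots> = (\<Sum>i\<le>deg K q. \<phi> (up_ring.coeff P q i \<otimes>\<^bsub>K\<^esub> \<zero>\<^bsub>K\<^esub> [^]\<^bsub>K\<^esub> i))"
    proof -
      have "\<phi> (\<Oplus>\<^bsub>K\<^esub>i\<in>B. g i) = (\<Sum>i\<in>B. \<phi> (g i))" if "finite B" "\<And>i. g i \<in> carrier K" for B and g :: "nat \<Rightarrow> 'k"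
        using that by (induction B rule: finite_induct) (simp_all add: \<phi>_add Pi_iff)
      then show ?thesis using cq by simp
    qed
    also have "\<dots> = (\<Sum>i\<le>deg K q. \<phi> (counit H (up_ring.coeff P q i \<odot> x [^] i)))"
      by (simp add: counit_linear cq cpow)
    also have "\<dots> = \<phi> (counit H (\<Oplus>i\<in>{..deg K q}. up_ring.coeff P q i \<odot> x [^] i))"
      by (subst module_hom_finsum[OF H_module F_module counit_functional]) (use cq in \<open>auto simp: finsum_F\<close>)
    finally have "\<phi> (counit L (\<Theta> h)) = \<phi> (counit H h)" by (simp add: ev_sum[OF q(1), symmetric] q(2))
    moreover have "counit L (\<Theta> h) \<in> carrier K"
      unfolding \<open>counit L (\<Theta> h) = _\<close> using cq by (intro R.finsum_closed) auto
    ultimately show ?thesis using counit_closed[OF h] by (simp add: \<phi>_eq_iff)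
  qed
  have ant: "antipode L (\<Theta> h) = \<Theta> (antipode H h)" if h: "h \<in> carrier H" for h
  proof -
    define q where "q = (SOME q. q \<in> \<Theta> h)"
    have q: "q \<in> carrier P" "ev q = h" using some[OF h] unfolding \<Theta>_def q_def by blast+
    have cq: "up_ring.coeff P q i \<in> carrier K" for i using q(1) U.coeff_closed by (simp add: P_def)
    have "\<Theta> (\<ominus> x) \<oplus>\<^bsub>A\<^esub> \<Theta> x = \<zero>\<^bsub>A\<^esub>"
      using module_hom_zero[OF H_module AM \<Theta>_hom] by (simp add: module_homD(2)[OF \<Theta>_hom, symmetric] M.l_neg)
    then have mxb: "\<ominus>\<^bsub>A\<^esub> xb = \<Theta> (\<ominus> x)"
      unfolding xb by (intro AM.M.minus_equality) (simp_all add: \<Theta>_closed)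
    have "antipode L (\<Theta> h) = (\<Oplus>\<^bsub>A\<^esub>i\<in>{..deg K q}. (up_ring.coeff P q i \<odot>\<^bsub>A\<^esub> \<one>\<^bsub>A\<^esub>) \<otimes>\<^bsub>A\<^esub> (\<ominus>\<^bsub>A\<^esub> xb) [^]\<^bsub>A\<^esub> i)"
      using q(1) unfolding L_sel poly_quot_eval_def q_def[symmetric] by (simp add: U.eval_on_carrier P_def)
    also have "\<dots> = (\<Oplus>\<^bsub>A\<^esub>i\<in>{..deg K q}. \<Theta> (antipode H (up_ring.coeff P q i \<odot> x [^] i)))"
    proof (rule AM.finsum_cong')
      show "(\<lambda>i. \<Theta> (antipode H (up_ring.coeff P q i \<odot> x [^] i))) \<in> {..deg K q} \<rightarrow> carrier A"
        by (intro Pi_I \<Theta>_closed antipode_closed smult_closed cq) simp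
      fix i
      show "(up_ring.coeff P q i \<odot>\<^bsub>A\<^esub> \<one>\<^bsub>A\<^esub>) \<otimes>\<^bsub>A\<^esub> (\<ominus>\<^bsub>A\<^esub> xb) [^]\<^bsub>A\<^esub> i = \<Theta> (antipode H (up_ring.coeff P q i \<odot> x [^] i))"
        using module_homD(3)[OF bilinear_mapD(1)[OF A_mult \<Theta>_closed[of "(\<ominus> x) [^] i"]] cq A_one_closed, of i]
        by (simp add: mxb \<Theta>_powA[symmetric] A_one \<Theta>_closed module_homD(3)[OF antipode_linear] anti cq
            module_homD(3)[OF \<Theta>_hom])
    qed simp
    also have "\<dots> = \<Theta> (antipode H (\<Oplus>i\<in>{..deg K q}. up_ring.coeff P q i \<odot> x [^] i))"
      by (rule module_hom_finsum[OF H_module AM module_hom_comp[OF antipode_linear \<Theta>_hom], symmetric])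
         (use cq in auto)
    finally show ?thesis by (simp add: ev_sum[OF q(1), symmetric] q(2))
  qed
  have "\<Theta> \<in> hopf_iso K H L" using iso \<Theta>_hom_L com cou ant by (simp add: hopf_iso_def)
  then show ?thesis unfolding is_hopf_iso_def L_def by blast
qed

end

section \<open>Selecting the model from the generator\<close>

context hopf_coords begin

interpretation HC: hopf_constants mc dc uc ec sc by (rule hopf_constants_coords)

theorem classification_by_generator:
  assumes p: "Factorial_Ring.prime CARD('n)" "of_nat CARD('n) = (0::'f)"
    and root: "\<And>a::'f. \<exists>c. c ^ (CARD('n) - 1) = a"
  shows "is_hopf_iso K H (group_hopf_algebra K (integer_mod_group CARD('n)))
    \<or> is_hopf_iso K H (primitive_hopf_algebra K (poly_var K [^]\<^bsub>UP K\<^esub> CARD('n)))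
    \<or> is_hopf_iso K H (primitive_hopf_algebra K (poly_var K [^]\<^bsub>UP K\<^esub> CARD('n) \<ominus>\<^bsub>UP K\<^esub> poly_var K))"
proof -
  have p1: "1 < CARD('n)" using p(1) by (rule prime_gt_1_nat)
  have basis: "\<exists>\<gamma>. power_basis K H \<phi> b \<xi> x \<gamma> CARD('n)"
    if x: "x \<in> carrier H" and ind: "fam_indep (HC.pw (co x)) CARD('n)" for x
  proof -
    obtain \<gamma> where "\<And>i. \<gamma> i \<in> module_hom K H F"
      "\<And>i j. i < CARD('n) \<Longrightarrow> j < CARD('n) \<Longrightarrow> \<gamma> i (x [^] j) = (if i = j then 1 else 0)"
      "\<And>h. h \<in> carrier H \<Longrightarrow> h = (\<Oplus>i\<in>{..<CARD('n)}. \<psi> (\<gamma> i h) \<odot> x [^] i)"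
      using power_coords[OF x ind] by blast
    then have "power_basis K H \<phi> b \<xi> x \<gamma> CARD('n)"
      by (intro power_basis.intro power_basis_axioms.intro hopf_coords_axioms x p1)
    then show ?thesis by blast
  qed
  consider g where "HC.group_gen g" | z where "HC.prim_gen z"
    using HC.prime_dimension_generator[OF p root] by blast
  then show ?thesis
  proof cases
    case 1
    obtain x where x: "x \<in> carrier H" "co x = g" using co_surj by blast
    have g: "HC.group_gen (co x)" using 1 x by simp
    then obtain \<gamma> where "power_basis K H \<phi> b \<xi> x \<gamma> CARD('n)"
      using basis[OF x(1)] by (auto simp: HC.group_gen_def)
    then interpret PB: power_basis K H \<phi> b \<xi> x \<gamma> "CARD('n)" .
    have gl: "HC.glike (co x)" using g by (simp add: HC.group_gen_def)
    show ?thesis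
      using PB.group_algebra_iso[OF glike_record[OF x(1) gl] group_gen_record[OF x(1) g]] by blast
  next
    case 2
    interpret dom: Ring.domain K by unfold_locales
    interpret U: UP_domain K "UP K" by unfold_locales simp
    obtain x where x: "x \<in> carrier H" "co x = z" using co_surj by blast
    have g: "HC.prim_gen (co x)" using 2 x by simp
    then obtain \<gamma> where "power_basis K H \<phi> b \<xi> x \<gamma> CARD('n)"
      using basis[OF x(1)] by (auto simp: HC.prim_gen_def)
    then interpret PB: power_basis K H \<phi> b \<xi> x \<gamma> "CARD('n)" .
    interpret Hc: cring H by (rule PB.H_cring)
    have c1: "(\<lambda>c. c \<odot> \<one>) \<in> ring_hom K H"
      by (rule ring_hom_memI) (auto simp: smult_l_distr smult_mult_left smult_assoc1)
    interpret E: UP_pre_univ_prop K H "\<lambda>c. c \<odot> \<one>" "UP K"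
      by (intro UP_pre_univ_prop.intro ring_hom_cring.intro ring_hom_cring_axioms.intro c1)
         (unfold_locales)
    define P where "P = UP K"
    define ev where "ev = UnivPoly.eval K H (\<lambda>c. c \<odot> \<one>) x"
    have ev_hom: "ev \<in> ring_hom P H" unfolding ev_def P_def by (rule E.eval_ring_hom) (rule x)
    have ev_monom: "ev (up_ring.monom P \<one>\<^bsub>K\<^esub> i) = x [^] i" for i
      unfolding ev_def P_def using x by (subst E.eval_monom) auto
    let ?X = "up_ring.monom P \<one>\<^bsub>K\<^esub>"
    have X: "?X i \<in> carrier P" for i by (simp add: P_def)
    have pow: "poly_var K [^]\<^bsub>P\<^esub> CARD('n) = ?X CARD('n)"
      unfolding P_def poly_var_def by (subst U.monom_pow) simp_all
    have var: "poly_var K = ?X 1" by (simp add: poly_var_def P_def)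
    have coX: "up_ring.coeff P (?X i) j = (if i = j then \<one>\<^bsub>K\<^esub> else \<zero>\<^bsub>K\<^esub>)" for i j
      by (simp add: P_def)
    have pr: "HC.primitive (co x)" using g by (simp add: HC.prim_gen_def)
    note pc = PB.primitive_hopf_algebra_iso[OF primitive_record[OF x(1) pr] prim_gen_record(2)[OF x(1) g], folded P_def ev_def]
    from prim_gen_record(1)[OF x(1) g] show ?thesis
    proof
      assume 0: "x [^] CARD('n) = \<zero>"
      have "is_hopf_iso K H (primitive_hopf_algebra K (poly_var K [^]\<^bsub>P\<^esub> CARD('n)))"
        unfolding pow by (rule pc) (simp_all add: X coX ev_monom 0)
      then show ?thesis unfolding P_def by blast
    next
      assume 1: "x [^] CARD('n) = x"
      interpret Pr: cring P unfolding P_def by (rule U.P.is_cring)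
      let ?f = "?X CARD('n) \<ominus>\<^bsub>P\<^esub> ?X 1"
      have fP: "?f \<in> carrier P" by (simp add: X Pr.minus_closed)
      have cof: "up_ring.coeff P ?f j = up_ring.coeff P (?X CARD('n)) j \<ominus>\<^bsub>K\<^esub> up_ring.coeff P (?X 1) j" for j
        unfolding P_def by (rule U.coeff_minus) simp_all
      have "?f \<oplus>\<^bsub>P\<^esub> ?X 1 = ?X CARD('n)" using X[of "CARD('n)"] X[of 1]
        by (simp add: a_minus_def Pr.a_assoc Pr.l_neg)
      then have "ev ?f \<oplus> ev (?X 1) = ev (?X CARD('n))" using ring_hom_add[OF ev_hom fP X[of 1]] by simp
      then have "ev ?f \<oplus> x = \<zero> \<oplus> x" using x by (simp add: ev_monom 1)
      then have ev0: "ev ?f = \<zero>" using x ring_hom_closed[OF ev_hom fP] M.add.right_cancel[of x "ev ?f" \<zero>] by simp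
      have "is_hopf_iso K H (primitive_hopf_algebra K (poly_var K [^]\<^bsub>P\<^esub> CARD('n) \<ominus>\<^bsub>P\<^esub> poly_var K))"
        unfolding pow unfolding var using p1 by (intro pc) (simp_all add: fP cof coX ev0 R.minus_eq del: One_nat_def)
      then show ?thesis unfolding P_def by blast
    qed
  qed
qed

end

section \<open>Reduction to a field type\<close>

lemma (in algebraically_closed) nth_root_exists:
  fixes n :: nat
  assumes a: "a \<in> carrier L" and n: "0 < n"
  shows "\<exists>c\<in>carrier L. c [^] n = a"
proof -
  \<comment> \<open>Coefficients are listed from the top: this is X^n - a, which splits into n > 0
    roots.\<close>
  let ?P = "\<one> # replicate (n - 1) \<zero> @ [\<ominus> a]"
  have P: "?P \<in> carrier (poly_ring L)"
    using a by (auto simp: univ_poly_carrier[symmetric] polynomial_def)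
  then have "size (roots ?P) = n"
    using roots_over_carrier[OF P] n by (simp add: splitted_def)
  then obtain c where "c \<in># roots ?P" using n by (metis multiset_nonemptyE nat_less_le size_empty)
  then have c: "c \<in> carrier L" "eval ?P c = \<zero>"
    using roots_mem_iff_is_root[OF P] by (auto simp: is_root_def)
  have e: "eval ?P c = c [^] n \<ominus> a"
    using a c(1) n eval_replicate[of "[\<ominus> a]" c "n - 1"] by (simp add: a_minus_def)
  have "c [^] n \<ominus> a = \<zero>" using e c(2) by (rule subst)
  then have "c [^] n = a" using a c(1) r_right_minus_eq[of "c [^] n" a] by blast
  then show ?thesis using c(1) by blast
qed

lemma hopf_coords_exist:
  fixes K :: "('k, 'm) ring_scheme" and H :: "('k, 'h, 'q) hopf_algebra_scheme" (structure)
    and \<phi> :: "'k \<Rightarrow> 'f::field"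
  assumes hopf: "hopf_algebra K H"
    and fd: "vectorspace.fin_dim K H" and dm: "vectorspace.dim K H = CARD('n::finite)"
    and pbij: "bij_betw \<phi> (carrier K) UNIV"
    and padd: "\<And>x y. \<lbrakk>x \<in> carrier K; y \<in> carrier K\<rbrakk> \<Longrightarrow> \<phi> (x \<oplus>\<^bsub>K\<^esub> y) = \<phi> x + \<phi> y"
    and pmult: "\<And>x y. \<lbrakk>x \<in> carrier K; y \<in> carrier K\<rbrakk> \<Longrightarrow> \<phi> (x \<otimes>\<^bsub>K\<^esub> y) = \<phi> x * \<phi> y"
  shows "\<exists>(b :: 'n \<Rightarrow> 'h) \<xi>. hopf_coords K H \<phi> b \<xi>"
proof -
  interpret hopf_algebra K H by fact
  obtain B where B: "finite B" "basis B" using finite_basis_exists[OF fd] by blast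
  then have BH: "B \<subseteq> carrier H" by (simp add: basis_def)
  have "card B = CARD('n)" using dim_basis[OF B] dm by simp
  then obtain b :: "'n \<Rightarrow> 'h" where b: "bij_betw b UNIV B"
    using finite_same_card_bij[OF finite_class.finite_UNIV B(1)] by metis
  then have bB: "b i \<in> B" for i by (auto simp: bij_betw_def)
  then have bH: "b i \<in> carrier H" for i using BH by blast
  have unique: "\<exists>!a. a \<in> B \<rightarrow>\<^sub>E carrier K \<and> lincomb a B = v" if "v \<in> carrier H" for v
    using basis_criterion[OF B(1) BH] B(2) that by blast
  \<comment> \<open>Uniqueness of coordinates holds for functions extensional outside B;
    \<open>cfI\<close> lifts this to arbitrary coefficient functions, compared on B alone.\<close>
  define cf where "cf v = (THE a. a \<in> B \<rightarrow>\<^sub>E carrier K \<and> lincomb a B = v)" for v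
  have cf: "cf v \<in> B \<rightarrow>\<^sub>E carrier K" "lincomb (cf v) B = v" if "v \<in> carrier H" for v
    using theI'[OF unique[OF that]] by (simp_all add: cf_def)
  have cfI: "cf v w = a w" if v: "v \<in> carrier H" and w: "w \<in> B" and a: "a \<in> B \<rightarrow> carrier K" and "lincomb a B = v" for v w a
  proof -
    have "restrict a B \<in> B \<rightarrow>\<^sub>E carrier K" using a by auto
    moreover have "lincomb (restrict a B) B = v"
      unfolding that(4)[symmetric] using a BH by (intro lincomb_cong) auto
    ultimately have "cf v = restrict a B" using unique[OF v] cf[OF v] by blast
    then show ?thesis using w by simp
  qed
  have cfc: "cf v w \<in> carrier K" if "v \<in> carrier H" "w \<in> B" for v w using cf(1)[OF that(1)] that(2) by auto
  have cf_add: "cf (v \<oplus> v') w = cf v w \<oplus>\<^bsub>K\<^esub> cf v' w" if v: "v \<in> carrier H" "v' \<in> carrier H" and w: "w \<in> B" for v v' w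
  proof (rule cfI)
    have "lincomb (\<lambda>w. cf v w \<oplus>\<^bsub>K\<^esub> cf v' w) B = (\<Oplus>w\<in>B. cf v w \<odot> w \<oplus> cf v' w \<odot> w)"
      unfolding lincomb_def using v cfc BH by (intro M.finsum_cong') (auto simp: smult_l_distr)
    also have "\<dots> = lincomb (cf v) B \<oplus> lincomb (cf v') B"
      unfolding lincomb_def using v cfc BH by (intro M.finsum_addf) auto
    finally show "lincomb (\<lambda>w. cf v w \<oplus>\<^bsub>K\<^esub> cf v' w) B = v \<oplus> v'" using v by (simp add: cf)
  qed (use v w cfc in auto)
  have cf_smult: "cf (c \<odot> v) w = c \<otimes>\<^bsub>K\<^esub> cf v w" if v: "v \<in> carrier H" and c: "c \<in> carrier K" and w: "w \<in> B" for v c w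
  proof (rule cfI)
    show "lincomb (\<lambda>w. c \<otimes>\<^bsub>K\<^esub> cf v w) B = c \<odot> v"
      using lincomb_smult[of B "cf v" c] v c cfc BH by (simp add: cf Pi_def)
  qed (use v w c cfc in auto)
  have phi0: "\<phi> \<zero>\<^bsub>K\<^esub> = 0" by (metis padd R.zero_closed R.l_zero add_cancel_left_left)
  have phi1: "\<phi> \<one>\<^bsub>K\<^esub> = 1"
  proof -
    have dom: "Ring.domain K" by unfold_locales
    have "\<phi> \<one>\<^bsub>K\<^esub> \<noteq> \<phi> \<zero>\<^bsub>K\<^esub>"
      using inj_onD[OF bij_betw_imp_inj_on[OF pbij], of "\<one>\<^bsub>K\<^esub>" "\<zero>\<^bsub>K\<^esub>"] Ring.domain.one_not_zero[OF dom] by auto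
    then have "\<phi> \<one>\<^bsub>K\<^esub> \<noteq> 0" by (simp add: phi0)
    then show ?thesis using pmult[of "\<one>\<^bsub>K\<^esub>" "\<one>\<^bsub>K\<^esub>"] by simp
  qed
  have cf_b: "cf (b j) (b i) = (if i = j then \<one>\<^bsub>K\<^esub> else \<zero>\<^bsub>K\<^esub>)" for i j
  proof -
    let ?a = "\<lambda>w. if w = b j then \<one>\<^bsub>K\<^esub> else \<zero>\<^bsub>K\<^esub>"
    have "lincomb ?a B = (\<Oplus>w\<in>B. if b j = w then w else \<zero>)"
      unfolding lincomb_def using BH by (intro M.finsum_cong') (auto simp: smult_l_null)
    also have "\<dots> = b j" using B(1) BH bB[of j] by (subst M.finsum_singleton) auto
    finally have "cf (b j) (b i) = ?a (b i)" using BH bB by (intro cfI) auto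
    moreover have "b i = b j \<longleftrightarrow> i = j" using b by (auto simp: bij_betw_def inj_on_def)
    ultimately show ?thesis by simp
  qed
  define \<xi> where "\<xi> i v = \<phi> (cf v (b i))" for i v
  have "hopf_coords K H \<phi> b \<xi>"
  proof (unfold_locales)
    show "\<xi> i \<in> module_hom K H (scalar_module \<phi>)" for i
      by (rule module_homI) (simp_all add: \<xi>_def cf_add cf_smult cfc bB padd pmult)
    show "\<xi> i (b j) = (if i = j then 1 else 0)" for i j by (simp add: \<xi>_def cf_b phi0 phi1)
    show "h = (\<Oplus>i\<in>UNIV. inv_into (carrier K) \<phi> (\<xi> i h) \<odot> b i)" if h: "h \<in> carrier H" for h
    proof -
      have "h = (\<Oplus>w\<in>b ` UNIV. cf h w \<odot> w)" using cf(2)[OF h] b by (simp add: lincomb_def bij_betw_def)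
      also have "\<dots> = (\<Oplus>i\<in>UNIV. cf h (b i) \<odot> b i)"
        using b h cfc BH bB by (subst M.finsum_reindex) (auto simp: bij_betw_def)
      also have "\<dots> = (\<Oplus>i\<in>UNIV. inv_into (carrier K) \<phi> (\<xi> i h) \<odot> b i)"
        using h bH bB pbij
        by (intro M.finsum_cong') (auto simp: \<xi>_def bij_betw_inv_into_left cfc intro!: smult_closed)
      finally show ?thesis .
    qed
  qed (use pbij padd pmult bH in auto)
  then show ?thesis by blast
qed

text \<open>The clause i = 0 keeps the set non-empty for n = 0, so that it can define a type
  whatever \<open>chosen\<close> is.\<close>

lemma finite_index_card:
  fixes n :: nat shows "finite {i. i < n \<or> i = 0}" "0 < n \<Longrightarrow> card {i. i < n \<or> i = 0} = n"
proof -
  have "{i. i < n \<or> i = 0} = {..<max n 1}" by (auto simp: max_def)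
  then show "finite {i. i < n \<or> i = 0}" "0 < n \<Longrightarrow> card {i. i < n \<or> i = 0} = n" by simp_all
qed

text \<open>
  The coordinates above live in types of class \<open>field\<close> and \<open>finite\<close>, which cannot depend on the
  variables $K$ and $p$ of the theorem. They can depend on constants, though: if the theorem fails
  at the given types, one counterexample is chosen once and for all, and its field and the index set
  $\{0, \dots, p-1\}$ are made into types. The counterexample is then refuted in these coordinates.
\<close>

definition counterexample ::
    "('k, 'm) ring_scheme \<Rightarrow> ('k, 'h, 'n) hopf_algebra_scheme \<Rightarrow> nat \<Rightarrow> bool"
  where "counterexample K H p \<longleftrightarrow> Factorial_Ring.prime p \<and> algebraically_closed K \<and> ring_char K = p
    \<and> hopf_algebra K H \<and> vectorspace.fin_dim K H \<and> vectorspace.dim K H = p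
    \<and> \<not> (is_hopf_iso K H (group_hopf_algebra K (integer_mod_group p))
      \<or> is_hopf_iso K H (primitive_hopf_algebra K (poly_var K [^]\<^bsub>UP K\<^esub> p))
      \<or> is_hopf_iso K H (primitive_hopf_algebra K (poly_var K [^]\<^bsub>UP K\<^esub> p \<ominus>\<^bsub>UP K\<^esub> poly_var K)))"

definition chosen :: "('k, 'm) ring_scheme \<times> ('k, 'h, 'n) hopf_algebra_scheme \<times> nat"
  where "chosen = (SOME (K, H, p). counterexample K H p)"

definition rat_ring :: "rat ring"
  where "rat_ring = \<lparr>carrier = UNIV, monoid.mult = (*), one = 1, ring.zero = 0, add = (+)\<rparr>"

lemma rat_ring_field: "Ring.field rat_ring"
proof -
  have "cring rat_ring"
    by (intro cringI abelian_groupI comm_monoidI)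
       (auto simp: rat_ring_def algebra_simps intro: exI[of _ "- _ :: rat"])
  moreover have "Units rat_ring = carrier rat_ring - {\<zero>\<^bsub>rat_ring\<^esub>}"
    by (auto simp: Units_def rat_ring_def intro: exI[of _ "1 / _ :: rat"])
  ultimately show ?thesis by (rule cring.cring_fieldI)
qed

text \<open>Without a counterexample \<^const>\<open>chosen\<close> is arbitrary, and the rationals serve as a dummy.\<close>

definition scalar_ring :: "('k \<times> 'm \<times> 'h \<times> 'n) itself \<Rightarrow> ('k + rat) ring"
  where "scalar_ring _ = (let K = fst (chosen :: ('k, 'm) ring_scheme \<times> ('k, 'h, 'n) hopf_algebra_scheme \<times> nat)
    in if Ring.field K then image_ring Inl K else image_ring Inr rat_ring)"

lemma scalar_ring_field: "Ring.field (scalar_ring TYPE('k \<times> 'm \<times> 'h \<times> 'n))"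
  using rat_ring_field by (auto simp: scalar_ring_def Let_def intro!: field.inj_imp_image_ring_is_field)

typedef ('k, 'm, 'h, 'n) scalar = "carrier (scalar_ring TYPE('k \<times> 'm \<times> 'h \<times> 'n))"
proof -
  interpret Ring.field "scalar_ring TYPE('k \<times> 'm \<times> 'h \<times> 'n)" by (rule scalar_ring_field)
  show ?thesis using zero_closed by blast
qed

instantiation scalar :: (type, type, type, type) field
begin

definition "0 = Abs_scalar \<zero>\<^bsub>scalar_ring TYPE('a \<times> 'b \<times> 'c \<times> 'd)\<^esub>"
definition "1 = Abs_scalar \<one>\<^bsub>scalar_ring TYPE('a \<times> 'b \<times> 'c \<times> 'd)\<^esub>"
definition "x + y = Abs_scalar (Rep_scalar x \<oplus>\<^bsub>scalar_ring TYPE('a \<times> 'b \<times> 'c \<times> 'd)\<^esub> Rep_scalar y)"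
definition "x * y = Abs_scalar (Rep_scalar x \<otimes>\<^bsub>scalar_ring TYPE('a \<times> 'b \<times> 'c \<times> 'd)\<^esub> Rep_scalar y)"
definition "- x = Abs_scalar (\<ominus>\<^bsub>scalar_ring TYPE('a \<times> 'b \<times> 'c \<times> 'd)\<^esub> Rep_scalar x)"
definition "x - y = Abs_scalar (Rep_scalar x \<ominus>\<^bsub>scalar_ring TYPE('a \<times> 'b \<times> 'c \<times> 'd)\<^esub> Rep_scalar y)"
text \<open>The class \<open>field\<close> demands that the inverse of 0 be 0, which the ring
  inverse does not guarantee.\<close>

definition "inverse x = (if x = 0 then 0
  else Abs_scalar (inv\<^bsub>scalar_ring TYPE('a \<times> 'b \<times> 'c \<times> 'd)\<^esub> Rep_scalar x))"
definition divide_scalar :: "('a, 'b, 'c, 'd) scalar \<Rightarrow> _" where "divide_scalar x y = x * inverse y"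

instance
proof
  let ?R = "scalar_ring TYPE('a \<times> 'b \<times> 'c \<times> 'd)"
  interpret R: Ring.field ?R by (rule scalar_ring_field)
  note rep = Rep_scalar_inject[symmetric]
  have [simp]: "Rep_scalar x \<in> carrier ?R" for x :: "('a, 'b, 'c, 'd) scalar" by (rule Rep_scalar)
  have [simp]: "Rep_scalar (0 :: ('a, 'b, 'c, 'd) scalar) = \<zero>\<^bsub>?R\<^esub>"
    "Rep_scalar (1 :: ('a, 'b, 'c, 'd) scalar) = \<one>\<^bsub>?R\<^esub>"
    "Rep_scalar (x + y) = Rep_scalar x \<oplus>\<^bsub>?R\<^esub> Rep_scalar y"
    "Rep_scalar (x * y) = Rep_scalar x \<otimes>\<^bsub>?R\<^esub> Rep_scalar y"
    "Rep_scalar (- x) = \<ominus>\<^bsub>?R\<^esub> Rep_scalar x"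
    "Rep_scalar (x - y) = Rep_scalar x \<ominus>\<^bsub>?R\<^esub> Rep_scalar y"
    for x y :: "('a, 'b, 'c, 'd) scalar"
    by (simp_all add: zero_scalar_def one_scalar_def plus_scalar_def times_scalar_def uminus_scalar_def
        minus_scalar_def Abs_scalar_inverse)
  fix x y z :: "('a, 'b, 'c, 'd) scalar"
  show "x * y * z = x * (y * z)" by (simp add: rep R.m_assoc)
  show "x * y = y * x" by (simp add: rep R.m_comm)
  show "1 * x = x" by (simp add: rep)
  show "x + y + z = x + (y + z)" by (simp add: rep R.a_assoc)
  show "x + y = y + x" by (simp add: rep R.a_comm)
  show "0 + x = x" by (simp add: rep)
  show "- x + x = 0" by (simp add: rep R.l_neg)
  show "x - y = x + - y" by (simp add: rep R.minus_eq)
  show "(x + y) * z = x * z + y * z" by (simp add: rep R.l_distr)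
  show "(0 :: ('a, 'b, 'c, 'd) scalar) \<noteq> 1" by (simp add: rep)
  show "inverse x * x = 1" if "x \<noteq> 0"
  proof -
    have "Rep_scalar x \<in> Units ?R" using that by (simp add: rep R.field_Units)
    then show ?thesis using that by (simp add: inverse_scalar_def rep Abs_scalar_inverse)
  qed
  show "inverse (0 :: ('a, 'b, 'c, 'd) scalar) = 0" by (simp add: inverse_scalar_def)
  show "x div y = x * inverse y" by (simp add: divide_scalar_def)
qed

end

typedef ('k, 'm, 'h, 'n) index =
  "{i. i < snd (snd (chosen :: ('k, 'm) ring_scheme \<times> ('k, 'h, 'n) hopf_algebra_scheme \<times> nat)) \<or> i = 0}"
  by blast

instance index :: (type, type, type, type) finite
  by standard
     (use type_definition.univ[OF type_definition_index] finite_index_card(1) in \<open>metis finite_imageI\<close>)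

lemma card_index:
  assumes "chosen = (K :: ('k, 'm) ring_scheme, H :: ('k, 'h, 'n) hopf_algebra_scheme, p)" "0 < p"
  shows "CARD(('k, 'm, 'h, 'n) index) = p"
proof -
  have "CARD(('k, 'm, 'h, 'n) index)
      = card {i. i < snd (snd (chosen :: ('k, 'm) ring_scheme \<times> ('k, 'h, 'n) hopf_algebra_scheme \<times> nat)) \<or> i = 0}"
    by (rule type_definition.card[OF type_definition_index])
  then show ?thesis by (simp add: assms finite_index_card(2))
qed

lemma chosen_counterexample:
  fixes K :: "('k, 'm) ring_scheme" and H :: "('k, 'h, 'n) hopf_algebra_scheme"
  assumes "counterexample K H p"
  obtains K0 :: "('k, 'm) ring_scheme" and H0 :: "('k, 'h, 'n) hopf_algebra_scheme" and p0
  where "chosen = (K0, H0, p0)" "counterexample K0 H0 p0"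
proof -
  let ?P = "\<lambda>(K :: ('k, 'm) ring_scheme, H :: ('k, 'h, 'n) hopf_algebra_scheme, p). counterexample K H p"
  have "?P (K, H, p)" using assms by simp
  then have "?P chosen" unfolding chosen_def by (rule someI)
  then show thesis using that by (cases chosen) auto
qed

text \<open>With K a field, \<open>scalar_ring\<close> is its copy in the left summand, and \<phi>
  is that embedding followed by the abstraction map of the type.\<close>

lemma scalar_iso:
  assumes chosen: "chosen = (K :: ('k, 'm) ring_scheme, H :: ('k, 'h, 'n) hopf_algebra_scheme, p)" and K: "Ring.field K"
  shows "\<exists>\<phi> :: 'k \<Rightarrow> ('k, 'm, 'h, 'n) scalar. bij_betw \<phi> (carrier K) UNIV \<and>
    (\<forall>x\<in>carrier K. \<forall>y\<in>carrier K. \<phi> (x \<oplus>\<^bsub>K\<^esub> y) = \<phi> x + \<phi> y \<and> \<phi> (x \<otimes>\<^bsub>K\<^esub> y) = \<phi> x * \<phi> y)"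
proof -
  let ?R = "scalar_ring TYPE('k \<times> 'm \<times> 'h \<times> 'n)"
  have "?R = image_ring Inl K" using K by (simp add: scalar_ring_def chosen)
  then have iso: "Inl \<in> ring_iso K ?R"
    using inj_imp_image_ring_iso[of Inl K] by simp
  have b: "bij_betw (Abs_scalar :: _ \<Rightarrow> ('k, 'm, 'h, 'n) scalar) (carrier ?R) UNIV"
    by (rule bij_betw_byWitness[of _ Rep_scalar]) (auto simp: Abs_scalar_inverse Rep_scalar_inverse Rep_scalar)
  let ?f = "\<lambda>x. Abs_scalar (Inl x) :: ('k, 'm, 'h, 'n) scalar"
  have "bij_betw ?f (carrier K) UNIV"
    using bij_betw_trans[OF _ b, of Inl "carrier K"] iso by (simp add: ring_iso_def o_def)
  moreover have "?f (x \<oplus>\<^bsub>K\<^esub> y) = ?f x + ?f y \<and> ?f (x \<otimes>\<^bsub>K\<^esub> y) = ?f x * ?f y"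
    if "x \<in> carrier K" "y \<in> carrier K" for x y
    using iso that by (simp add: ring_iso_def ring_hom_def Pi_iff plus_scalar_def times_scalar_def Abs_scalar_inverse)
  ultimately show ?thesis by blast
qed

text \<open>The theorem for a field and a dimension that are already represented by types: \<phi>
  carries the characteristic and the roots of degree p - 1 over to the field type.\<close>

lemma prime_dimension_classification:
  fixes K :: "('k, 'm) ring_scheme" and H :: "('k, 'h, 'q) hopf_algebra_scheme"
    and \<phi> :: "'k \<Rightarrow> 'f::field"
  assumes p: "Factorial_Ring.prime CARD('n::finite)" and closed: "algebraically_closed K"
    and char: "ring_char K = CARD('n)" and hopf: "hopf_algebra K H"
    and fd: "vectorspace.fin_dim K H" and dm: "vectorspace.dim K H = CARD('n)"
    and pbij: "bij_betw \<phi> (carrier K) UNIV"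
    and padd: "\<And>x y. \<lbrakk>x \<in> carrier K; y \<in> carrier K\<rbrakk> \<Longrightarrow> \<phi> (x \<oplus>\<^bsub>K\<^esub> y) = \<phi> x + \<phi> y"
    and pmult: "\<And>x y. \<lbrakk>x \<in> carrier K; y \<in> carrier K\<rbrakk> \<Longrightarrow> \<phi> (x \<otimes>\<^bsub>K\<^esub> y) = \<phi> x * \<phi> y"
  shows "is_hopf_iso K H (group_hopf_algebra K (integer_mod_group CARD('n)))
    \<or> is_hopf_iso K H (primitive_hopf_algebra K (poly_var K [^]\<^bsub>UP K\<^esub> CARD('n)))
    \<or> is_hopf_iso K H (primitive_hopf_algebra K (poly_var K [^]\<^bsub>UP K\<^esub> CARD('n) \<ominus>\<^bsub>UP K\<^esub> poly_var K))"
proof -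
  obtain b :: "'n \<Rightarrow> 'h" and \<xi> where "hopf_coords K H \<phi> b \<xi>"
    using hopf_coords_exist[OF hopf fd dm pbij padd pmult] by blast
  then interpret HC: hopf_coords K H \<phi> b \<xi> .
  interpret L: algebraically_closed K by (rule closed)
  have pow: "\<phi> (c [^]\<^bsub>K\<^esub> i) = \<phi> c ^ i" if "c \<in> carrier K" for c and i :: nat
    using that by (induction i) (simp_all add: HC.\<phi>_one pmult)
  have nat: "\<phi> (\<one>\<^bsub>K\<^esub> [^]\<^bsub>add_monoid K\<^esub> i) = of_nat i \<and> \<one>\<^bsub>K\<^esub> [^]\<^bsub>add_monoid K\<^esub> i \<in> carrier K" for i :: nat
    by (induction i) (simp_all add: HC.\<phi>_zero HC.\<phi>_one padd nat_pow_def)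
  have "abelian_group K" by unfold_locales
  then have grp: "group (add_monoid K)" by (rule abelian_group.a_group)
  \<comment> \<open>The characteristic is the additive order of 1, so that multiple of 1
    vanishes.\<close>
  have "\<one>\<^bsub>K\<^esub> [^]\<^bsub>add_monoid K\<^esub> CARD('n) = \<zero>\<^bsub>K\<^esub>"
    using group.pow_ord_eq_1[OF grp, of "\<one>\<^bsub>K\<^esub>"] by (simp add: char[symmetric] ring_char_def)
  then have char0: "of_nat CARD('n) = (0::'f)" using nat[of "CARD('n)"] HC.\<phi>_zero by simp
  have root: "\<exists>c. c ^ (CARD('n) - 1) = a" for a :: 'f
  proof -
    obtain a' where a': "a' \<in> carrier K" "a = \<phi> a'" using pbij by (auto simp: bij_betw_def)
    obtain c where "c \<in> carrier K" "c [^]\<^bsub>K\<^esub> (CARD('n) - 1) = a'"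
      using L.nth_root_exists[OF a'(1), of "CARD('n) - 1"] prime_gt_1_nat[OF p] by auto
    then show ?thesis using pow[of c "CARD('n) - 1"] a'(2) by (intro exI[of _ "\<phi> c"]) simp
  qed
  show ?thesis by (rule HC.classification_by_generator[OF p char0 root])
qed

theorem theorem2p1:
  fixes K :: "('k, 'm) ring_scheme"
    and H :: "('k, 'h, 'n) hopf_algebra_scheme"
    and p :: nat
  assumes "Factorial_Ring.prime p"
    and "algebraically_closed K"
    and "ring_char K = p"
    and "hopf_algebra K H"
    and "vectorspace.fin_dim K H"
    and "vectorspace.dim K H = p"
  shows "is_hopf_iso K H (group_hopf_algebra K (integer_mod_group p))
    \<or> is_hopf_iso K H (primitive_hopf_algebra K (poly_var K [^]\<^bsub>UP K\<^esub> p))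
    \<or> is_hopf_iso K H (primitive_hopf_algebra K (poly_var K [^]\<^bsub>UP K\<^esub> p \<ominus>\<^bsub>UP K\<^esub> poly_var K))"
proof (rule ccontr)
  assume "\<not> ?thesis"
  then have "counterexample K H p" unfolding counterexample_def using assms by blast
  then obtain K0 :: "('k, 'm) ring_scheme" and H0 :: "('k, 'h, 'n) hopf_algebra_scheme" and p0
    where chosen: "chosen = (K0, H0, p0)" and ce: "counterexample K0 H0 p0" by (rule chosen_counterexample)
  have p0: "Factorial_Ring.prime p0" "algebraically_closed K0" "ring_char K0 = p0"
    "hopf_algebra K0 H0" "vectorspace.fin_dim K0 H0" "vectorspace.dim K0 H0 = p0"
    using ce unfolding counterexample_def by blast+
  have card: "CARD(('k, 'm, 'h, 'n) index) = p0"
    by (rule card_index[OF chosen prime_gt_0_nat[OF p0(1)]])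
  obtain \<phi> :: "'k \<Rightarrow> ('k, 'm, 'h, 'n) scalar" where \<phi>: "bij_betw \<phi> (carrier K0) UNIV"
    "\<And>x y. x \<in> carrier K0 \<Longrightarrow> y \<in> carrier K0 \<Longrightarrow> \<phi> (x \<oplus>\<^bsub>K0\<^esub> y) = \<phi> x + \<phi> y"
    "\<And>x y. x \<in> carrier K0 \<Longrightarrow> y \<in> carrier K0 \<Longrightarrow> \<phi> (x \<otimes>\<^bsub>K0\<^esub> y) = \<phi> x * \<phi> y"
    using scalar_iso[OF chosen algebraically_closed.axioms(1)[OF p0(2)]] by blast
  show False
    using prime_dimension_classification[where 'n = "('k, 'm, 'h, 'n) index", unfolded card, OF p0 \<phi>] ce
    unfolding counterexample_def by blast
qed

end
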